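(* Let $\alpha\in(\tfrac12,1)$, $h>0$, $T>0$, let $A,B\in\mathbb{R}^{n\times n}$ satisfy $AB=BA$, let $C\in\mathbb{R}^{n\times m}$ with $n>m$, and let $\Delta\in C([0,T],\mathbb{R}^{n\times n})$. The linear fractional stochastic delay system $$({}^{C}D^{\alpha}_{0^+}x)(t)=Ax(t)+Bx(t-h)+Cu(t)+\Delta(t)\frac{dW(t)}{dt},\qquad x(t)=\phi(t),\ t\in[-h,0],$$ is completely controllable on $[0,T]$ if and only if there exists $\gamma>0$ such that $$\mathbf{E}\langle\mathcal{W}_Tx,x\rangle\ge\gamma\,\mathbf{E}\|x\|^2\qquad\text{for all }x\in\mathbb{L}^2(\Omega,\mathscr{F}_T,\mathbb{R}^n).$$
   Context: $(\Omega,\mathscr{F},\{\mathscr{F}_t\}_{t\in[0,T]},\mathbf{P})$ is a filtered complete probability space satisfying the usual conditions, and $W$ is a standard $n$-dimensional Brownian motion on it (with respect to the filtration). $^{*}$ denotes transpose; $\langle\cdot,\cdot\rangle$ and $\|\cdot\|$ are Euclidean on $\mathbb{R}^n$. $U_{ad}=L_2^{\mathscr{F}}([0,T],\mathbb{R}^m)$ is the set of square-integrable $\{\mathscr{F}_t\}$-adapted controls $u$. Initial functions $\phi$ are in $C^1([-h,0],\mathbb{R}^n)$. The solution of the system corresponding to $\phi$ and $u\in U_{ad}$ is $$x(t)=\mathscr{E}^{A,B}_{h,\alpha}(t)\phi(-h)+\int_{-h}^{0}\mathscr{E}^{A,B}_{h,\alpha}(t-h-r)\phi'(r)dr+\int_0^t\mathscr{E}^{A,B}_{h,\alpha,\alpha}(t-h-r)Cu(r)dr+\int_0^t\mathscr{E}^{A,B}_{h,\alpha,\alpha}(t-h-r)\Delta(r)dW(r).$$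 Complete controllability on $[0,T]$: for every initial function $\phi$ and every $x_1\in\mathbb{L}^2(\Omega,\mathscr{F}_T,\mathbb{R}^n)$ there exists $u\in U_{ad}$ such that the solution satisfies $x(T)=x_1$. The controllability Grammian operator $\mathcal{W}_T:\mathbb{L}^2(\Omega,\mathscr{F}_T,\mathbb{R}^n)\to\mathbb{L}^2(\Omega,\mathscr{F}_T,\mathbb{R}^n)$ is $$\mathcal{W}_Tz=\int_0^T\mathscr{E}^{A,B}_{h,\alpha,\alpha}(T-h-r)CC^{*}\mathscr{E}^{A^*,B^*}_{h,\alpha,\alpha}(T-h-r)\,\mathbf{E}\{z\mid\mathscr{F}_r\}\,dr.$$ Three-parameter matrix Mittag-Leffler function: $E^{\delta}_{\alpha,\beta}(At^{\alpha})=\sum_{k=0}^\infty A^k\frac{(\delta)_k}{\Gamma(k\alpha+\beta)}\frac{t^{k\alpha}}{k!}$, with $(\delta)_k$ the Pochhammer symbol (rising factorial). Delayed Mittag-Leffler type matrix functions ($I$, $\Theta$ are the identity and zero matrices): $\mathscr{E}^{A,B}_{h,\alpha}(t)=\Theta$ for $t<-h$; $=I$ for $-h\le t\le0$; and for $(p-1)h<t\le ph$, $p\in\{1,2,\dots\}$, $$\mathscr{E}^{A,B}_{h,\alpha}(t)=I+\sum_{k=1}^{p}(t-(k-1)h)^{k\alpha}B^{k-1}E^{k}_{\alpha,k\alpha+1}(A(t-(k-1)h)^{\alpha})(A+B).$$ $\mathscr{E}^{A,B}_{h,\alpha,\beta}(t)=\Theta$ for $t\le-h$; and for $t>-h$ with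 $(p-1)h<t\le ph$, $p\in\{0,1,2,\dots\}$, $$\mathscr{E}^{A,B}_{h,\alpha,\beta}(t)=\sum_{k=0}^{p}(t-(k-1)h)^{k\alpha+\beta-1}B^{k}E^{k+1}_{\alpha,k\alpha+\beta}(A(t-(k-1)h)^{\alpha}).$$ *)

theory Defs
  imports "HOL-Probability.Probability"
begin

section \<open>Delayed Mittag-Leffler type matrix functions\<close>

text \<open>The class operation \<open>^\<close> on \<^typ>\<open>real^'n^'n\<close> is not used, since multiplication
  in the type class instance is componentwise.\<close>

definition matpow :: "real^'n^'n \<Rightarrow> nat \<Rightarrow> real^'n^'n" where
  "matpow A k = (((**) A) ^^ k) (mat 1)"

text \<open>\<open>E\<^sup>\<delta>\<^bsub>\<alpha>,\<beta>\<^esub>(X)\<close>, to be evaluated at \<open>X = A t\<^sup>\<alpha>\<close>, so that \<open>X\<^sup>k = A\<^sup>k t\<^bsup>k\<alpha>\<^esup>\<close>.\<close>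

definition mittag_leffler3 :: "real \<Rightarrow> real \<Rightarrow> real \<Rightarrow> real^'n^'n \<Rightarrow> real^'n^'n" where
  "mittag_leffler3 \<delta> \<alpha> \<beta> X =
     (\<Sum>k. (pochhammer \<delta> k / Gamma (real k * \<alpha> + \<beta>) / fact k) *\<^sub>R matpow X k)"

text \<open>The natural number \<open>p\<close> with \<open>(p - 1) h < t \<le> p h\<close>, for \<open>t > -h\<close>.\<close>

definition delay_index :: "real \<Rightarrow> real \<Rightarrow> nat" where
  "delay_index h t = nat \<lceil>t / h\<rceil>"

lemma delay_index_eqI:
  assumes "0 < h" "(real p - 1) * h < t" "t \<le> real p * h"
  shows "delay_index h t = p"
proof -
  have "\<lceil>t / h\<rceil> = int p"
    using assms by (intro ceiling_unique) (auto simp: field_simps)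
  thus ?thesis by (simp add: delay_index_def)
qed

text \<open>\<open>\<E>\<^bsup>A,B\<^esup>\<^bsub>h,\<alpha>\<^esub>\<close>\<close>

definition delayed_ML1 ::
  "real \<Rightarrow> real \<Rightarrow> real^'n^'n \<Rightarrow> real^'n^'n \<Rightarrow> real \<Rightarrow> real^'n^'n" where
  "delayed_ML1 h \<alpha> A B t =
     (if t < - h then 0
      else if t \<le> 0 then mat 1
      else mat 1 + (\<Sum>k = 1..delay_index h t.
        (t - (real k - 1) * h) powr (real k * \<alpha>) *\<^sub>R
          (matpow B (k - 1)
            ** mittag_leffler3 (real k) \<alpha> (real k * \<alpha> + 1) ((t - (real k - 1) * h) powr \<alpha> *\<^sub>R A)
            ** (A + B))))"

text \<open>\<open>\<E>\<^bsup>A,B\<^esup>\<^bsub>h,\<alpha>,\<beta>\<^esub>\<close>\<close>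

definition delayed_ML2 ::
  "real \<Rightarrow> real \<Rightarrow> real \<Rightarrow> real^'n^'n \<Rightarrow> real^'n^'n \<Rightarrow> real \<Rightarrow> real^'n^'n" where
  "delayed_ML2 h \<alpha> \<beta> A B t =
     (if t \<le> - h then 0
      else \<Sum>k = 0..delay_index h t.
        (t - (real k - 1) * h) powr (real k * \<alpha> + \<beta> - 1) *\<^sub>R
          (matpow B k
            ** mittag_leffler3 (real k + 1) \<alpha> (real k * \<alpha> + \<beta>)
                 ((t - (real k - 1) * h) powr \<alpha> *\<^sub>R A)))"


section \<open>Filtered probability space and Brownian motion\<close>

locale usual_filtered_prob_space = prob_space M + complete_measure M
  for M :: "'a measure" +
  fixes F :: "real \<Rightarrow> 'a measure" and T :: real
  assumes subalgebra_F: "t \<in> {0..T} \<Longrightarrow> subalgebra M (F t)"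
    and F_mono: "0 \<le> s \<Longrightarrow> s \<le> t \<Longrightarrow> t \<le> T \<Longrightarrow> sets (F s) \<subseteq> sets (F t)"
    and F_null_sets: "null_sets M \<subseteq> sets (F 0)"
    and F_right_continuous: "0 \<le> t \<Longrightarrow> t < T \<Longrightarrow> sets (F t) = (\<Inter>s\<in>{t<..T}. sets (F s))"

locale standard_brownian_motion = usual_filtered_prob_space M F T
  for M :: "'a measure" and F :: "real \<Rightarrow> 'a measure" and T :: real +
  fixes W :: "real \<Rightarrow> 'a \<Rightarrow> real^'n"
  assumes W_adapted: "t \<in> {0..T} \<Longrightarrow> W t \<in> borel_measurable (F t)"
    and W_zero: "AE \<omega> in M. W 0 \<omega> = 0"
    and W_continuous: "AE \<omega> in M. continuous_on {0..T} (\<lambda>t. W t \<omega>)"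
    and W_gaussian: "0 \<le> s \<Longrightarrow> s < t \<Longrightarrow> t \<le> T \<Longrightarrow>
      distributed M lborel (\<lambda>\<omega>. W t \<omega> - W s \<omega>)
        (\<lambda>x. ennreal (\<Prod>i\<in>UNIV. normal_density 0 (sqrt (t - s)) (x $ i)))"
    and W_indep: "0 \<le> s \<Longrightarrow> s < t \<Longrightarrow> t \<le> T \<Longrightarrow>
      indep_set (sets (F s)) {(\<lambda>\<omega>. W t \<omega> - W s \<omega>) -` S \<inter> space M | S. S \<in> sets borel}"


section \<open>Square-integrable variables and processes\<close>

definition L2_rv :: "'a measure \<Rightarrow> 'a measure \<Rightarrow> ('a \<Rightarrow> 'b::euclidean_space) set" where
  "L2_rv M G = {z \<in> borel_measurable G. integrable M (\<lambda>\<omega>. (norm (z \<omega>))\<^sup>2)}"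

definition L2_adapted ::
  "'a measure \<Rightarrow> (real \<Rightarrow> 'a measure) \<Rightarrow> real \<Rightarrow> (real \<Rightarrow> 'a \<Rightarrow> 'b::euclidean_space) set" where
  "L2_adapted M F b =
     {u. (\<lambda>(t, \<omega>). u t \<omega>) \<in> borel_measurable (restrict_space lborel {0..b} \<Otimes>\<^sub>M M)
       \<and> (\<forall>t\<in>{0..b}. u t \<in> borel_measurable (F t))
       \<and> integrable (restrict_space lborel {0..b} \<Otimes>\<^sub>M M) (\<lambda>(t, \<omega>). (norm (u t \<omega>))\<^sup>2)}"

definition vec_cond_exp ::
  "'a measure \<Rightarrow> 'a measure \<Rightarrow> ('a \<Rightarrow> real^'n) \<Rightarrow> 'a \<Rightarrow> real^'n" where
  "vec_cond_exp M G z \<omega> = (\<chi> i. real_cond_exp M G (\<lambda>\<omega>. z \<omega> $ i) \<omega>)"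

text \<open>The process \<open>r \<mapsto> E{z | F\<^sub>r}\<close>. For each \<open>r\<close> the constant \<^const>\<open>vec_cond_exp\<close> selects an
  unspecified version, and these selections need not be jointly measurable in \<open>(r, \<omega>)\<close>. To integrate
  over \<open>r\<close> path by path, one takes a jointly measurable version; it is unique up to
  \<open>dr \<otimes> P\<close>-null sets.\<close>

definition cond_exp_process ::
  "'a measure \<Rightarrow> (real \<Rightarrow> 'a measure) \<Rightarrow> real \<Rightarrow> ('a \<Rightarrow> real^'n) \<Rightarrow> real \<Rightarrow> 'a \<Rightarrow> real^'n" where
  "cond_exp_process M F T z =
     (SOME Z. Z \<in> L2_adapted M F T \<and>
        (AE r in lborel. r \<in> {0..T} \<longrightarrow> (AE \<omega> in M. Z r \<omega> = vec_cond_exp M (F r) z \<omega>)))"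


section \<open>The Ito integral over \<open>[0, b]\<close>\<close>

text \<open>A simple integrand is given by a number \<open>N\<close>, a partition \<open>0 \<le> s 0 \<le> \<dots> \<le> s N \<le> b\<close> and
  bounded values \<open>\<xi> i\<close>, measurable at the left end point of \<open>(s i, s (i+1)]\<close>.\<close>

definition simple_integrand ::
  "(real \<Rightarrow> 'a measure) \<Rightarrow> real \<Rightarrow> nat \<Rightarrow> (nat \<Rightarrow> real) \<Rightarrow> (nat \<Rightarrow> 'a \<Rightarrow> real^'k^'n) \<Rightarrow> bool" where
  "simple_integrand F b N s \<xi> \<longleftrightarrow>
     0 \<le> s 0 \<and> s N \<le> b \<and> (\<forall>i<N. s i \<le> s (Suc i)) \<and>
     (\<forall>i<N. \<xi> i \<in> borel_measurable (F (s i)) \<and> bounded (\<xi> i ` space (F (s i))))"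

definition simple_process ::
  "nat \<Rightarrow> (nat \<Rightarrow> real) \<Rightarrow> (nat \<Rightarrow> 'a \<Rightarrow> real^'k^'n) \<Rightarrow> real \<Rightarrow> 'a \<Rightarrow> real^'k^'n" where
  "simple_process N s \<xi> r \<omega> = (\<Sum>i<N. indicator {s i<..s (Suc i)} r *\<^sub>R \<xi> i \<omega>)"

definition simple_ito ::
  "(real \<Rightarrow> 'a \<Rightarrow> real^'k) \<Rightarrow> nat \<Rightarrow> (nat \<Rightarrow> real) \<Rightarrow> (nat \<Rightarrow> 'a \<Rightarrow> real^'k^'n) \<Rightarrow> 'a \<Rightarrow> real^'n" where
  "simple_ito W N s \<xi> \<omega> = (\<Sum>i<N. \<xi> i \<omega> *v (W (s (Suc i)) \<omega> - W (s i) \<omega>))"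

definition has_ito_integral ::
  "'a measure \<Rightarrow> (real \<Rightarrow> 'a measure) \<Rightarrow> (real \<Rightarrow> 'a \<Rightarrow> real^'k) \<Rightarrow> real \<Rightarrow>
   (real \<Rightarrow> 'a \<Rightarrow> real^'k^'n) \<Rightarrow> ('a \<Rightarrow> real^'n) \<Rightarrow> bool" where
  "has_ito_integral M F W b H J \<longleftrightarrow>
     H \<in> L2_adapted M F b \<and> J \<in> borel_measurable M \<and>
     (\<exists>N s \<xi>. (\<forall>k. simple_integrand F b (N k) (s k) (\<xi> k)) \<and>
        (\<lambda>k. \<integral>\<^sup>+ (r, \<omega>). ennreal ((norm (H r \<omega> - simple_process (N k) (s k) (\<xi> k) r \<omega>))\<^sup>2)
               \<partial>(restrict_space lborel {0..b} \<Otimes>\<^sub>M M)) \<longlonglongrightarrow> 0 \<and>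
        (\<lambda>k. \<integral>\<^sup>+ \<omega>. ennreal ((norm (J \<omega> - simple_ito W (N k) (s k) (\<xi> k) \<omega>))\<^sup>2) \<partial>M) \<longlonglongrightarrow> 0)"

text \<open>By the Ito isometry the integral is determined up to null sets.\<close>

definition ito_integral ::
  "'a measure \<Rightarrow> (real \<Rightarrow> 'a measure) \<Rightarrow> (real \<Rightarrow> 'a \<Rightarrow> real^'k) \<Rightarrow> real \<Rightarrow>
   (real \<Rightarrow> 'a \<Rightarrow> real^'k^'n) \<Rightarrow> 'a \<Rightarrow> real^'n" where
  "ito_integral M F W b H = (SOME J. has_ito_integral M F W b H J)"


section \<open>The controlled delay system\<close>

text \<open>\<^const>\<open>C1_differentiable_on\<close> uses two-sided derivatives at the end points and hence
  depends on values outside \<open>[-h, 0]\<close>.\<close>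

definition C1_initial :: "real \<Rightarrow> (real \<Rightarrow> real^'n) set" where
  "C1_initial h =
     {\<phi>. (\<forall>s\<in>{-h..0}. \<phi> differentiable (at s within {-h..0})) \<and>
         continuous_on {-h..0} (\<lambda>s. vector_derivative \<phi> (at s within {-h..0}))}"

text \<open>The solution of \<open>D\<^sup>\<alpha> x(t) = A x(t) + B x(t-h) + C u(t) + \<Delta>(t) dW(t)/dt\<close> on \<open>(0, T]\<close> with
  \<open>x = \<phi>\<close> on \<open>[-h, 0]\<close> is understood in the mild sense, through the representation formula.\<close>

definition delay_solution ::
  "'a measure \<Rightarrow> (real \<Rightarrow> 'a measure) \<Rightarrow> (real \<Rightarrow> 'a \<Rightarrow> real^'n) \<Rightarrow> real \<Rightarrow> real \<Rightarrow>
   real^'n^'n \<Rightarrow> real^'n^'n \<Rightarrow> real^'m^'n \<Rightarrow> (real \<Rightarrow> real^'n^'n) \<Rightarrow>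
   (real \<Rightarrow> real^'n) \<Rightarrow> (real \<Rightarrow> 'a \<Rightarrow> real^'m) \<Rightarrow> real \<Rightarrow> 'a \<Rightarrow> real^'n" where
  "delay_solution M F W h \<alpha> A B C \<Delta> \<phi> u t \<omega> =
     (if t \<le> 0 then \<phi> t
      else delayed_ML1 h \<alpha> A B t *v \<phi> (- h)
         + (LINT r:{-h..0}|lborel.
              delayed_ML1 h \<alpha> A B (t - h - r) *v vector_derivative \<phi> (at r within {-h..0}))
         + (LINT r:{0..t}|lborel. delayed_ML2 h \<alpha> \<alpha> A B (t - h - r) *v (C *v u r \<omega>))
         + ito_integral M F W t (\<lambda>r _. delayed_ML2 h \<alpha> \<alpha> A B (t - h - r) ** \<Delta> r) \<omega>)"

definition completely_controllable ::
  "'a measure \<Rightarrow> (real \<Rightarrow> 'a measure) \<Rightarrow> (real \<Rightarrow> 'a \<Rightarrow> real^'n) \<Rightarrow> real \<Rightarrow> real \<Rightarrow> real \<Rightarrow>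
   real^'n^'n \<Rightarrow> real^'n^'n \<Rightarrow> real^'m^'n \<Rightarrow> (real \<Rightarrow> real^'n^'n) \<Rightarrow> bool" where
  "completely_controllable M F W T h \<alpha> A B C \<Delta> \<longleftrightarrow>
     (\<forall>\<phi>\<in>C1_initial h. \<forall>x1\<in>L2_rv M (F T). \<exists>u\<in>L2_adapted M F T.
        AE \<omega> in M. delay_solution M F W h \<alpha> A B C \<Delta> \<phi> u T \<omega> = x1 \<omega>)"

definition grammian ::
  "'a measure \<Rightarrow> (real \<Rightarrow> 'a measure) \<Rightarrow> real \<Rightarrow> real \<Rightarrow> real \<Rightarrow>
   real^'n^'n \<Rightarrow> real^'n^'n \<Rightarrow> real^'m^'n \<Rightarrow> ('a \<Rightarrow> real^'n) \<Rightarrow> 'a \<Rightarrow> real^'n" where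
  "grammian M F T h \<alpha> A B C z \<omega> =
     (LINT r:{0..T}|lborel.
        (delayed_ML2 h \<alpha> \<alpha> A B (T - h - r) ** C ** transpose C
           ** delayed_ML2 h \<alpha> \<alpha> (transpose A) (transpose B) (T - h - r))
        *v cond_exp_process M F T z r \<omega>)"

end

theory Submission
  imports Defs
begin

text \<open>
  Let \<open>K r\<close> be the kernel \<open>\<E>(T - h - r) C\<close>. Up to a summand in \<open>L\<^sup>2(F\<^sub>T)\<close> that does not depend on
  \<open>u\<close>, the terminal state is \<open>L u = \<integral> K u dr\<close>, so complete controllability means that \<open>L\<close> maps onto
  \<open>L\<^sup>2(F\<^sub>T)\<close>. The adjoint of \<open>L\<close> is \<open>z \<mapsto> K\<^sup>* E{z | F\<^sub>r}\<close>; since \<open>A\<close> and \<open>B\<close> commute, the Grammian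
  is \<open>L L\<^sup>*\<close> and its quadratic form is \<open>\<parallel>L\<^sup>* z\<parallel>\<^sup>2\<close>. Surjectivity bounds \<open>\<parallel>z\<parallel>\<close> by a multiple of
  \<open>\<parallel>L\<^sup>* z\<parallel>\<close> (uniform boundedness, by a gliding hump), and conversely a coercive Grammian is inverted by
  a Richardson iteration. The process \<open>r \<mapsto> E{z | F\<^sub>r}\<close> has a jointly measurable adapted version because
  \<open>r \<mapsto> \<parallel>E{z | F\<^sub>r}\<parallel>\<^sup>2\<close> is increasing, which makes its dyadic discretizations converge at rate
  \<open>2\<^sup>-\<^sup>j\<close>. The kernel is bounded by \<open>c (T - r)\<^bsup>\<alpha>-1\<^esup>\<close>, which is square-integrable as \<open>\<alpha> > 1/2\<close>;
  hence \<open>L\<close> is bounded and the Ito integral exists and lies in \<open>L\<^sup>2(F\<^sub>T)\<close>.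
\<close>

section \<open>Square-integrable functions\<close>

text \<open>Square-integrable variables are functions, not classes, and
  \<open>cond_exp_process\<close> and \<open>ito_integral\<close> are arbitrary choices. A chosen
  version of the conditional expectations depends on z linearly only almost everywhere, so the
  Hilbert space arguments are arranged around norms and pairings of given functions instead of a
  linear operator. The version picked by \<open>cond_exp_process\<close> is known to be jointly
  measurable only over \<open>M\<close>, so the image of an \<open>F T\<close>-measurable variable
  under the Grammian is not known to be \<open>F T\<close>-measurable; the proof computes with a
  second version, jointly measurable over \<open>F T\<close>, and shows that the quadratic form is
  the same. \<open>ito_integral\<close> means something only after an Ito integral has been shown to
  exist, and its \<open>F T\<close>-measurability is recovered from the approximating sums.
  Mean-square limits of random variables are taken along sequences whose increments decay
  geometrically, so that one completeness lemma with an explicit rate serves the gliding hump, the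
  Richardson iteration and the Ito integral.\<close>

definition l2norm :: "'a measure \<Rightarrow> ('a \<Rightarrow> 'b::euclidean_space) \<Rightarrow> real" where
  "l2norm M f = sqrt (LINT \<omega>|M. (norm (f \<omega>))\<^sup>2)"

lemma l2norm_nonneg [simp]: "0 \<le> l2norm M f"
  by (simp add: l2norm_def)

lemma l2norm_power2: "(l2norm M f)\<^sup>2 = (LINT \<omega>|M. (norm (f \<omega>))\<^sup>2)"
  by (simp add: l2norm_def)

lemma subalgebra_refl: "subalgebra M M"
  by (simp add: subalgebra_def)

lemma L2_rv_measurable: "f \<in> L2_rv M G \<Longrightarrow> f \<in> borel_measurable G"
  and L2_rv_integrable: "f \<in> L2_rv M G \<Longrightarrow> integrable M (\<lambda>\<omega>. (norm (f \<omega>))\<^sup>2)"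
  by (simp_all add: L2_rv_def)

lemma L2_rv_superalgebra: "f \<in> L2_rv M G \<Longrightarrow> subalgebra M G \<Longrightarrow> f \<in> L2_rv M M"
  by (auto simp: L2_rv_def intro: measurable_from_subalg)

lemma L2_rv_dominated:
  fixes f :: "'a \<Rightarrow> 'b::euclidean_space"
  assumes "f \<in> borel_measurable G" "subalgebra M G" "integrable M g" "AE \<omega> in M. (norm (f \<omega>))\<^sup>2 \<le> g \<omega>"
  shows "f \<in> L2_rv M G"
proof -
  have [measurable]: "f \<in> borel_measurable M" using assms measurable_from_subalg by blast
  have "integrable M (\<lambda>\<omega>. (norm (f \<omega>))\<^sup>2)"
    using assms(4) by (intro Bochner_Integration.integrable_bound[OF assms(3)]) auto
  then show ?thesis using assms(1) by (simp add: L2_rv_def)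
qed

lemma L2_rv_add:
  fixes f g :: "'a \<Rightarrow> 'b::euclidean_space"
  assumes "f \<in> L2_rv M G" "g \<in> L2_rv M G" "subalgebra M G"
  shows "(\<lambda>\<omega>. f \<omega> + g \<omega>) \<in> L2_rv M G"
proof (rule L2_rv_dominated[where g = "\<lambda>\<omega>. 2 * (norm (f \<omega>))\<^sup>2 + 2 * (norm (g \<omega>))\<^sup>2"])
  have [measurable]: "f \<in> borel_measurable G" "g \<in> borel_measurable G"
    using assms L2_rv_measurable by blast+
  show "(\<lambda>\<omega>. f \<omega> + g \<omega>) \<in> borel_measurable G" by measurable
  show "integrable M (\<lambda>\<omega>. 2 * (norm (f \<omega>))\<^sup>2 + 2 * (norm (g \<omega>))\<^sup>2)"
    using L2_rv_integrable[OF assms(1)] L2_rv_integrable[OF assms(2)] by simp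
  show "AE \<omega> in M. (norm (f \<omega> + g \<omega>))\<^sup>2 \<le> 2 * (norm (f \<omega>))\<^sup>2 + 2 * (norm (g \<omega>))\<^sup>2"
  proof (rule AE_I2)
    fix \<omega>
    have "(norm (f \<omega> + g \<omega>))\<^sup>2 + (norm (f \<omega> - g \<omega>))\<^sup>2 = 2 * (norm (f \<omega>))\<^sup>2 + 2 * (norm (g \<omega>))\<^sup>2"
      by (simp add: power2_norm_eq_inner inner_simps inner_commute)
    then show "(norm (f \<omega> + g \<omega>))\<^sup>2 \<le> 2 * (norm (f \<omega>))\<^sup>2 + 2 * (norm (g \<omega>))\<^sup>2"
      by (smt (verit) zero_le_power2)
  qed
qed (fact assms)

lemma L2_rv_scaleR:
  fixes f :: "'a \<Rightarrow> 'b::euclidean_space"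
  assumes "f \<in> L2_rv M G"
  shows "(\<lambda>\<omega>. c *\<^sub>R f \<omega>) \<in> L2_rv M G"
  using assms by (auto simp: L2_rv_def power_mult_distrib)

lemma L2_rv_diff:
  fixes f g :: "'a \<Rightarrow> 'b::euclidean_space"
  assumes "f \<in> L2_rv M G" "g \<in> L2_rv M G" "subalgebra M G"
  shows "(\<lambda>\<omega>. f \<omega> - g \<omega>) \<in> L2_rv M G"
  using L2_rv_add[OF assms(1) L2_rv_scaleR[OF assms(2), of "-1"] assms(3)] by simp

lemma L2_rv_zero: "(\<lambda>_. 0) \<in> L2_rv M G"
  by (simp add: L2_rv_def)

lemma L2_rv_sum:
  fixes f :: "'i \<Rightarrow> 'a \<Rightarrow> 'b::euclidean_space"
  assumes "\<And>i. i \<in> I \<Longrightarrow> f i \<in> L2_rv M G" "subalgebra M G"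
  shows "(\<lambda>\<omega>. \<Sum>i\<in>I. f i \<omega>) \<in> L2_rv M G"
  using assms(1)
  by (induction I rule: infinite_finite_induct) (auto intro: L2_rv_add L2_rv_zero assms(2))

lemma L2_rv_const: "finite_measure M \<Longrightarrow> (\<lambda>_. c) \<in> L2_rv M G"
  by (simp add: L2_rv_def finite_measure.integrable_const)

lemma L2_rv_integrable_inner:
  fixes f g :: "'a \<Rightarrow> 'b::euclidean_space"
  assumes "f \<in> L2_rv M M" "g \<in> L2_rv M M"
  shows "integrable M (\<lambda>\<omega>. f \<omega> \<bullet> g \<omega>)"
proof -
  have [measurable]: "f \<in> borel_measurable M" "g \<in> borel_measurable M"
    using assms L2_rv_measurable by blast+
  have *: "norm (f \<omega> \<bullet> g \<omega>) \<le> norm ((norm (f \<omega>))\<^sup>2 + (norm (g \<omega>))\<^sup>2)" for \<omega>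
  proof -
    have "\<bar>f \<omega> \<bullet> g \<omega>\<bar> \<le> norm (f \<omega>) * norm (g \<omega>)" by (rule Cauchy_Schwarz_ineq2)
    moreover have "2 * norm (f \<omega>) * norm (g \<omega>) \<le> (norm (f \<omega>))\<^sup>2 + (norm (g \<omega>))\<^sup>2"
      by (rule sum_squares_bound)
    moreover have "0 \<le> norm (f \<omega>) * norm (g \<omega>)" by simp
    ultimately show ?thesis unfolding real_norm_def by linarith
  qed
  show ?thesis
    by (rule Bochner_Integration.integrable_bound
        [OF Bochner_Integration.integrable_add[OF L2_rv_integrable[OF assms(1)] L2_rv_integrable[OF assms(2)]]])
       (use * in \<open>simp_all del: real_norm_def\<close>)
qed

lemma l2norm_scaleR: "l2norm M (\<lambda>\<omega>. c *\<^sub>R f \<omega>) = \<bar>c\<bar> * l2norm M f"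
  by (simp add: l2norm_def power_mult_distrib real_sqrt_mult)

text \<open>The scalar \<open>c\<close> is kept free: as a polynomial in \<open>c\<close> the
  identity yields Cauchy-Schwarz, and the values 1, -1 and \<open>- \<rho>\<close> yield the
  triangle inequality, Pythagoras and the contraction estimate.\<close>

lemma L2_rv_norm_add:
  fixes f g :: "'a \<Rightarrow> 'b::euclidean_space"
  assumes "f \<in> L2_rv M M" "g \<in> L2_rv M M"
  shows "(l2norm M (\<lambda>\<omega>. f \<omega> + c *\<^sub>R g \<omega>))\<^sup>2
    = (l2norm M f)\<^sup>2 + 2 * c * (LINT \<omega>|M. f \<omega> \<bullet> g \<omega>) + c\<^sup>2 * (l2norm M g)\<^sup>2"
proof -
  have "(LINT \<omega>|M. (norm (f \<omega> + c *\<^sub>R g \<omega>))\<^sup>2)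
      = (LINT \<omega>|M. (norm (f \<omega>))\<^sup>2 + (2 * c) * (f \<omega> \<bullet> g \<omega>) + c\<^sup>2 * (norm (g \<omega>))\<^sup>2)"
    by (intro arg_cong[where f = "integral\<^sup>L M"] ext)
       (simp only: power2_norm_eq_inner inner_add_left inner_add_right inner_scaleR_left inner_scaleR_right
          inner_commute[of "g _" "f _"], simp add: power2_eq_square algebra_simps)
  also have "\<dots> = (LINT \<omega>|M. (norm (f \<omega>))\<^sup>2) + 2 * c * (LINT \<omega>|M. f \<omega> \<bullet> g \<omega>)
      + c\<^sup>2 * (LINT \<omega>|M. (norm (g \<omega>))\<^sup>2)"
    using assms L2_rv_integrable_inner[OF assms] by (simp add: L2_rv_def)
  finally show ?thesis by (simp only: l2norm_power2)
qed

lemma L2_rv_Cauchy_Schwarz: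
  fixes f g :: "'a \<Rightarrow> 'b::euclidean_space"
  assumes "f \<in> L2_rv M M" "g \<in> L2_rv M M"
  shows "\<bar>LINT \<omega>|M. f \<omega> \<bullet> g \<omega>\<bar> \<le> l2norm M f * l2norm M g"
proof -
  define a b p where "a = (l2norm M f)\<^sup>2" and "b = (l2norm M g)\<^sup>2" and "p = (LINT \<omega>|M. f \<omega> \<bullet> g \<omega>)"
  have pos: "0 \<le> a + 2 * c * p + c\<^sup>2 * b" for c
    using L2_rv_norm_add[OF assms, of c] unfolding a_def b_def p_def by (metis zero_le_power2)
  have "p\<^sup>2 \<le> a * b"
  proof (cases "b = 0")
    case True
    have "p = 0"
    proof (rule ccontr)
      assume "p \<noteq> 0"
      \<comment> \<open>For \<open>b = 0\<close> the polynomial is affine in \<open>c\<close>, and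
        at this \<open>c\<close> it equals -1.\<close>
      with pos[of "- (a + 1) / (2 * p)"] True show False by (simp add: field_simps)
    qed
    with True show ?thesis by simp
  next
    case False
    then have "b > 0" by (simp add: b_def)
    \<comment> \<open>The polynomial at its minimizer \<open>c = - p / b\<close>.\<close>
    have "0 \<le> a - p\<^sup>2 / b"
      using pos[of "- p / b"] \<open>b > 0\<close> by (simp add: field_simps power2_eq_square)
    then show ?thesis using \<open>b > 0\<close> by (simp add: field_simps)
  qed
  then have "p\<^sup>2 \<le> (l2norm M f * l2norm M g)\<^sup>2" by (simp add: a_def b_def power_mult_distrib)
  then show ?thesis unfolding p_def by (simp add: abs_le_square_iff[symmetric])
qed

lemma L2_rv_triangle:
  fixes f g :: "'a \<Rightarrow> 'b::euclidean_space"
  assumes "f \<in> L2_rv M M" "g \<in> L2_rv M M"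
  shows "l2norm M (\<lambda>\<omega>. f \<omega> + g \<omega>) \<le> l2norm M f + l2norm M g"
proof -
  have "(l2norm M (\<lambda>\<omega>. f \<omega> + g \<omega>))\<^sup>2 \<le> (l2norm M f + l2norm M g)\<^sup>2"
    using L2_rv_norm_add[OF assms, of 1] L2_rv_Cauchy_Schwarz[OF assms]
    by (simp add: power2_sum)
  then show ?thesis by (rule power2_le_imp_le) simp
qed

lemma L2_rv_triangle_diff:
  fixes f g k :: "'a \<Rightarrow> 'b::euclidean_space"
  assumes "f \<in> L2_rv M M" "g \<in> L2_rv M M" "k \<in> L2_rv M M"
  shows "l2norm M (\<lambda>\<omega>. f \<omega> - k \<omega>) \<le> l2norm M (\<lambda>\<omega>. f \<omega> - g \<omega>) + l2norm M (\<lambda>\<omega>. g \<omega> - k \<omega>)"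
  using L2_rv_triangle[OF L2_rv_diff[OF assms(1,2) subalgebra_refl] L2_rv_diff[OF assms(2,3) subalgebra_refl]]
  by simp

lemma l2norm_minus_commute: "l2norm M (\<lambda>\<omega>. f \<omega> - g \<omega>) = l2norm M (\<lambda>\<omega>. g \<omega> - f \<omega>)"
  by (simp add: l2norm_def norm_minus_commute)

lemma L2_rv_nn_integral:
  "f \<in> L2_rv M M \<Longrightarrow> (\<integral>\<^sup>+\<omega>. ennreal ((norm (f \<omega>))\<^sup>2) \<partial>M) = ennreal ((l2norm M f)\<^sup>2)"
  by (simp add: l2norm_power2 L2_rv_def nn_integral_eq_integral)

lemma L2_rv_nn_integralD:
  fixes f :: "'a \<Rightarrow> 'b::euclidean_space"
  assumes "f \<in> borel_measurable M" "(\<integral>\<^sup>+\<omega>. ennreal ((norm (f \<omega>))\<^sup>2) \<partial>M) \<le> ennreal (c\<^sup>2)" "0 \<le> c"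
  shows "f \<in> L2_rv M M" "l2norm M f \<le> c"
proof -
  show *: "f \<in> L2_rv M M"
    using assms by (auto simp: L2_rv_def intro!: integrableI_bounded
      intro: le_less_trans[OF _ ennreal_less_top])
  have "(l2norm M f)\<^sup>2 \<le> c\<^sup>2"
    using assms(2) L2_rv_nn_integral[OF *] by simp
  then show "l2norm M f \<le> c" by (rule power2_le_imp_le) (fact assms)
qed

section \<open>Completeness along geometrically convergent sequences\<close>

lemma L2_rv_geometric_diff:
  fixes X :: "nat \<Rightarrow> 'a \<Rightarrow> 'b::euclidean_space"
  assumes X: "\<And>n. X n \<in> L2_rv M M"
    and le: "\<And>n. l2norm M (\<lambda>\<omega>. X (Suc n) \<omega> - X n \<omega>) \<le> c * q ^ n"
    and q: "0 \<le> q" "q < 1" and "0 \<le> c"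
  shows "l2norm M (\<lambda>\<omega>. X (n + k) \<omega> - X n \<omega>) \<le> c * q ^ n / (1 - q)"
proof -
  have "l2norm M (\<lambda>\<omega>. X (n + k) \<omega> - X n \<omega>) \<le> (\<Sum>i<k. c * q ^ (n + i))"
  proof (induction k)
    case 0
    then show ?case by (simp add: l2norm_def)
  next
    case (Suc k)
    then show ?case
      using L2_rv_triangle_diff[OF X[of "n + Suc k"] X[of "n + k"] X[of n]] le[of "n + k"]
      by simp
  qed
  also have "\<dots> = c * q ^ n * (\<Sum>i<k. q ^ i)" by (simp add: sum_distrib_left power_add mult.assoc)
  also have "\<dots> \<le> c * q ^ n * (1 / (1 - q))"
    using q assms(5) by (intro mult_left_mono) (auto simp: sum_gp_strict divide_right_mono)
  finally show ?thesis by simp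
qed

text \<open>Cauchy-Schwarz against the constant 1 makes the L1 norms of the increments summable, so
  almost every path converges; Fatou then carries the geometric tail bound over to the limit. The
  rate is part of the conclusion because its constant enters later estimates.\<close>

lemma L2_rv_complete_geometric:
  fixes X :: "nat \<Rightarrow> 'a \<Rightarrow> 'b::euclidean_space"
  assumes "finite_measure M" "subalgebra M G"
    and X: "\<And>n. X n \<in> L2_rv M G"
    and le: "\<And>n. l2norm M (\<lambda>\<omega>. X (Suc n) \<omega> - X n \<omega>) \<le> c * q ^ n"
    and q: "0 \<le> q" "q < 1" and c: "0 \<le> c"
  obtains Y where "Y \<in> L2_rv M G" "\<And>n. l2norm M (\<lambda>\<omega>. Y \<omega> - X n \<omega>) \<le> c * q ^ n / (1 - q)"
proof -
  interpret finite_measure M by fact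
  have XM: "X n \<in> L2_rv M M" for n using L2_rv_superalgebra[OF X assms(2)] .
  have [measurable]: "X n \<in> borel_measurable G" "X n \<in> borel_measurable M" for n
    using X XM L2_rv_measurable by blast+
  define d where "d n \<omega> = norm (X (Suc n) \<omega> - X n \<omega>)" for n \<omega>
  have [measurable]: "d n \<in> borel_measurable M" for n unfolding d_def by measurable
  \<comment> \<open>\<open>lim\<close> of \<open>G\<close>-measurable functions is
    \<open>G\<close>-measurable even where the sequence diverges, so no exceptional null set has to
    be removed.\<close>
  define Y where "Y \<omega> = lim (\<lambda>n. X n \<omega>)" for \<omega>
  have Ym [measurable]: "Y \<in> borel_measurable G" unfolding Y_def by measurable
  have [measurable]: "Y \<in> borel_measurable M" using Ym assms(2) measurable_from_subalg by blast
  define K where "K = sqrt (measure M (space M))"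
  have int_d: "(\<integral>\<^sup>+\<omega>. ennreal (d n \<omega>) \<partial>M) \<le> ennreal (K * c * q ^ n)" for n
  proof -
    have dL: "d n \<in> L2_rv M M"
      using L2_rv_diff[OF XM XM subalgebra_refl, of "Suc n" n] unfolding L2_rv_def d_def by auto
    have one: "(\<lambda>_. 1::real) \<in> L2_rv M M" by (rule L2_rv_const) fact
    have int: "integrable M (d n)" using L2_rv_integrable_inner[OF dL one] by simp
    have "(LINT \<omega>|M. d n \<omega>) \<le> l2norm M (d n) * l2norm M (\<lambda>_. 1::real)"
      using L2_rv_Cauchy_Schwarz[OF dL one] by simp
    also have "l2norm M (\<lambda>_. 1::real) = K" by (simp add: l2norm_def K_def)
    also have "l2norm M (d n) \<le> c * q ^ n" using le[of n] by (simp add: l2norm_def d_def)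
    finally have "(LINT \<omega>|M. d n \<omega>) \<le> K * c * q ^ n" by (simp add: K_def mult_right_mono mult_ac)
    moreover have "(\<integral>\<^sup>+\<omega>. ennreal (d n \<omega>) \<partial>M) = ennreal (LINT \<omega>|M. d n \<omega>)"
      by (rule nn_integral_eq_integral[OF int]) (simp add: d_def)
    ultimately show ?thesis by (simp add: ennreal_leI)
  qed
  have "(\<integral>\<^sup>+\<omega>. (\<Sum>n. ennreal (d n \<omega>)) \<partial>M) = (\<Sum>n. \<integral>\<^sup>+\<omega>. ennreal (d n \<omega>) \<partial>M)"
    by (rule nn_integral_suminf) simp
  also have "\<dots> \<le> (\<Sum>n. ennreal (K * c * q ^ n))" by (intro suminf_le int_d) auto
  also have "\<dots> = ennreal (\<Sum>n. K * c * q ^ n)"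
    using q c by (intro suminf_ennreal2 summable_mult) (auto simp: K_def summable_geometric)
  finally have "(\<integral>\<^sup>+\<omega>. (\<Sum>n. ennreal (d n \<omega>)) \<partial>M) \<noteq> \<infinity>"
    using ennreal_less_top le_less_trans by (metis infinity_ennreal_def less_irrefl)
  then have "AE \<omega> in M. (\<Sum>n. ennreal (d n \<omega>)) \<noteq> \<infinity>"
    by (intro nn_integral_PInf_AE) auto
  then have conv: "AE \<omega> in M. (\<lambda>n. X n \<omega>) \<longlonglongrightarrow> Y \<omega>"
  proof (rule AE_mp, intro AE_I2 impI)
    fix \<omega> assume "(\<Sum>n. ennreal (d n \<omega>)) \<noteq> \<infinity>"
    then have "summable (\<lambda>n. d n \<omega>)"
      by (intro summable_suminf_not_top) (auto simp: d_def)
    then have "summable (\<lambda>n. X (Suc n) \<omega> - X n \<omega>)"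
      unfolding d_def by (rule summable_norm_cancel)
    then have "convergent (\<lambda>n. (X n \<omega> - X 0 \<omega>) + X 0 \<omega>)"
      by (intro convergent_add convergent_const)
         (simp add: summable_iff_convergent sum_lessThan_telescope[of "\<lambda>n. X n \<omega>"])
    then show "(\<lambda>n. X n \<omega>) \<longlonglongrightarrow> Y \<omega>"
      by (simp add: Y_def convergent_LIMSEQ_iff)
  qed
  have le': "(\<integral>\<^sup>+\<omega>. ennreal ((norm (Y \<omega> - X n \<omega>))\<^sup>2) \<partial>M) \<le> ennreal ((c * q ^ n / (1 - q))\<^sup>2)" for n
  proof -
    have "(\<integral>\<^sup>+\<omega>. ennreal ((norm (Y \<omega> - X n \<omega>))\<^sup>2) \<partial>M)
        = (\<integral>\<^sup>+\<omega>. liminf (\<lambda>k. ennreal ((norm (X (n + k) \<omega> - X n \<omega>))\<^sup>2)) \<partial>M)"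
    proof (intro nn_integral_cong_AE, use conv in eventually_elim)
      case (elim \<omega>)
      have "(\<lambda>k. X (n + k) \<omega>) \<longlonglongrightarrow> Y \<omega>"
        using LIMSEQ_ignore_initial_segment[OF elim, of n] by (simp add: add.commute)
      then have "(\<lambda>k. ennreal ((norm (X (n + k) \<omega> - X n \<omega>))\<^sup>2)) \<longlonglongrightarrow> ennreal ((norm (Y \<omega> - X n \<omega>))\<^sup>2)"
        by (intro tendsto_intros tendsto_ennrealI)
      from lim_imp_Liminf[OF sequentially_bot this] show ?case by simp
    qed
    also have "\<dots> \<le> liminf (\<lambda>k. \<integral>\<^sup>+\<omega>. ennreal ((norm (X (n + k) \<omega> - X n \<omega>))\<^sup>2) \<partial>M)"
      by (rule nn_integral_liminf) simp
    also have "\<dots> \<le> ennreal ((c * q ^ n / (1 - q))\<^sup>2)"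
    proof (intro Liminf_le[OF sequentially_bot] always_eventually allI)
      fix k
      show "(\<integral>\<^sup>+\<omega>. ennreal ((norm (X (n + k) \<omega> - X n \<omega>))\<^sup>2) \<partial>M) \<le> ennreal ((c * q ^ n / (1 - q))\<^sup>2)"
        using L2_rv_geometric_diff[OF XM le q c, of n k]
        by (subst L2_rv_nn_integral[OF L2_rv_diff[OF XM XM subalgebra_refl]])
           (intro ennreal_leI power_mono, auto)
    qed
    finally show ?thesis .
  qed
  have nn: "0 \<le> c * q ^ n / (1 - q)" for n using q c by simp
  have D: "(\<lambda>\<omega>. Y \<omega> - X n \<omega>) \<in> L2_rv M M" "l2norm M (\<lambda>\<omega>. Y \<omega> - X n \<omega>) \<le> c * q ^ n / (1 - q)" for n
    using L2_rv_nn_integralD[OF _ le' nn, of n] by simp_all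
  have "Y \<in> L2_rv M M"
    using L2_rv_add[OF D(1) XM subalgebra_refl, of 0 0] by simp
  then have "Y \<in> L2_rv M G" using Ym by (simp add: L2_rv_def)
  then show ?thesis using D(2) that by blast
qed

section \<open>Conditional expectations of square-integrable vectors\<close>

lemma borel_measurable_vec_nthI:
  fixes f :: "'a \<Rightarrow> real^'n"
  assumes "\<And>i. (\<lambda>\<omega>. f \<omega> $ i) \<in> borel_measurable M"
  shows "f \<in> borel_measurable M"
  unfolding borel_measurable_euclidean_space[where f = f]
  using assms by (auto simp: Basis_vec_def inner_axis)

lemma borel_measurable_vec_nth [measurable (raw)]:
  fixes f :: "'a \<Rightarrow> ('b::euclidean_space)^'n"
  assumes "f \<in> borel_measurable M"
  shows "(\<lambda>\<omega>. f \<omega> $ i) \<in> borel_measurable M"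
  by (rule measurable_compose[OF assms borel_measurable_continuous_onI]) (intro continuous_intros)

lemma norm_vec_power2: "(norm (x :: real^'n))\<^sup>2 = (\<Sum>i\<in>UNIV. (x $ i)\<^sup>2)"
  unfolding power2_norm_eq_inner inner_vec_def by (simp add: power2_eq_square)

lemma L2_rv_vec_nth:
  fixes z :: "'a \<Rightarrow> real^'n"
  assumes "z \<in> L2_rv M M"
  shows "(\<lambda>\<omega>. z \<omega> $ i) \<in> L2_rv M M"
proof (rule L2_rv_dominated[OF _ subalgebra_refl L2_rv_integrable[OF assms]])
  have [measurable]: "z \<in> borel_measurable M" using assms by (rule L2_rv_measurable)
  show "(\<lambda>\<omega>. z \<omega> $ i) \<in> borel_measurable M" by measurable
  show "AE \<omega> in M. (norm (z \<omega> $ i))\<^sup>2 \<le> (norm (z \<omega>))\<^sup>2"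
    by (intro AE_I2 power_mono) (simp_all add: component_le_norm_cart)
qed

context finite_measure
begin

lemma L2_rv_imp_integrable:
  fixes f :: "'a \<Rightarrow> real"
  assumes "f \<in> L2_rv M M" shows "integrable M f"
proof (rule square_integrable_imp_integrable)
  show "f \<in> borel_measurable M" using assms by (rule L2_rv_measurable)
  show "integrable M (\<lambda>x. (f x)\<^sup>2)" using L2_rv_integrable[OF assms] by simp
qed

lemma vec_cond_exp_measurable:
  "vec_cond_exp M G z \<in> borel_measurable G"
  by (rule borel_measurable_vec_nthI) (simp add: vec_cond_exp_def)

text \<open>Conditional Jensen for the square, component by component.\<close>

lemma vec_cond_exp_L2:
  fixes z :: "'a \<Rightarrow> real^'n"
  assumes G: "subalgebra M G" and z: "z \<in> L2_rv M M"
  shows "vec_cond_exp M G z \<in> L2_rv M G"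
proof -
  interpret finite_measure_subalgebra M G by standard fact
  have "integrable M (\<lambda>\<omega>. (real_cond_exp M G (\<lambda>\<omega>. z \<omega> $ i) \<omega>)\<^sup>2)" for i
  proof (rule integrable_convex_cond_exp[where I = UNIV and q = "\<lambda>x. x\<^sup>2"])
    have *: "(\<lambda>\<omega>. z \<omega> $ i) \<in> L2_rv M M" by (rule L2_rv_vec_nth[OF z])
    then show "integrable M (\<lambda>\<omega>. z \<omega> $ i)" by (rule L2_rv_imp_integrable)
    show "integrable M (\<lambda>\<omega>. (z \<omega> $ i)\<^sup>2)" using L2_rv_integrable[OF *] by simp
  qed (auto simp: convex_power2)
  then show ?thesis
    by (simp add: L2_rv_def vec_cond_exp_measurable norm_vec_power2) (simp add: vec_cond_exp_def)
qed

text \<open>In each component the \<open>G\<close>-measurable factor is pulled into the conditional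
  expectation. In other words, \<open>vec_cond_exp M G\<close> acts as the orthogonal projection
  onto L2 of \<open>G\<close>.\<close>

lemma vec_cond_exp_inner:
  fixes z :: "'a \<Rightarrow> real^'n"
  assumes G: "subalgebra M G" and z: "z \<in> L2_rv M M" and f: "f \<in> L2_rv M G"
  shows "(LINT \<omega>|M. f \<omega> \<bullet> vec_cond_exp M G z \<omega>) = (LINT \<omega>|M. f \<omega> \<bullet> z \<omega>)"
proof -
  interpret finite_measure_subalgebra M G by standard fact
  have fM: "f \<in> L2_rv M M" using L2_rv_superalgebra[OF f G] .
  have [measurable]: "f \<in> borel_measurable G" "z \<in> borel_measurable M"
    using L2_rv_measurable[OF f] L2_rv_measurable[OF z] by auto
  have int: "integrable M (\<lambda>\<omega>. f \<omega> $ i * z \<omega> $ i)" for i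
    using L2_rv_integrable_inner[OF L2_rv_vec_nth[OF fM] L2_rv_vec_nth[OF z]] by simp
  have "(LINT \<omega>|M. f \<omega> \<bullet> vec_cond_exp M G z \<omega>)
      = (\<Sum>i\<in>UNIV. LINT \<omega>|M. f \<omega> $ i * real_cond_exp M G (\<lambda>\<omega>. z \<omega> $ i) \<omega>)"
    unfolding inner_vec_def vec_cond_exp_def
    using real_cond_exp_intg(1)[OF int] by simp
  also have "\<dots> = (\<Sum>i\<in>UNIV. LINT \<omega>|M. f \<omega> $ i * z \<omega> $ i)"
    using real_cond_exp_intg(2)[OF int] by simp
  also have "\<dots> = (LINT \<omega>|M. f \<omega> \<bullet> z \<omega>)"
    unfolding inner_vec_def using int by simp
  finally show ?thesis .
qed

lemma vec_cond_exp_norm_power2: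
  fixes z :: "'a \<Rightarrow> real^'n"
  assumes "subalgebra M G" "z \<in> L2_rv M M"
  shows "(l2norm M (vec_cond_exp M G z))\<^sup>2 = (LINT \<omega>|M. vec_cond_exp M G z \<omega> \<bullet> z \<omega>)"
  using vec_cond_exp_inner[OF assms vec_cond_exp_L2[OF assms]]
  by (simp only: l2norm_power2 power2_norm_eq_inner)

lemma vec_cond_exp_norm_le:
  fixes z :: "'a \<Rightarrow> real^'n"
  assumes G: "subalgebra M G" and z: "z \<in> L2_rv M M"
  shows "l2norm M (vec_cond_exp M G z) \<le> l2norm M z"
proof -
  let ?e = "l2norm M (vec_cond_exp M G z)"
  have "?e * ?e \<le> ?e * l2norm M z"
    using vec_cond_exp_norm_power2[OF assms]
      L2_rv_Cauchy_Schwarz[OF L2_rv_superalgebra[OF vec_cond_exp_L2[OF assms] G] z]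
    unfolding power2_eq_square by linarith
  then show ?thesis
    using l2norm_nonneg[of M z] by (cases "?e = 0") (simp_all add: mult_le_cancel_left_pos order_less_le)
qed

text \<open>Pythagoras: the projection to the smaller algebra is also an admissible test function
  for the larger one. Along the filtration it shows that the squared norm of the conditional
  expectation increases, and that its increments are squared distances.\<close>

lemma vec_cond_exp_diff_norm:
  fixes z :: "'a \<Rightarrow> real^'n"
  assumes G: "subalgebra M G" and H: "subalgebra M H" and GH: "sets G \<subseteq> sets H" and z: "z \<in> L2_rv M M"
  shows "(l2norm M (\<lambda>\<omega>. vec_cond_exp M H z \<omega> - vec_cond_exp M G z \<omega>))\<^sup>2
    = (l2norm M (vec_cond_exp M H z))\<^sup>2 - (l2norm M (vec_cond_exp M G z))\<^sup>2"
proof -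
  have eG: "vec_cond_exp M G z \<in> L2_rv M G" and eH: "vec_cond_exp M H z \<in> L2_rv M H"
    using vec_cond_exp_L2[OF G z] vec_cond_exp_L2[OF H z] by auto
  have "subalgebra H G" using G H GH by (simp add: subalgebra_def)
  then have "vec_cond_exp M G z \<in> L2_rv M H"
    using eG measurable_from_subalg[of H G _ borel] by (auto simp: L2_rv_def)
  from vec_cond_exp_inner[OF H z this]
  have *: "(LINT \<omega>|M. vec_cond_exp M H z \<omega> \<bullet> vec_cond_exp M G z \<omega>) = (l2norm M (vec_cond_exp M G z))\<^sup>2"
    using vec_cond_exp_norm_power2[OF G z] by (simp add: inner_commute)
  show ?thesis
    using L2_rv_norm_add[OF L2_rv_superalgebra[OF eH H] L2_rv_superalgebra[OF eG G], of "-1"] *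
    by simp
qed

end

section \<open>A jointly measurable version of the conditional expectation process\<close>

context usual_filtered_prob_space
begin

lemma finite_measure_M: "finite_measure M"
  by (rule finite_measure_axioms)

text \<open>\<open>X\<close> freezes the conditional expectation at the left end point of the grid
  cell containing \<open>r\<close>. By Pythagoras the squared error is an increment of
  \<open>m\<close>, which is enlarged to the increment over the whole cell; the bound is then a step
  function of \<open>r\<close> and can be integrated term by term.\<close>

lemma cond_exp_grid_error:
  fixes z :: "'a \<Rightarrow> real^'n"
  assumes "0 < T" "z \<in> L2_rv M M" and N: "0 < N"
  defines "m \<equiv> \<lambda>r. (l2norm M (vec_cond_exp M (F r) z))\<^sup>2"
  defines "d \<equiv> T / real N"
  defines "X \<equiv> \<lambda>r \<omega>. \<Sum>i<N. indicator {real i * d..<real (Suc i) * d} r *\<^sub>R vec_cond_exp M (F (real i * d)) z \<omega>"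
  assumes r: "0 \<le> r" "r < T"
  shows "(\<integral>\<^sup>+\<omega>. ennreal ((norm (vec_cond_exp M (F r) z \<omega> - X r \<omega>))\<^sup>2) \<partial>M)
    \<le> (\<Sum>i<N. ennreal (m (real (Suc i) * d) - m (real i * d)) * indicator {real i * d..<real (Suc i) * d} r)"
proof -
  have d: "0 < d" using assms by (simp add: d_def)
  define k where "k = nat \<lfloor>r / d\<rfloor>"
  have k: "real k * d \<le> r" "r < real (Suc k) * d"
  proof -
    have "real k = of_int \<lfloor>r / d\<rfloor>" using r d by (simp add: k_def)
    then show "real k * d \<le> r" "r < real (Suc k) * d"
      using d floor_correct[of "r / d"]
      by (simp_all add: pos_le_divide_eq[symmetric] pos_divide_less_eq[symmetric] add.commute)
  qed
  have "real k * d < real N * d" using k(1) r d N by (simp add: d_def)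
  then have kN: "k < N" using d by simp
  then have "real (Suc k) \<le> real N" by simp
  then have "real (Suc k) * d \<le> real N * d" using d by (intro mult_right_mono) auto
  then have kT: "real (Suc k) * d \<le> T" using N by (simp add: d_def)
  \<comment> \<open>The type \<open>'e\<close> stays general, since the indicator occurs as a real
    factor in \<open>X\<close> and as an \<open>ennreal\<close> factor in the bound.\<close>
  have ind: "indicator {real i * d..<real (Suc i) * d} r = (if i = k then 1 else 0 :: 'e::zero_neq_one)" for i
  proof (cases "i = k")
    case False
    then consider "Suc i \<le> k" | "Suc k \<le> i" by linarith
    then show ?thesis
    proof cases
      case 1
      then have "real (Suc i) * d \<le> real k * d" using d by (intro mult_right_mono) auto
      with k False show ?thesis by (simp add: indicator_def)
    next
      case 2
      then have "real (Suc k) * d \<le> real i * d" using d by (intro mult_right_mono) auto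
      with k False show ?thesis by (simp add: indicator_def)
    qed
  qed (use k in \<open>simp add: indicator_def\<close>)
  have X: "X r \<omega> = vec_cond_exp M (F (real k * d)) z \<omega>" for \<omega>
  proof -
    have "X r \<omega> = (\<Sum>i<N. if i = k then vec_cond_exp M (F (real i * d)) z \<omega> else 0)"
      unfolding X_def ind by (intro sum.cong) auto
    then show ?thesis using kN by simp
  qed
  have sub: "subalgebra M (F (real k * d))" "subalgebra M (F r)" "subalgebra M (F (real (Suc k) * d))"
    using k kT r d by (auto intro!: subalgebra_F simp del: of_nat_Suc)
  have le: "m r \<le> m (real (Suc k) * d)"
    using vec_cond_exp_diff_norm[OF sub(2,3) F_mono assms(2)] k kT r
    unfolding m_def by (smt (verit) zero_le_power2)
  have dL: "(\<lambda>\<omega>. vec_cond_exp M (F r) z \<omega> - X r \<omega>) \<in> L2_rv M M"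
    unfolding X using L2_rv_superalgebra[OF vec_cond_exp_L2[OF sub(1) assms(2)] sub(1)]
      L2_rv_superalgebra[OF vec_cond_exp_L2[OF sub(2) assms(2)] sub(2)]
    by (intro L2_rv_diff subalgebra_refl) auto
  have "(\<integral>\<^sup>+\<omega>. ennreal ((norm (vec_cond_exp M (F r) z \<omega> - X r \<omega>))\<^sup>2) \<partial>M) = ennreal (m r - m (real k * d))"
    unfolding L2_rv_nn_integral[OF dL] m_def
    using vec_cond_exp_diff_norm[OF sub(1,2) F_mono assms(2)] k r d by (simp add: X)
  also have "\<dots> \<le> ennreal (m (real (Suc k) * d) - m (real k * d))"
    using le by (intro ennreal_leI) simp
  also have "\<dots> = (\<Sum>i<N. if i = k then ennreal (m (real (Suc i) * d) - m (real i * d)) else 0)"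
    using kN by simp
  also have "\<dots> = (\<Sum>i<N. ennreal (m (real (Suc i) * d) - m (real i * d)) * indicator {real i * d..<real (Suc i) * d} r)"
    unfolding ind by (intro sum.cong) auto
  finally show ?thesis .
qed

text \<open>All cells have length \<open>d\<close>, so the integral is \<open>d\<close> times a
  telescoping sum of increments of \<open>m\<close>, which is at most \<open>m T\<close> and hence
  at most the squared norm of \<open>z\<close>.\<close>

lemma cond_exp_grid_error_integral:
  fixes z :: "'a \<Rightarrow> real^'n"
  assumes "0 < T" "z \<in> L2_rv M M" and N: "0 < N"
  defines "m \<equiv> \<lambda>r. (l2norm M (vec_cond_exp M (F r) z))\<^sup>2"
  defines "d \<equiv> T / real N"
  shows "(\<integral>\<^sup>+r. (\<Sum>i<N. ennreal (m (real (Suc i) * d) - m (real i * d)) * indicator {real i * d..<real (Suc i) * d} r) \<partial>lborel)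
    \<le> ennreal (d * (l2norm M z)\<^sup>2)"
proof -
  have d: "0 < d" using assms by (simp add: d_def)
  have mono: "m (real i * d) \<le> m (real (Suc i) * d)" if "i < N" for i
  proof -
    have "real (Suc i) \<le> real N" using that by simp
    then have "real (Suc i) * d \<le> real N * d" using d by (intro mult_right_mono) auto
    then have "real (Suc i) * d \<le> T" using N by (simp add: d_def)
    moreover have "0 \<le> real i * d" "real i * d \<le> real (Suc i) * d" using d by simp_all
    ultimately show ?thesis
      using vec_cond_exp_diff_norm[OF subalgebra_F subalgebra_F F_mono assms(2), of "real i * d" "real (Suc i) * d"]
      unfolding m_def by (smt (verit) atLeastAtMost_iff zero_le_power2)
  qed
  have "(\<integral>\<^sup>+r. (\<Sum>i<N. ennreal (m (real (Suc i) * d) - m (real i * d)) * indicator {real i * d..<real (Suc i) * d} r) \<partial>lborel)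
      = (\<Sum>i<N. ennreal (m (real (Suc i) * d) - m (real i * d)) * emeasure lborel {real i * d..<real (Suc i) * d})"
    by (subst nn_integral_sum) (auto intro!: sum.cong nn_integral_cmult_indicator)
  also have "\<dots> = (\<Sum>i<N. ennreal ((m (real (Suc i) * d) - m (real i * d)) * d))"
  proof (intro sum.cong refl)
    fix i assume "i \<in> {..<N}"
    then have "0 \<le> m (real (Suc i) * d) - m (real i * d)" using mono by simp
    moreover have "emeasure lborel {real i * d..<real (Suc i) * d} = ennreal d"
      using d by (simp add: algebra_simps)
    ultimately show "ennreal (m (real (Suc i) * d) - m (real i * d)) * emeasure lborel {real i * d..<real (Suc i) * d}
        = ennreal ((m (real (Suc i) * d) - m (real i * d)) * d)"
      using d by (simp only: ennreal_mult less_imp_le)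
  qed
  also have "\<dots> = ennreal (\<Sum>i<N. (m (real (Suc i) * d) - m (real i * d)) * d)"
    using d mono by (intro sum_ennreal) auto
  also have "(\<Sum>i<N. (m (real (Suc i) * d) - m (real i * d)) * d) = d * (m (real N * d) - m 0)"
    using sum_lessThan_telescope[of "\<lambda>i. m (real i * d)" N]
    unfolding sum_distrib_right[symmetric] by simp
  also have "\<dots> \<le> d * (l2norm M z)\<^sup>2"
  proof -
    have "real N * d = T" using N by (simp add: d_def)
    moreover have "l2norm M (vec_cond_exp M (F T) z) \<le> l2norm M z"
      using assms(1,2) by (intro vec_cond_exp_norm_le subalgebra_F) auto
    ultimately have "m (real N * d) \<le> (l2norm M z)\<^sup>2" unfolding m_def by (simp add: power_mono)
    moreover have "0 \<le> m 0" by (simp add: m_def)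
    ultimately show ?thesis using d by (intro mult_left_mono) auto
  qed
  finally show ?thesis by (simp add: ennreal_leI)
qed

text \<open>On dyadic grids the integrated errors are summable over the levels. Hence for almost
  every \<open>r\<close> the expected squared errors are summable, and then for almost every
  \<omega> the squared errors themselves, which forces \<open>X j r \<omega>\<close> to converge to
  the conditional expectation. Joint measurability over \<open>F T\<close>, and measurability over
  \<open>F r\<close> for fixed \<open>r\<close>, pass from \<open>X j\<close> to the pointwise
  limit.\<close>

lemma cond_exp_version_exists:
  fixes z :: "'a \<Rightarrow> real^'n"
  assumes "0 < T" "z \<in> L2_rv M M"
  obtains Z where "(\<lambda>(r, \<omega>). Z r \<omega>) \<in> borel_measurable (restrict_space lborel {0..T} \<Otimes>\<^sub>M F T)"
    and "\<And>r. r \<in> {0..T} \<Longrightarrow> Z r \<in> borel_measurable (F r)"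
    and "AE r in lborel. r \<in> {0..T} \<longrightarrow> (AE \<omega> in M. Z r \<omega> = vec_cond_exp M (F r) z \<omega>)"
proof -
  define d where "d j = T / real (2 ^ j)" for j :: nat
  define m where "m r = (l2norm M (vec_cond_exp M (F r) z))\<^sup>2" for r
  define X where "X j r \<omega> = (\<Sum>i<2 ^ j. indicator {real i * d j..<real (Suc i) * d j} r *\<^sub>R
    vec_cond_exp M (F (real i * d j)) z \<omega>)" for j r \<omega>
  define D where "D j r = (\<Sum>i<2 ^ j. ennreal (m (real (Suc i) * d j) - m (real i * d j)) *
    indicator {real i * d j..<real (Suc i) * d j} r)" for j and r :: real
  define Z where "Z r \<omega> = lim (\<lambda>j. X j r \<omega>)" for r \<omega>
  have dpos: "0 < d j" for j using assms by (simp add: d_def)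
  have sub: "subalgebra (F r) (F s)" if "0 \<le> s" "s \<le> r" "r \<le> T" for s r
    using subalgebra_F[of s] subalgebra_F[of r] F_mono[OF that] that by (auto simp: subalgebra_def)
  have grid: "real i * d j \<le> T" if "i < 2 ^ j" for i j
  proof -
    have "real i \<le> real (2 ^ j)" using that by linarith
    then show ?thesis using assms(1) by (simp add: d_def field_simps)
  qed
  have em: "vec_cond_exp M (F (real i * d j)) z \<in> borel_measurable (F r)"
    if "real i * d j \<le> r" "r \<le> T" for i j r
  proof -
    have "subalgebra (F r) (F (real i * d j))" using that dpos[of j] by (intro sub) auto
    then show ?thesis using vec_cond_exp_measurable by (rule measurable_from_subalg)
  qed
  show thesis
  proof (rule that[of Z])
    have [measurable]: "(\<lambda>x. X j (fst x) (snd x)) \<in> borel_measurable (restrict_space lborel {0..T} \<Otimes>\<^sub>M F T)" for j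
    proof -
      have "(\<lambda>x. indicator {real i * d j..<real (Suc i) * d j} (fst x) *\<^sub>R vec_cond_exp M (F (real i * d j)) z (snd x))
          \<in> borel_measurable (restrict_space lborel {0..T} \<Otimes>\<^sub>M F T)" if "i < 2 ^ j" for i
      proof -
        have [measurable]: "vec_cond_exp M (F (real i * d j)) z \<in> borel_measurable (F T)"
          by (rule em[OF grid[OF that]]) simp
        have [measurable]: "indicat_real {real i * d j..<real (Suc i) * d j} \<in> borel_measurable (restrict_space lborel {0..T})"
          by (intro measurable_restrict_space1) auto
        show ?thesis by measurable
      qed
      then show ?thesis unfolding X_def by (intro borel_measurable_sum) auto
    qed
    show "(\<lambda>(r, \<omega>). Z r \<omega>) \<in> borel_measurable (restrict_space lborel {0..T} \<Otimes>\<^sub>M F T)"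
      unfolding Z_def split_beta by measurable
    show "Z r \<in> borel_measurable (F r)" if "r \<in> {0..T}" for r
    proof -
      \<comment> \<open>Cells that begin after \<open>r\<close> carry conditional expectations that
        need not be \<open>F r\<close>-measurable, but their indicators vanish at
        \<open>r\<close>.\<close>
      have "(\<lambda>\<omega>. indicator {real i * d j..<real (Suc i) * d j} r *\<^sub>R vec_cond_exp M (F (real i * d j)) z \<omega>)
          \<in> borel_measurable (F r)" for i j
        using em[of i j r] that by (cases "real i * d j \<le> r") (auto intro: borel_measurable_scaleR)
      then have [measurable]: "X j r \<in> borel_measurable (F r)" for j unfolding X_def by measurable
      show ?thesis unfolding Z_def by measurable
    qed
    have Dm: "D j \<in> borel_measurable lborel" for j unfolding D_def by measurable
    have "(\<integral>\<^sup>+r. (\<Sum>j. D j r) \<partial>lborel) = (\<Sum>j. \<integral>\<^sup>+r. D j r \<partial>lborel)"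
      by (rule nn_integral_suminf[OF Dm])
    also have "\<dots> \<le> (\<Sum>j. ennreal (d j * (l2norm M z)\<^sup>2))"
      using cond_exp_grid_error_integral[OF assms, of "2 ^ _"]
      unfolding D_def m_def d_def by (intro suminf_le) auto
    also have "\<dots> = (\<Sum>j. ennreal (T * (l2norm M z)\<^sup>2 * (1 / 2) ^ j))"
      by (simp add: d_def power_one_over field_simps)
    also have "\<dots> = ennreal (\<Sum>j. T * (l2norm M z)\<^sup>2 * (1 / 2) ^ j)"
      using assms(1) by (intro suminf_ennreal2 summable_mult summable_geometric) auto
    finally have "(\<integral>\<^sup>+r. (\<Sum>j. D j r) \<partial>lborel) \<noteq> \<infinity>"
      using ennreal_less_top le_less_trans by (metis infinity_ennreal_def less_irrefl)
    then have AE1: "AE r in lborel. (\<Sum>j. D j r) \<noteq> \<infinity>"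
      using Dm by (intro nn_integral_PInf_AE) auto
    \<comment> \<open>The cells are open on the right, so at \<open>r = T\<close> every
      \<open>X j\<close> is 0 and the limit carries no information there.\<close>
    have AE2: "AE r in lborel. r \<noteq> T" by (rule AE_lborel_singleton)
    show "AE r in lborel. r \<in> {0..T} \<longrightarrow> (AE \<omega> in M. Z r \<omega> = vec_cond_exp M (F r) z \<omega>)"
      using AE1 AE2
    proof (eventually_elim, intro impI)
      fix r assume fin: "(\<Sum>j. D j r) \<noteq> \<infinity>" and "r \<noteq> T" "r \<in> {0..T}"
      then have r: "0 \<le> r" "r < T" by auto
      let ?Q = "\<lambda>j \<omega>. ennreal ((norm (vec_cond_exp M (F r) z \<omega> - X j r \<omega>))\<^sup>2)"
      have em': "vec_cond_exp M (F s) z \<in> borel_measurable M" if "s \<in> {0..T}" for s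
        using measurable_from_subalg[OF subalgebra_F[OF that] vec_cond_exp_measurable] .
      have [measurable]: "vec_cond_exp M (F r) z \<in> borel_measurable M" using r by (intro em') simp
      have [measurable]: "X j r \<in> borel_measurable M" for j
        unfolding X_def using grid dpos[of j]
        by (intro borel_measurable_sum borel_measurable_scaleR em') (auto simp: less_imp_le)
      have [measurable]: "?Q j \<in> borel_measurable M" for j
        by measurable
      have "(\<integral>\<^sup>+\<omega>. (\<Sum>j. ?Q j \<omega>) \<partial>M) = (\<Sum>j. \<integral>\<^sup>+\<omega>. ?Q j \<omega> \<partial>M)"
        by (rule nn_integral_suminf) simp
      also have "\<dots> \<le> (\<Sum>j. D j r)"
        using cond_exp_grid_error[OF assms _ r, of "2 ^ _"]
        unfolding D_def m_def d_def X_def by (intro suminf_le) auto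
      finally have "(\<integral>\<^sup>+\<omega>. (\<Sum>j. ?Q j \<omega>) \<partial>M) \<noteq> \<infinity>" using fin by (auto simp: top_unique)
      then have "AE \<omega> in M. (\<Sum>j. ?Q j \<omega>) \<noteq> \<infinity>" by (intro nn_integral_PInf_AE) auto
      then show "AE \<omega> in M. Z r \<omega> = vec_cond_exp M (F r) z \<omega>"
      proof (rule AE_mp, intro AE_I2 impI)
        fix \<omega> assume "(\<Sum>j. ?Q j \<omega>) \<noteq> \<infinity>"
        then have "summable (\<lambda>j. (norm (vec_cond_exp M (F r) z \<omega> - X j r \<omega>))\<^sup>2)"
          by (intro summable_suminf_not_top) auto
        then have "(\<lambda>j. (norm (vec_cond_exp M (F r) z \<omega> - X j r \<omega>))\<^sup>2) \<longlonglongrightarrow> 0"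
          by (rule summable_LIMSEQ_zero)
        from tendsto_real_sqrt[OF this]
        have "(\<lambda>j. norm (vec_cond_exp M (F r) z \<omega> - X j r \<omega>)) \<longlonglongrightarrow> 0" by simp
        from tendsto_diff[OF tendsto_const tendsto_norm_zero_cancel[OF this], of "vec_cond_exp M (F r) z \<omega>"]
        have "(\<lambda>j. X j r \<omega>) \<longlonglongrightarrow> vec_cond_exp M (F r) z \<omega>" by simp
        then show "Z r \<omega> = vec_cond_exp M (F r) z \<omega>" by (simp add: Z_def limI)
      qed
    qed
  qed
qed

end

section \<open>The control map and its adjoint\<close>

text \<open>\<open>norm\<close> of a matrix is the Euclidean norm of all its entries, the Frobenius
  norm, so this is Cauchy-Schwarz in each row.\<close>

lemma norm_matrix_vector_mult_le:
  fixes A :: "real^'m^'n"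
  shows "norm (A *v x) \<le> norm A * norm x"
proof -
  have "(norm (A *v x))\<^sup>2 = (\<Sum>i\<in>UNIV. (A $ i \<bullet> x)\<^sup>2)"
    unfolding norm_vec_power2 by (simp add: matrix_vector_mul_component)
  also have "\<dots> \<le> (\<Sum>i\<in>UNIV. (norm (A $ i))\<^sup>2 * (norm x)\<^sup>2)"
    by (intro sum_mono) (metis Cauchy_Schwarz_ineq power2_norm_eq_inner)
  also have "\<dots> = (norm A)\<^sup>2 * (norm x)\<^sup>2"
    by (simp add: norm_vec_def L2_set_def sum_nonneg sum_distrib_right)
  finally have "(norm (A *v x))\<^sup>2 \<le> (norm A * norm x)\<^sup>2" by (simp add: power_mult_distrib)
  then show ?thesis by (rule power2_le_imp_le) simp
qed

lemma norm_vec_power2_norm: "(norm x)\<^sup>2 = (\<Sum>i\<in>UNIV. (norm (x $ i))\<^sup>2)"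
  for x :: "('b::real_normed_vector)^'n"
  by (simp add: norm_vec_def L2_set_def sum_nonneg)

lemma norm_transpose_matrix:
  fixes A :: "real^'m^'n"
  shows "norm (transpose A) = norm A"
proof -
  have "(norm (transpose A))\<^sup>2 = (\<Sum>i\<in>UNIV. \<Sum>j\<in>UNIV. (A $ j $ i)\<^sup>2)"
    unfolding norm_vec_power2_norm[of "transpose A"] norm_vec_power2 by (simp add: transpose_def)
  also have "\<dots> = (\<Sum>j\<in>UNIV. \<Sum>i\<in>UNIV. (A $ j $ i)\<^sup>2)" by (rule sum.swap)
  also have "\<dots> = (norm A)\<^sup>2"
    unfolding norm_vec_power2_norm[of A] norm_vec_power2 by simp
  finally show ?thesis by simp
qed

lemma continuous_on_transpose: "continuous_on S (transpose :: real^'m^'n \<Rightarrow> real^'n^'m)"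
  unfolding transpose_def by (intro continuous_intros)

lemma continuous_on_matrix_vector_mult:
  "continuous_on S (\<lambda>x. (fst x :: real^'m^'n) *v snd x)"
  unfolding matrix_vector_mult_def by (intro continuous_intros)

lemma borel_measurable_transpose [measurable (raw)]:
  fixes f :: "'a \<Rightarrow> real^'m^'n"
  assumes "f \<in> borel_measurable M"
  shows "(\<lambda>x. transpose (f x)) \<in> borel_measurable M"
  by (rule measurable_compose[OF assms borel_measurable_continuous_onI[OF continuous_on_transpose]])

lemma borel_measurable_matrix_vector_mult [measurable (raw)]:
  fixes f :: "'a \<Rightarrow> real^'m^'n" and g :: "'a \<Rightarrow> real^'m"
  assumes "f \<in> borel_measurable M" "g \<in> borel_measurable M"
  shows "(\<lambda>x. f x *v g x) \<in> borel_measurable M"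
  using borel_measurable_continuous_Pair[OF assms continuous_on_matrix_vector_mult] by simp

lemma inner_transpose_matrix_vector:
  fixes A :: "real^'m^'n"
  shows "(A *v x) \<bullet> y = x \<bullet> (transpose A *v y)"
  by (metis dot_lmul_matrix inner_commute transpose_matrix_vector)

lemma L2_rv_norm:
  fixes f :: "'a \<Rightarrow> 'b::euclidean_space"
  assumes "f \<in> L2_rv M M"
  shows "(\<lambda>\<omega>. norm (f \<omega>)) \<in> L2_rv M M"
  using assms by (auto simp: L2_rv_def)

lemma l2norm_norm: "l2norm M (\<lambda>\<omega>. norm (f \<omega>)) = l2norm M f"
  by (simp add: l2norm_def)

lemma L2_rv_matrix_vector_integral:
  fixes K :: "'a \<Rightarrow> real^'m^'n" and u :: "'a \<Rightarrow> real^'m"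
  assumes K: "K \<in> L2_rv N N" and u: "u \<in> L2_rv N N"
  shows "integrable N (\<lambda>r. K r *v u r)"
    and "norm (LINT r|N. K r *v u r) \<le> l2norm N K * l2norm N u"
proof -
  have [measurable]: "K \<in> borel_measurable N" "u \<in> borel_measurable N"
    using L2_rv_measurable[OF K] L2_rv_measurable[OF u] by auto
  have int: "integrable N (\<lambda>r. norm (K r) * norm (u r))"
    using L2_rv_integrable_inner[OF L2_rv_norm[OF K] L2_rv_norm[OF u]] by simp
  show *: "integrable N (\<lambda>r. K r *v u r)"
    by (rule Bochner_Integration.integrable_bound[OF int]) (auto simp: norm_matrix_vector_mult_le)
  have "norm (LINT r|N. K r *v u r) \<le> (LINT r|N. norm (K r *v u r))" by (rule integral_norm_bound)
  also have "\<dots> \<le> (LINT r|N. norm (K r) * norm (u r))"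
    using * int by (intro integral_mono) (auto simp: norm_matrix_vector_mult_le)
  also have "\<dots> \<le> l2norm N K * l2norm N u"
    using L2_rv_Cauchy_Schwarz[OF L2_rv_norm[OF K] L2_rv_norm[OF u]] by (simp add: l2norm_norm)
  finally show "norm (LINT r|N. K r *v u r) \<le> l2norm N K * l2norm N u" .
qed

abbreviation interval_measure_upto :: "real \<Rightarrow> real measure" where
  "interval_measure_upto b \<equiv> restrict_space lborel {0..b}"

lemma finite_measure_interval: "finite_measure (interval_measure_upto b)"
  by (intro finite_measureI) (simp add: emeasure_restrict_space space_restrict_space emeasure_lborel_Icc_eq)

lemma set_integral_interval:
  fixes f :: "real \<Rightarrow> 'b::{banach, second_countable_topology}"
  shows "(LINT r:{0..b}|lborel. f r) = (LINT r|interval_measure_upto b. f r)"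
  by (simp add: integral_restrict_space set_lebesgue_integral_def)

lemma L2_adapted_iff:
  "u \<in> L2_adapted M F b \<longleftrightarrow>
    case_prod u \<in> L2_rv (interval_measure_upto b \<Otimes>\<^sub>M M) (interval_measure_upto b \<Otimes>\<^sub>M M)
    \<and> (\<forall>t\<in>{0..b}. u t \<in> borel_measurable (F t))"
proof -
  have "(\<lambda>(t, \<omega>). (norm (u t \<omega>))\<^sup>2) = (\<lambda>x. (norm (case_prod u x))\<^sup>2)" by auto
  then show ?thesis unfolding L2_adapted_def L2_rv_def mem_Collect_eq by auto
qed

definition control_map :: "real \<Rightarrow> (real \<Rightarrow> real^'m^'n) \<Rightarrow> (real \<Rightarrow> 'a \<Rightarrow> real^'m) \<Rightarrow> 'a \<Rightarrow> real^'n" where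
  "control_map b K u \<omega> = (LINT r:{0..b}|lborel. K r *v u r \<omega>)"

lemma measurable_subalgebra_pair:
  assumes "f \<in> borel_measurable (N \<Otimes>\<^sub>M G)" "subalgebra M G"
  shows "f \<in> borel_measurable (N \<Otimes>\<^sub>M M)"
proof -
  have "id \<in> measurable M G"
    using assms(2) by (auto simp: subalgebra_def measurable_def)
  then have "(\<lambda>x. (fst x, id (snd x))) \<in> measurable (N \<Otimes>\<^sub>M M) (N \<Otimes>\<^sub>M G)" by measurable
  from measurable_compose[OF this assms(1)] show ?thesis by simp
qed

text \<open>Measurability of a parameter integral. \<open>G\<close> is left open because two cases
  occur: \<open>M\<close> for arbitrary controls, and \<open>F T\<close> for images that have to
  stay in L2 of \<open>F T\<close>.\<close>

lemma control_map_measurable: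
  fixes K :: "real \<Rightarrow> real^'m^'n"
  assumes [measurable]: "K \<in> borel_measurable (interval_measure_upto b)"
    and u: "case_prod u \<in> borel_measurable (interval_measure_upto b \<Otimes>\<^sub>M G)"
  shows "control_map b K u \<in> borel_measurable G"
proof -
  interpret N: finite_measure "interval_measure_upto b" by (rule finite_measure_interval)
  have "(\<lambda>x. case_prod u (snd x, fst x)) \<in> borel_measurable (G \<Otimes>\<^sub>M interval_measure_upto b)"
    by (rule measurable_compose[OF _ u]) simp
  then have [measurable]: "(\<lambda>x. u (snd x) (fst x)) \<in> borel_measurable (G \<Otimes>\<^sub>M interval_measure_upto b)"
    by simp
  show ?thesis
    unfolding control_map_def set_integral_interval
    by (intro N.borel_measurable_lebesgue_integral) (simp add: split_beta)
qed

section \<open>The control map on square-integrable controls and the adjoint identity\<close>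

context usual_filtered_prob_space
begin

abbreviation "NT \<equiv> interval_measure_upto T"
abbreviation "PT \<equiv> NT \<Otimes>\<^sub>M M"

text \<open>The condition under \<open>SOME\<close> in \<open>cond_exp_process\<close>, named
  because a second version with stronger measurability is used beside the chosen one.\<close>

definition is_cond_exp_version :: "('a \<Rightarrow> real^'n) \<Rightarrow> (real \<Rightarrow> 'a \<Rightarrow> real^'n) \<Rightarrow> bool" where
  "is_cond_exp_version z Z \<longleftrightarrow> Z \<in> L2_adapted M F T \<and>
     (AE r in lborel. r \<in> {0..T} \<longrightarrow> (AE \<omega> in M. Z r \<omega> = vec_cond_exp M (F r) z \<omega>))"

lemma pair_sigma_finite_NT: "pair_sigma_finite NT M"
proof -
  interpret N: finite_measure NT by (rule finite_measure_interval)
  show ?thesis by unfold_locales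
qed

lemma AE_NT_iff: "(AE r in NT. P r) \<longleftrightarrow> (AE r in lborel. r \<in> {0..T} \<longrightarrow> P r)"
  by (rule AE_restrict_space_iff) simp

lemma space_NT: "space NT = {0..T}"
  by (simp add: space_restrict_space)

text \<open>Cauchy-Schwarz in \<open>r\<close> on almost every path, then Tonelli. The almost sure
  integrability is recorded because a Bochner integral is 0 by convention when the integrand is not
  integrable, so an inner product may be moved under the integral only on the integrable
  paths.\<close>

lemma control_map_L2:
  fixes K :: "real \<Rightarrow> real^'m^'n"
  assumes K: "K \<in> L2_rv NT NT" and u: "case_prod u \<in> L2_rv PT PT"
  shows "control_map T K u \<in> L2_rv M M"
    and "l2norm M (control_map T K u) \<le> l2norm NT K * l2norm PT (case_prod u)"
    and "AE \<omega> in M. integrable NT (\<lambda>r. K r *v u r \<omega>)"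
proof -
  interpret P: pair_sigma_finite NT M by (rule pair_sigma_finite_NT)
  interpret N: finite_measure NT by (rule finite_measure_interval)
  have um [measurable]: "case_prod u \<in> borel_measurable PT" by (rule L2_rv_measurable[OF u])
  have um' [measurable]: "(\<lambda>r. u r \<omega>) \<in> borel_measurable NT" if "\<omega> \<in> space M" for \<omega>
    using measurable_compose[OF measurable_Pair2'[OF that] um] by simp
  have m: "control_map T K u \<in> borel_measurable M"
    by (rule control_map_measurable[OF L2_rv_measurable[OF K] um])
  have "integrable (M \<Otimes>\<^sub>M NT) (\<lambda>(\<omega>, r). (norm (case_prod u (r, \<omega>)))\<^sup>2)"
    by (rule P.integrable_product_swap[OF L2_rv_integrable[OF u]])
  then have "integrable (M \<Otimes>\<^sub>M NT) (\<lambda>(\<omega>, r). (norm (u r \<omega>))\<^sup>2)" by simp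
  interpret P': pair_sigma_finite M NT ..
  have "AE \<omega> in M. integrable NT (\<lambda>r. (norm (u r \<omega>))\<^sup>2)"
    using P'.AE_integrable_fst'[OF \<open>integrable (M \<Otimes>\<^sub>M NT) (\<lambda>(\<omega>, r). (norm (u r \<omega>))\<^sup>2)\<close>] by simp
  then have uL: "AE \<omega> in M. (\<lambda>r. u r \<omega>) \<in> L2_rv NT NT"
    by (rule AE_mp, intro AE_I2 impI) (use um' in \<open>simp add: L2_rv_def\<close>)
  then show "AE \<omega> in M. integrable NT (\<lambda>r. K r *v u r \<omega>)"
    by eventually_elim (rule L2_rv_matrix_vector_integral(1)[OF K])
  have "AE \<omega> in M. ennreal ((norm (control_map T K u \<omega>))\<^sup>2)
      \<le> ennreal ((l2norm NT K)\<^sup>2) * (\<integral>\<^sup>+r. ennreal ((norm (u r \<omega>))\<^sup>2) \<partial>NT)"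
    using uL
  proof eventually_elim
    case (elim \<omega>)
    have "(norm (control_map T K u \<omega>))\<^sup>2 \<le> (l2norm NT K * l2norm NT (\<lambda>r. u r \<omega>))\<^sup>2"
      using L2_rv_matrix_vector_integral(2)[OF K elim]
      by (intro power_mono) (simp_all add: control_map_def set_integral_interval)
    then have "ennreal ((norm (control_map T K u \<omega>))\<^sup>2)
        \<le> ennreal ((l2norm NT K)\<^sup>2 * (l2norm NT (\<lambda>r. u r \<omega>))\<^sup>2)"
      by (intro ennreal_leI) (simp add: power_mult_distrib)
    then show ?case unfolding L2_rv_nn_integral[OF elim] by (simp add: ennreal_mult)
  qed
  then have "(\<integral>\<^sup>+\<omega>. ennreal ((norm (control_map T K u \<omega>))\<^sup>2) \<partial>M)
      \<le> (\<integral>\<^sup>+\<omega>. ennreal ((l2norm NT K)\<^sup>2) * (\<integral>\<^sup>+r. ennreal ((norm (u r \<omega>))\<^sup>2) \<partial>NT) \<partial>M)"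
    by (rule nn_integral_mono_AE)
  also have "\<dots> = ennreal ((l2norm NT K)\<^sup>2) * (\<integral>\<^sup>+\<omega>. (\<integral>\<^sup>+r. ennreal ((norm (u r \<omega>))\<^sup>2) \<partial>NT) \<partial>M)"
  proof (rule nn_integral_cmult)
    have "(\<lambda>x. case_prod u (snd x, fst x)) \<in> borel_measurable (M \<Otimes>\<^sub>M NT)"
      by (rule measurable_compose[OF _ um]) simp
    then have [measurable]: "(\<lambda>x. u (snd x) (fst x)) \<in> borel_measurable (M \<Otimes>\<^sub>M NT)" by simp
    show "(\<lambda>\<omega>. \<integral>\<^sup>+r. ennreal ((norm (u r \<omega>))\<^sup>2) \<partial>NT) \<in> borel_measurable M"
      by (rule P.M1.borel_measurable_nn_integral) (simp add: split_beta')
  qed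
  also have "(\<integral>\<^sup>+\<omega>. (\<integral>\<^sup>+r. ennreal ((norm (u r \<omega>))\<^sup>2) \<partial>NT) \<partial>M)
      = (\<integral>\<^sup>+x. ennreal ((norm (case_prod u x))\<^sup>2) \<partial>PT)"
    using P.nn_integral_snd[of "\<lambda>(r, \<omega>). ennreal ((norm (u r \<omega>))\<^sup>2)"] by (simp add: split_beta')
  also have "\<dots> = ennreal ((l2norm PT (case_prod u))\<^sup>2)" by (rule L2_rv_nn_integral[OF u])
  finally have le: "(\<integral>\<^sup>+\<omega>. ennreal ((norm (control_map T K u \<omega>))\<^sup>2) \<partial>M)
      \<le> ennreal ((l2norm NT K * l2norm PT (case_prod u))\<^sup>2)"
    by (simp add: power_mult_distrib ennreal_mult)
  show "control_map T K u \<in> L2_rv M M"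
    and "l2norm M (control_map T K u) \<le> l2norm NT K * l2norm PT (case_prod u)"
    by (rule L2_rv_nn_integralD[OF m le]; simp)+
qed

text \<open>\<open>K\<close> is merely square-integrable and may be unbounded in \<open>r\<close>,
  so a bound of \<open>Y\<close> in mean square over \<open>PT\<close> would not control the
  product. A bound on almost every slice lets the integral of the squared norm of \<open>K\<close>
  factor out.\<close>

lemma transpose_mult_L2:
  fixes K :: "real \<Rightarrow> real^'m^'n"
  assumes K: "K \<in> L2_rv NT NT" and Y: "case_prod Y \<in> borel_measurable PT"
    and le: "AE r in NT. (\<integral>\<^sup>+\<omega>. ennreal ((norm (Y r \<omega>))\<^sup>2) \<partial>M) \<le> ennreal (c\<^sup>2)" and c: "0 \<le> c"
  shows "case_prod (\<lambda>r \<omega>. transpose (K r) *v Y r \<omega>) \<in> L2_rv PT PT"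
    and "l2norm PT (case_prod (\<lambda>r \<omega>. transpose (K r) *v Y r \<omega>)) \<le> l2norm NT K * c"
proof -
  note [measurable] = Y
  have [measurable]: "K \<in> borel_measurable NT" by (rule L2_rv_measurable[OF K])
  have Ym: "Y r \<in> borel_measurable M" if "r \<in> space NT" for r
    using measurable_compose[OF measurable_Pair1'[OF that] Y] by simp
  have "(\<lambda>x. transpose (K (fst x)) *v case_prod Y x) \<in> borel_measurable PT"
    by (intro borel_measurable_matrix_vector_mult borel_measurable_transpose Y) measurable
  then have m: "case_prod (\<lambda>r \<omega>. transpose (K r) *v Y r \<omega>) \<in> borel_measurable PT"
    by (simp only: split_beta')
  have "(\<integral>\<^sup>+x. ennreal ((norm (case_prod (\<lambda>r \<omega>. transpose (K r) *v Y r \<omega>) x))\<^sup>2) \<partial>PT)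
      = (\<integral>\<^sup>+r. (\<integral>\<^sup>+\<omega>. ennreal ((norm (transpose (K r) *v Y r \<omega>))\<^sup>2) \<partial>M) \<partial>NT)"
  proof -
    have "(\<lambda>x. ennreal ((norm (case_prod (\<lambda>r \<omega>. transpose (K r) *v Y r \<omega>) x))\<^sup>2)) \<in> borel_measurable PT"
      using m by measurable
    from nn_integral_fst[OF this] show ?thesis by simp
  qed
  also have "\<dots> \<le> (\<integral>\<^sup>+r. ennreal ((norm (K r))\<^sup>2) * ennreal (c\<^sup>2) \<partial>NT)"
  proof (rule nn_integral_mono_AE)
    show "AE r in NT. (\<integral>\<^sup>+\<omega>. ennreal ((norm (transpose (K r) *v Y r \<omega>))\<^sup>2) \<partial>M)
      \<le> ennreal ((norm (K r))\<^sup>2) * ennreal (c\<^sup>2)"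
      using le AE_space[of NT]
    proof eventually_elim
      case (elim r)
      note [measurable] = Ym[OF elim(2)]
      have "(\<integral>\<^sup>+\<omega>. ennreal ((norm (transpose (K r) *v Y r \<omega>))\<^sup>2) \<partial>M)
          \<le> (\<integral>\<^sup>+\<omega>. ennreal ((norm (K r))\<^sup>2) * ennreal ((norm (Y r \<omega>))\<^sup>2) \<partial>M)"
      proof (intro nn_integral_mono)
        fix \<omega>
        have "(norm (transpose (K r) *v Y r \<omega>))\<^sup>2 \<le> (norm (K r) * norm (Y r \<omega>))\<^sup>2"
          using norm_matrix_vector_mult_le[of "transpose (K r)" "Y r \<omega>"]
          by (intro power_mono) (simp_all add: norm_transpose_matrix)
        then show "ennreal ((norm (transpose (K r) *v Y r \<omega>))\<^sup>2) \<le> ennreal ((norm (K r))\<^sup>2) * ennreal ((norm (Y r \<omega>))\<^sup>2)"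
          by (simp add: ennreal_mult[symmetric] power_mult_distrib ennreal_leI)
      qed
      also have "\<dots> = ennreal ((norm (K r))\<^sup>2) * (\<integral>\<^sup>+\<omega>. ennreal ((norm (Y r \<omega>))\<^sup>2) \<partial>M)"
        by (rule nn_integral_cmult) measurable
      also have "\<dots> \<le> ennreal ((norm (K r))\<^sup>2) * ennreal (c\<^sup>2)" using elim(1) by (rule mult_left_mono) simp
      finally show ?case .
    qed
  qed
  also have "\<dots> = ennreal ((l2norm NT K)\<^sup>2) * ennreal (c\<^sup>2)"
    by (subst nn_integral_multc) (simp_all add: L2_rv_nn_integral[OF K])
  also have "\<dots> = ennreal ((l2norm NT K * c)\<^sup>2)" by (simp add: power_mult_distrib ennreal_mult)
  finally have le': "(\<integral>\<^sup>+x. ennreal ((norm (case_prod (\<lambda>r \<omega>. transpose (K r) *v Y r \<omega>) x))\<^sup>2) \<partial>PT)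
    \<le> ennreal ((l2norm NT K * c)\<^sup>2)" .
  show "case_prod (\<lambda>r \<omega>. transpose (K r) *v Y r \<omega>) \<in> L2_rv PT PT"
    and "l2norm PT (case_prod (\<lambda>r \<omega>. transpose (K r) *v Y r \<omega>)) \<le> l2norm NT K * c"
    by (rule L2_rv_nn_integralD[OF m le']; simp add: c)+
qed

text \<open>Conditional expectation is a contraction, and on almost every slice a version differs
  from it on a null set only. This is the slice bound that \<open>transpose_mult_L2\<close> asks
  for.\<close>

lemma cond_exp_version_bound:
  assumes z: "z \<in> L2_rv M M"
    and Z: "AE r in NT. AE \<omega> in M. Z r \<omega> = vec_cond_exp M (F r) z \<omega>"
  shows "AE r in NT. (\<integral>\<^sup>+\<omega>. ennreal ((norm (Z r \<omega>))\<^sup>2) \<partial>M) \<le> ennreal ((l2norm M z)\<^sup>2)"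
  using Z AE_space
proof eventually_elim
  case (elim r)
  then have sub: "subalgebra M (F r)" by (intro subalgebra_F) (simp add: space_NT)
  have "(\<integral>\<^sup>+\<omega>. ennreal ((norm (Z r \<omega>))\<^sup>2) \<partial>M) = (\<integral>\<^sup>+\<omega>. ennreal ((norm (vec_cond_exp M (F r) z \<omega>))\<^sup>2) \<partial>M)"
    using elim(1) by (intro nn_integral_cong_AE, eventually_elim) simp
  also have "\<dots> = ennreal ((l2norm M (vec_cond_exp M (F r) z))\<^sup>2)"
    by (rule L2_rv_nn_integral[OF L2_rv_superalgebra[OF vec_cond_exp_L2[OF sub z] sub]])
  also have "\<dots> \<le> ennreal ((l2norm M z)\<^sup>2)"
    by (intro ennreal_leI power_mono vec_cond_exp_norm_le sub z) simp
  finally show ?case .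
qed

lemma is_cond_exp_version_exists:
  assumes "0 < T" and z: "z \<in> L2_rv M M"
  obtains Z where "is_cond_exp_version z Z" "case_prod Z \<in> borel_measurable (NT \<Otimes>\<^sub>M F T)"
proof -
  from cond_exp_version_exists[OF assms]
  obtain Z where Z: "(\<lambda>(r, \<omega>). Z r \<omega>) \<in> borel_measurable (NT \<Otimes>\<^sub>M F T)"
    "\<And>r. r \<in> {0..T} \<Longrightarrow> Z r \<in> borel_measurable (F r)"
    "AE r in lborel. r \<in> {0..T} \<longrightarrow> (AE \<omega> in M. Z r \<omega> = vec_cond_exp M (F r) z \<omega>)" by blast
  have m: "case_prod Z \<in> borel_measurable PT"
    using assms(1) by (intro measurable_subalgebra_pair[OF Z(1)] subalgebra_F) simp
  \<comment> \<open>With the identity as kernel, \<open>transpose_mult_L2\<close> turns the slice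
    bound into square-integrability of \<open>Z\<close> itself.\<close>
  have I: "(\<lambda>_. mat 1 :: real^'b^'b) \<in> L2_rv NT NT"
    by (rule L2_rv_const[OF finite_measure_interval])
  have "case_prod Z \<in> L2_rv PT PT"
    using transpose_mult_L2(1)[OF I m cond_exp_version_bound[OF z]] Z(3) by (simp add: AE_NT_iff)
  with Z show ?thesis
    by (intro that[of Z]) (auto simp: is_cond_exp_version_def L2_adapted_iff)
qed

text \<open>The adjoint of \<open>control_map T K\<close>. Its argument is a version
  \<open>Z\<close> instead of the variable z, so that different versions can be compared.\<close>

definition dual_control :: "(real \<Rightarrow> real^'m^'n) \<Rightarrow> (real \<Rightarrow> 'a \<Rightarrow> real^'n) \<Rightarrow> real \<Rightarrow> 'a \<Rightarrow> real^'m" where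
  "dual_control K Z r \<omega> = transpose (K r) *v Z r \<omega>"

lemma dual_control_L2:
  fixes K :: "real \<Rightarrow> real^'m^'n"
  assumes K: "K \<in> L2_rv NT NT" and z: "z \<in> L2_rv M M" and Z: "is_cond_exp_version z Z"
  shows "dual_control K Z \<in> L2_adapted M F T"
    and "l2norm PT (case_prod (dual_control K Z)) \<le> l2norm NT K * l2norm M z"
proof -
  have ZL: "case_prod Z \<in> L2_rv PT PT" "\<And>t. t \<in> {0..T} \<Longrightarrow> Z t \<in> borel_measurable (F t)"
    and ZE: "AE r in NT. AE \<omega> in M. Z r \<omega> = vec_cond_exp M (F r) z \<omega>"
    using Z by (auto simp: is_cond_exp_version_def L2_adapted_iff AE_NT_iff)
  note * = transpose_mult_L2[OF K L2_rv_measurable[OF ZL(1)] cond_exp_version_bound[OF z ZE]]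
  have "dual_control K Z t \<in> borel_measurable (F t)" if "t \<in> {0..T}" for t
  proof -
    note [measurable] = ZL(2)[OF that]
    show ?thesis unfolding dual_control_def by measurable
  qed
  then show "dual_control K Z \<in> L2_adapted M F T"
    using *(1) by (simp add: L2_adapted_iff dual_control_def[abs_def])
  show "l2norm PT (case_prod (dual_control K Z)) \<le> l2norm NT K * l2norm M z"
    using *(2) by (simp add: dual_control_def[abs_def])
qed

text \<open>Fubini moves the inner product with \<open>z\<close> under the integral over
  \<open>r\<close>. At almost every \<open>r\<close> the vector \<open>K r *v u r\<close> is
  square-integrable and, as \<open>u\<close> is adapted, \<open>F r\<close>-measurable; so
  \<open>z\<close> may be replaced by its projection and then by \<open>Z r\<close>, and
  \<open>K r\<close> is moved to the other side by transposition.\<close>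

lemma control_map_adjoint:
  fixes K :: "real \<Rightarrow> real^'m^'n"
  assumes K: "K \<in> L2_rv NT NT" and u: "u \<in> L2_adapted M F T"
    and z: "z \<in> L2_rv M M" and Z: "is_cond_exp_version z Z"
  shows "(LINT \<omega>|M. control_map T K u \<omega> \<bullet> z \<omega>)
    = (LINT x|PT. case_prod u x \<bullet> case_prod (dual_control K Z) x)"
proof -
  interpret P: pair_sigma_finite NT M by (rule pair_sigma_finite_NT)
  have uL: "case_prod u \<in> L2_rv PT PT" and uF: "\<And>t. t \<in> {0..T} \<Longrightarrow> u t \<in> borel_measurable (F t)"
    using u by (auto simp: L2_adapted_iff)
  have zm [measurable]: "z \<in> borel_measurable M" by (rule L2_rv_measurable[OF z])
  have "case_prod (\<lambda>r \<omega>. transpose (K r) *v z \<omega>) \<in> L2_rv PT PT"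
  proof (rule transpose_mult_L2(1)[OF K])
    show "AE r in NT. (\<integral>\<^sup>+ \<omega>. ennreal ((norm (z \<omega>))\<^sup>2) \<partial>M) \<le> ennreal ((l2norm M z)\<^sup>2)"
      by (simp add: L2_rv_nn_integral[OF z])
  qed (simp_all add: split_beta')
  from L2_rv_integrable_inner[OF uL this]
  have int: "integrable PT (\<lambda>(r, \<omega>). (K r *v u r \<omega>) \<bullet> z \<omega>)"
    by (simp add: split_beta' inner_transpose_matrix_vector)
  have int2: "integrable PT (\<lambda>(r, \<omega>). u r \<omega> \<bullet> dual_control K Z r \<omega>)"
    using L2_rv_integrable_inner[OF uL] dual_control_L2(1)[OF K z Z]
    by (simp add: split_beta' L2_adapted_iff)
  have "(LINT \<omega>|M. control_map T K u \<omega> \<bullet> z \<omega>) = (LINT \<omega>|M. LINT r|NT. (K r *v u r \<omega>) \<bullet> z \<omega>)"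
  proof (rule integral_cong_AE)
    show "(\<lambda>\<omega>. control_map T K u \<omega> \<bullet> z \<omega>) \<in> borel_measurable M"
      using L2_rv_measurable[OF control_map_L2(1)[OF K uL]] by measurable
    show "(\<lambda>\<omega>. LINT r|NT. (K r *v u r \<omega>) \<bullet> z \<omega>) \<in> borel_measurable M"
      using P.integrable_snd[OF int] by simp
    show "AE \<omega> in M. control_map T K u \<omega> \<bullet> z \<omega> = (LINT r|NT. (K r *v u r \<omega>) \<bullet> z \<omega>)"
      using control_map_L2(3)[OF K uL]
      by eventually_elim (simp add: control_map_def set_integral_interval)
  qed
  also have "\<dots> = (LINT r|NT. LINT \<omega>|M. (K r *v u r \<omega>) \<bullet> z \<omega>)"
    by (rule P.Fubini_integral[OF int])
  also have "\<dots> = (LINT r|NT. LINT \<omega>|M. u r \<omega> \<bullet> dual_control K Z r \<omega>)"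
  proof (rule integral_cong_AE)
    show "(\<lambda>r. LINT \<omega>|M. (K r *v u r \<omega>) \<bullet> z \<omega>) \<in> borel_measurable NT"
      using P.integrable_fst[OF int] by simp
    show "(\<lambda>r. LINT \<omega>|M. u r \<omega> \<bullet> dual_control K Z r \<omega>) \<in> borel_measurable NT"
      using P.integrable_fst[OF int2] by simp
    have "AE r in NT. AE \<omega> in M. Z r \<omega> = vec_cond_exp M (F r) z \<omega>"
      using Z by (simp add: is_cond_exp_version_def AE_NT_iff)
    moreover have "AE r in NT. integrable M (\<lambda>\<omega>. (norm (u r \<omega>))\<^sup>2)"
      using P.AE_integrable_fst'[OF L2_rv_integrable[OF uL]] by simp
    ultimately show "AE r in NT. (LINT \<omega>|M. (K r *v u r \<omega>) \<bullet> z \<omega>) = (LINT \<omega>|M. u r \<omega> \<bullet> dual_control K Z r \<omega>)"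
      using AE_space
    proof eventually_elim
      case (elim r)
      then have rT: "r \<in> {0..T}" by (simp add: space_NT)
      then have sub: "subalgebra M (F r)" by (rule subalgebra_F)
      have uLr: "u r \<in> L2_rv M (F r)" using elim(2) uF[OF rT] by (simp add: L2_rv_def)
      note uFr [measurable] = uF[OF rT]
      have f: "(\<lambda>\<omega>. K r *v u r \<omega>) \<in> L2_rv M (F r)"
      proof (rule L2_rv_dominated[OF _ sub])
        show "integrable M (\<lambda>\<omega>. (norm (K r))\<^sup>2 * (norm (u r \<omega>))\<^sup>2)" using elim(2) by simp
        show "AE \<omega> in M. (norm (K r *v u r \<omega>))\<^sup>2 \<le> (norm (K r))\<^sup>2 * (norm (u r \<omega>))\<^sup>2"
          unfolding power_mult_distrib[symmetric]
          by (intro AE_I2 power_mono norm_matrix_vector_mult_le) simp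
      qed measurable
      have [measurable]: "u r \<in> borel_measurable M" "vec_cond_exp M (F r) z \<in> borel_measurable M"
        "Z r \<in> borel_measurable M"
        using measurable_from_subalg[OF sub uFr] measurable_from_subalg[OF sub vec_cond_exp_measurable]
          measurable_from_subalg[OF sub, of "Z r" borel] Z rT
        by (auto simp: is_cond_exp_version_def L2_adapted_iff)
      have "(LINT \<omega>|M. (K r *v u r \<omega>) \<bullet> z \<omega>) = (LINT \<omega>|M. (K r *v u r \<omega>) \<bullet> vec_cond_exp M (F r) z \<omega>)"
        by (rule vec_cond_exp_inner[OF sub z f, symmetric])
      also have "\<dots> = (LINT \<omega>|M. (K r *v u r \<omega>) \<bullet> Z r \<omega>)"
      proof (rule integral_cong_AE)
        show "AE \<omega> in M. (K r *v u r \<omega>) \<bullet> vec_cond_exp M (F r) z \<omega> = (K r *v u r \<omega>) \<bullet> Z r \<omega>"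
          using elim(1) by eventually_elim simp
      qed measurable
      finally show ?case by (simp add: dual_control_def inner_transpose_matrix_vector)
    qed
  qed
  also have "\<dots> = (LINT x|PT. case_prod u x \<bullet> case_prod (dual_control K Z) x)"
    using P.integral_fst[OF int2] by (simp add: split_beta')
  finally show ?thesis .
qed

end

section \<open>Surjectivity and coercivity\<close>

lemma L2_rv_inner_diff_left:
  fixes f g k :: "'a \<Rightarrow> 'b::euclidean_space"
  assumes "f \<in> L2_rv M M" "g \<in> L2_rv M M" "k \<in> L2_rv M M"
  shows "(LINT \<omega>|M. (f \<omega> - g \<omega>) \<bullet> k \<omega>) = (LINT \<omega>|M. f \<omega> \<bullet> k \<omega>) - (LINT \<omega>|M. g \<omega> \<bullet> k \<omega>)"
  using L2_rv_integrable_inner[OF assms(1,3)] L2_rv_integrable_inner[OF assms(2,3)]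
  by (simp add: inner_diff_left)

lemma L2_rv_inner_add_left:
  fixes f g k :: "'a \<Rightarrow> 'b::euclidean_space"
  assumes "f \<in> L2_rv M M" "g \<in> L2_rv M M" "k \<in> L2_rv M M"
  shows "(LINT \<omega>|M. (f \<omega> + c *\<^sub>R g \<omega>) \<bullet> k \<omega>) = (LINT \<omega>|M. f \<omega> \<bullet> k \<omega>) + c * (LINT \<omega>|M. g \<omega> \<bullet> k \<omega>)"
  using L2_rv_integrable_inner[OF assms(1,3)] L2_rv_integrable_inner[OF assms(2,3)]
  by (simp add: inner_add_left)

lemma l2norm_eq_0_imp_AE:
  fixes f :: "'a \<Rightarrow> 'b::euclidean_space"
  assumes f: "f \<in> L2_rv M M" and "l2norm M f = 0"
  shows "AE \<omega> in M. f \<omega> = 0"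
proof -
  have "(LINT \<omega>|M. (norm (f \<omega>))\<^sup>2) = 0" using assms(2) l2norm_power2[of M f] by simp
  then have "AE \<omega> in M. (norm (f \<omega>))\<^sup>2 = 0"
    using integral_nonneg_eq_0_iff_AE[OF L2_rv_integrable[OF f]] by simp
  then show ?thesis by simp
qed

text \<open>Gliding hump: the sign of each increment \<open>\<plusminus>3\<^sup>-\<^sup>n z\<^sub>n / \<parallel>z\<^sub>n\<parallel>\<close> is chosen such that the pairing
  with \<open>z\<^sub>n\<close> is not decreased, and the later increments are too small to undo this.\<close>

lemma L2_uniform_boundedness:
  fixes p :: "('a \<Rightarrow> 'b::euclidean_space) \<Rightarrow> real"
  assumes fin: "finite_measure M" and G: "subalgebra M G"
    and p: "\<And>z. 0 \<le> p z"
    and bounded: "\<And>y. y \<in> L2_rv M G \<Longrightarrow> \<exists>c. \<forall>z\<in>L2_rv M G. \<bar>LINT \<omega>|M. y \<omega> \<bullet> z \<omega>\<bar> \<le> c * p z"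
  shows "\<exists>c>0. \<forall>z\<in>L2_rv M G. l2norm M z \<le> c * p z"
proof (rule ccontr)
  assume neg: "\<not> ?thesis"
  \<comment> \<open>The base 9 is the square of 3: the increments below shrink like 3^-n, and growth
    of order 3^n has to remain for the contradiction.\<close>
  have "\<exists>z\<in>L2_rv M G. 9 ^ n * p z < l2norm M z" for n :: nat
  proof (rule ccontr)
    assume "\<not> ?thesis"
    then have "\<forall>z\<in>L2_rv M G. l2norm M z \<le> 9 ^ n * p z" by (auto simp: not_less)
    then have "\<exists>c>0. \<forall>z\<in>L2_rv M G. l2norm M z \<le> c * p z" by (intro exI[of _ "9 ^ n"]) simp
    with neg show False by contradiction
  qed
  then obtain z where zG: "\<And>n. z n \<in> L2_rv M G" and z: "\<And>n::nat. 9 ^ n * p (z n) < l2norm M (z n)"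
    by metis
  have zM: "z n \<in> L2_rv M M" for n by (rule L2_rv_superalgebra[OF zG G])
  define a where "a n = l2norm M (z n)" for n
  have a: "0 < a n" for n
  proof -
    have "0 \<le> 9 ^ n * p (z n)" using p by simp
    with z[of n] show ?thesis unfolding a_def by linarith
  qed
  \<comment> \<open>Normalized so that the increment \<open>e n *\<^sub>R z n\<close> has norm
    3^-(n+1).\<close>
  define e where "e n = (1 / 3) ^ Suc n / a n" for n
  define step where "step n x = (\<lambda>\<omega>. x \<omega> + (if 0 \<le> (LINT \<omega>|M. x \<omega> \<bullet> z n \<omega>) then e n else - e n) *\<^sub>R z n \<omega>)" for n x
  define X where "X = rec_nat (\<lambda>_. 0) step"
  have X0: "X 0 = (\<lambda>_. 0)" and XS: "X (Suc n) = step n (X n)" for n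
    by (simp_all add: X_def)
  have XG: "X n \<in> L2_rv M G" for n
    by (induction n) (auto simp: X0 XS step_def intro!: L2_rv_zero L2_rv_add L2_rv_diff L2_rv_scaleR zG G)
  have XM: "X n \<in> L2_rv M M" for n by (rule L2_rv_superalgebra[OF XG G])
  have le: "l2norm M (\<lambda>\<omega>. X (Suc n) \<omega> - X n \<omega>) \<le> 1 / 3 * (1 / 3) ^ n" for n
    using a[of n] by (simp add: XS step_def l2norm_scaleR e_def a_def[symmetric])
  obtain Y where YG: "Y \<in> L2_rv M G"
    and Y: "\<And>n. l2norm M (\<lambda>\<omega>. Y \<omega> - X n \<omega>) \<le> 1 / 3 * (1 / 3) ^ n / (1 - 1 / 3)"
    using L2_rv_complete_geometric[OF fin G XG le] by auto
  have YM: "Y \<in> L2_rv M M" by (rule L2_rv_superalgebra[OF YG G])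
  have low: "(1 / 3) ^ Suc n * a n \<le> \<bar>LINT \<omega>|M. X (Suc n) \<omega> \<bullet> z n \<omega>\<bar>" for n
  proof -
    have "e n * (LINT \<omega>|M. z n \<omega> \<bullet> z n \<omega>) = (1 / 3) ^ Suc n * a n"
      using a[of n] l2norm_power2[of M "z n"]
      by (simp add: e_def a_def[symmetric] power2_norm_eq_inner[symmetric] power2_eq_square field_simps)
    moreover have "0 \<le> (1 / 3) ^ Suc n * a n" using a[of n] by simp
    ultimately show ?thesis
      using L2_rv_inner_add_left[OF XM[of n] zM[of n] zM[of n], of "e n"]
        L2_rv_inner_add_left[OF XM[of n] zM[of n] zM[of n], of "- e n"]
      unfolding XS step_def
      by (cases "0 \<le> (LINT \<omega>|M. X n \<omega> \<bullet> z n \<omega>)") (simp_all del: power_Suc)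
  qed
  obtain c where c: "\<And>z. z \<in> L2_rv M G \<Longrightarrow> \<bar>LINT \<omega>|M. Y \<omega> \<bullet> z \<omega>\<bar> \<le> c * p z"
    using bounded[OF YG] by blast
  have "3 ^ n \<le> 6 * \<bar>c\<bar>" for n
  proof -
    have "\<bar>LINT \<omega>|M. (Y \<omega> - X (Suc n) \<omega>) \<bullet> z n \<omega>\<bar> \<le> l2norm M (\<lambda>\<omega>. Y \<omega> - X (Suc n) \<omega>) * a n"
      unfolding a_def by (rule L2_rv_Cauchy_Schwarz[OF L2_rv_diff[OF YM XM subalgebra_refl] zM])
    \<comment> \<open>The increments after step n sum to at most half of 3^-(n+1), so half of the
      lower bound in \<open>low\<close> survives in the limit.\<close>
    also have "\<dots> \<le> 1 / 2 * (1 / 3) ^ Suc n * a n"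
      using Y[of "Suc n"] a[of n] by (intro mult_right_mono) auto
    finally have "1 / 2 * (1 / 3) ^ Suc n * a n \<le> \<bar>LINT \<omega>|M. Y \<omega> \<bullet> z n \<omega>\<bar>"
      using low[of n] L2_rv_inner_diff_left[OF YM XM[of "Suc n"] zM[of n]] by linarith
    also have "\<dots> \<le> \<bar>c\<bar> * p (z n)"
      using c[OF zG[of n]] mult_right_mono[OF abs_ge_self[of c] p[of "z n"]] by linarith
    also have "\<dots> \<le> \<bar>c\<bar> * (a n / 9 ^ n)"
      using z[of n] by (intro mult_left_mono) (simp_all add: a_def field_simps)
    finally have "1 / 2 * (1 / 3) ^ Suc n * a n \<le> \<bar>c\<bar> / 9 ^ n * a n" by simp
    then have "1 / 2 * (1 / 3) ^ Suc n \<le> \<bar>c\<bar> / 9 ^ n"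
      using a[of n] by (simp only: mult_le_cancel_right_pos)
    then have "9 ^ n * (1 / 3) ^ n \<le> 6 * \<bar>c\<bar>" by (simp add: field_simps)
    then show ?thesis by (simp add: power_mult_distrib[symmetric])
  qed
  moreover obtain n where "6 * \<bar>c\<bar> < 3 ^ n" using real_arch_pow[of 3 "6 * \<bar>c\<bar>"] by auto
  ultimately show False by (meson not_less)
qed

text \<open>The residuals of the Richardson iteration \<open>R\<^sub>n\<^sub>+\<^sub>1 = R\<^sub>n - \<rho> W R\<^sub>n\<close> decay geometrically, so
  \<open>z = \<rho> \<Sum> R\<^sub>n\<close> solves the equation. It is tested against \<open>W w\<close>, so only symmetry of
  \<open>W\<close> is used, not linearity.\<close>

lemma L2_coercive_solve:
  fixes W :: "('a \<Rightarrow> 'b::euclidean_space) \<Rightarrow> 'a \<Rightarrow> 'b"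
  assumes fin: "finite_measure M" and G: "subalgebra M G"
    and W: "\<And>x. x \<in> L2_rv M G \<Longrightarrow> W x \<in> L2_rv M G"
    and sym: "\<And>x y. x \<in> L2_rv M G \<Longrightarrow> y \<in> L2_rv M G \<Longrightarrow>
      (LINT \<omega>|M. W x \<omega> \<bullet> y \<omega>) = (LINT \<omega>|M. x \<omega> \<bullet> W y \<omega>)"
    and bound: "\<And>x. x \<in> L2_rv M G \<Longrightarrow> l2norm M (W x) \<le> \<kappa> * l2norm M x" and \<kappa>: "0 \<le> \<kappa>"
    and coercive: "\<And>x. x \<in> L2_rv M G \<Longrightarrow> \<gamma> * (l2norm M x)\<^sup>2 \<le> (LINT \<omega>|M. W x \<omega> \<bullet> x \<omega>)" and \<gamma>: "0 < \<gamma>"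
    and y: "y \<in> L2_rv M G"
  obtains z where "z \<in> L2_rv M G" "AE \<omega> in M. W z \<omega> = y \<omega>"
proof -
  note sup = L2_rv_superalgebra[OF _ G]
  \<comment> \<open>Adding \<gamma> keeps \<open>k\<close> positive, even if \<kappa> is 0, and at
    least \<gamma>, so that \<open>q\<close> lies in [0, 1). The step \<rho> minimizes 1 - 2 \<rho>
    \<gamma> + \<rho>^2 k^2, and the minimum is \<open>q\<^sup>2\<close>.\<close>
  define k where "k = \<kappa> + \<gamma>"
  define \<rho> where "\<rho> = \<gamma> / k\<^sup>2"
  define q where "q = sqrt (1 - (\<gamma> / k)\<^sup>2)"
  have k: "0 < k" "\<gamma> \<le> k" "\<kappa> \<le> k" using \<kappa> \<gamma> by (auto simp: k_def)
  have \<rho>: "0 < \<rho>" using k \<gamma> by (simp add: \<rho>_def)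
  have gk: "0 < (\<gamma> / k)\<^sup>2" "(\<gamma> / k)\<^sup>2 \<le> 1" using k \<gamma> by (simp_all add: power_le_one_iff)
  then have q: "0 \<le> q" "q < 1" "q\<^sup>2 = 1 - (\<gamma> / k)\<^sup>2" by (simp_all add: q_def)
  have contract: "l2norm M (\<lambda>\<omega>. x \<omega> + (- \<rho>) *\<^sub>R W x \<omega>) \<le> q * l2norm M x" if x: "x \<in> L2_rv M G" for x
  proof -
    have "(l2norm M (\<lambda>\<omega>. x \<omega> + (- \<rho>) *\<^sub>R W x \<omega>))\<^sup>2
        = (l2norm M x)\<^sup>2 - 2 * \<rho> * (LINT \<omega>|M. W x \<omega> \<bullet> x \<omega>) + \<rho>\<^sup>2 * (l2norm M (W x))\<^sup>2"
      using L2_rv_norm_add[OF sup[OF x] sup[OF W[OF x]], of "- \<rho>"] by (simp add: inner_commute)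
    also have "\<dots> \<le> (l2norm M x)\<^sup>2 - 2 * \<rho> * (\<gamma> * (l2norm M x)\<^sup>2) + \<rho>\<^sup>2 * (k * l2norm M x)\<^sup>2"
    proof -
      have "l2norm M (W x) \<le> k * l2norm M x"
        using bound[OF x] mult_right_mono[OF k(3) l2norm_nonneg[of M x]] by linarith
      then have "\<rho>\<^sup>2 * (l2norm M (W x))\<^sup>2 \<le> \<rho>\<^sup>2 * (k * l2norm M x)\<^sup>2"
        by (intro mult_left_mono power_mono) auto
      moreover have "2 * \<rho> * (\<gamma> * (l2norm M x)\<^sup>2) \<le> 2 * \<rho> * (LINT \<omega>|M. W x \<omega> \<bullet> x \<omega>)"
        using coercive[OF x] \<rho> by (intro mult_left_mono) auto
      ultimately show ?thesis by linarith
    qed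
    also have "\<dots> = (q * l2norm M x)\<^sup>2"
      unfolding power_mult_distrib[of q] q(3) \<rho>_def
      using k by (simp add: power2_eq_square field_simps)
    finally show ?thesis by (rule power2_le_imp_le) (simp add: q)
  qed
  define R where "R = rec_nat y (\<lambda>_ x \<omega>. x \<omega> + (- \<rho>) *\<^sub>R W x \<omega>)"
  have R0: "R 0 = y" and RS: "R (Suc n) = (\<lambda>\<omega>. R n \<omega> + (- \<rho>) *\<^sub>R W (R n) \<omega>)" for n
    by (simp_all add: R_def)
  have RG: "R n \<in> L2_rv M G" for n
  proof (induction n)
    case (Suc n)
    then show ?case unfolding RS by (intro L2_rv_add L2_rv_scaleR W G)
  qed (simp add: R0 y)
  have Rn: "l2norm M (R n) \<le> q ^ n * l2norm M y" for n
  proof (induction n)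
    case (Suc n)
    have "l2norm M (R (Suc n)) \<le> q * l2norm M (R n)" unfolding RS by (rule contract[OF RG])
    also have "\<dots> \<le> q * (q ^ n * l2norm M y)" using Suc q by (intro mult_left_mono) auto
    finally show ?case by (simp add: mult.assoc)
  qed (simp add: R0)
  define X where "X n \<omega> = (\<Sum>j<n. \<rho> *\<^sub>R R j \<omega>)" for n \<omega>
  have XG: "X n \<in> L2_rv M G" for n
    unfolding X_def by (intro L2_rv_sum L2_rv_scaleR RG G)
  have le: "l2norm M (\<lambda>\<omega>. X (Suc n) \<omega> - X n \<omega>) \<le> \<rho> * l2norm M y * q ^ n" for n
    using Rn[of n] \<rho> by (simp add: X_def l2norm_scaleR mult_ac)
  obtain z where zG: "z \<in> L2_rv M G"
    and z: "\<And>n. l2norm M (\<lambda>\<omega>. z \<omega> - X n \<omega>) \<le> \<rho> * l2norm M y * q ^ n / (1 - q)"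
    using L2_rv_complete_geometric[OF fin G XG le q(1,2)] \<rho> by auto
  have weak: "(LINT \<omega>|M. z \<omega> \<bullet> W w \<omega>) = (LINT \<omega>|M. y \<omega> \<bullet> w \<omega>)" if w: "w \<in> L2_rv M G" for w
  proof -
    note wM = sup[OF w] and WwM = sup[OF W[OF w]]
    \<comment> \<open>Telescoping: by symmetry, pairing \<open>\<rho> *\<^sub>R R j\<close> with
      \<open>W w\<close> is the same as pairing \<open>R j - R (Suc j)\<close> with
      \<open>w\<close>.\<close>
    have part: "(LINT \<omega>|M. X n \<omega> \<bullet> W w \<omega>) = (LINT \<omega>|M. y \<omega> \<bullet> w \<omega>) - (LINT \<omega>|M. R n \<omega> \<bullet> w \<omega>)" for n
    proof (induction n)
      case 0
      then show ?case by (simp add: X_def R0)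
    next
      case (Suc n)
      have "(LINT \<omega>|M. X (Suc n) \<omega> \<bullet> W w \<omega>) = (LINT \<omega>|M. X n \<omega> \<bullet> W w \<omega>) + \<rho> * (LINT \<omega>|M. R n \<omega> \<bullet> W w \<omega>)"
        using L2_rv_inner_add_left[OF sup[OF XG] sup[OF RG] WwM, of n \<rho> n] by (simp add: X_def)
      moreover have "(LINT \<omega>|M. R (Suc n) \<omega> \<bullet> w \<omega>) = (LINT \<omega>|M. R n \<omega> \<bullet> w \<omega>) - \<rho> * (LINT \<omega>|M. W (R n) \<omega> \<bullet> w \<omega>)"
        using L2_rv_inner_add_left[OF sup[OF RG] sup[OF W[OF RG]] wM, of n "- \<rho>" n] by (simp add: RS)
      ultimately show ?case using Suc sym[OF RG w] by simp
    qed
    have "\<bar>(LINT \<omega>|M. z \<omega> \<bullet> W w \<omega>) - (LINT \<omega>|M. y \<omega> \<bullet> w \<omega>)\<bar>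
        \<le> (\<rho> * l2norm M y / (1 - q) * l2norm M (W w) + l2norm M y * l2norm M w) * q ^ n" for n
    proof -
      have "\<bar>LINT \<omega>|M. (z \<omega> - X n \<omega>) \<bullet> W w \<omega>\<bar> \<le> l2norm M (\<lambda>\<omega>. z \<omega> - X n \<omega>) * l2norm M (W w)"
        by (rule L2_rv_Cauchy_Schwarz[OF L2_rv_diff[OF sup[OF zG] sup[OF XG] subalgebra_refl] WwM])
      also have "\<dots> \<le> \<rho> * l2norm M y * q ^ n / (1 - q) * l2norm M (W w)"
        by (intro mult_right_mono z) simp
      finally have 1: "\<bar>(LINT \<omega>|M. z \<omega> \<bullet> W w \<omega>) - (LINT \<omega>|M. X n \<omega> \<bullet> W w \<omega>)\<bar>
          \<le> \<rho> * l2norm M y * q ^ n / (1 - q) * l2norm M (W w)"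
        using L2_rv_inner_diff_left[OF sup[OF zG] sup[OF XG] WwM] by simp
      have "\<bar>LINT \<omega>|M. R n \<omega> \<bullet> w \<omega>\<bar> \<le> l2norm M (R n) * l2norm M w"
        by (rule L2_rv_Cauchy_Schwarz[OF sup[OF RG] wM])
      also have "\<dots> \<le> q ^ n * l2norm M y * l2norm M w" by (intro mult_right_mono Rn) simp
      finally have 2: "\<bar>LINT \<omega>|M. R n \<omega> \<bullet> w \<omega>\<bar> \<le> q ^ n * l2norm M y * l2norm M w" .
      have "\<bar>(LINT \<omega>|M. z \<omega> \<bullet> W w \<omega>) - (LINT \<omega>|M. y \<omega> \<bullet> w \<omega>)\<bar>
          \<le> \<rho> * l2norm M y * q ^ n / (1 - q) * l2norm M (W w) + q ^ n * l2norm M y * l2norm M w"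
        using 1 2 part[of n] by linarith
      also have "\<dots> = (\<rho> * l2norm M y / (1 - q) * l2norm M (W w) + l2norm M y * l2norm M w) * q ^ n"
        by (simp add: algebra_simps)
      finally show ?thesis .
    qed
    moreover have "(\<lambda>n. (\<rho> * l2norm M y / (1 - q) * l2norm M (W w) + l2norm M y * l2norm M w) * q ^ n) \<longlonglongrightarrow> 0"
      using q by (intro tendsto_mult_right_zero LIMSEQ_power_zero) simp
    ultimately have "\<bar>(LINT \<omega>|M. z \<omega> \<bullet> W w \<omega>) - (LINT \<omega>|M. y \<omega> \<bullet> w \<omega>)\<bar> \<le> 0"
      by (intro LIMSEQ_le_const[where X = "\<lambda>n. _ * q ^ n"]) auto
    then show ?thesis by simp
  qed
  \<comment> \<open>The residual of the limit serves as its own test function.\<close>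
  define w where "w \<omega> = W z \<omega> - y \<omega>" for \<omega>
  have wG: "w \<in> L2_rv M G" unfolding w_def by (intro L2_rv_diff W zG y G)
  have "(l2norm M w)\<^sup>2 = (LINT \<omega>|M. (W z \<omega> - y \<omega>) \<bullet> w \<omega>)"
    unfolding l2norm_power2 power2_norm_eq_inner by (simp only: w_def)
  also have "\<dots> = (LINT \<omega>|M. z \<omega> \<bullet> W w \<omega>) - (LINT \<omega>|M. y \<omega> \<bullet> w \<omega>)"
    using L2_rv_inner_diff_left[OF sup[OF W[OF zG]] sup[OF y] sup[OF wG]] sym[OF zG wG] by simp
  also have "\<dots> = 0" using weak[OF wG] by simp
  finally have "AE \<omega> in M. w \<omega> = 0" by (intro l2norm_eq_0_imp_AE[OF sup[OF wG]]) simp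
  then show ?thesis using zG by (intro that[of z]) (simp_all add: w_def)
qed

context usual_filtered_prob_space
begin

lemma cond_exp_process_is_version:
  assumes "0 < T" "z \<in> L2_rv M M"
  shows "is_cond_exp_version z (cond_exp_process M F T z)"
proof -
  obtain Z where "is_cond_exp_version z Z" using is_cond_exp_version_exists[OF assms] by blast
  moreover have "cond_exp_process M F T z = (SOME Z. is_cond_exp_version z Z)"
    by (simp only: cond_exp_process_def is_cond_exp_version_def)
  ultimately show ?thesis by (simp only: someI[of "is_cond_exp_version z"])
qed

lemma dual_control_energy:
  fixes K :: "real \<Rightarrow> real^'m^'n"
  assumes K: "K \<in> L2_rv NT NT" and z: "z \<in> L2_rv M M" and Z: "is_cond_exp_version z Z"
  shows "(LINT \<omega>|M. control_map T K (dual_control K Z) \<omega> \<bullet> z \<omega>) = (l2norm PT (case_prod (dual_control K Z)))\<^sup>2"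
  unfolding control_map_adjoint[OF K dual_control_L2(1)[OF K z Z] z Z]
  by (simp only: l2norm_power2 power2_norm_eq_inner)

lemma control_map_surjective_iff:
  fixes K :: "real \<Rightarrow> real^'m^'n"
  assumes T: "0 < T" and K: "K \<in> L2_rv NT NT"
  shows "(\<forall>y\<in>L2_rv M (F T). \<exists>u\<in>L2_adapted M F T. AE \<omega> in M. control_map T K u \<omega> = y \<omega>) \<longleftrightarrow>
    (\<exists>\<gamma>>0. \<forall>x\<in>L2_rv M (F T). \<gamma> * (l2norm M x)\<^sup>2 \<le>
      (LINT \<omega>|M. control_map T K (dual_control K (cond_exp_process M F T x)) \<omega> \<bullet> x \<omega>))"
    (is "?surj \<longleftrightarrow> ?coercive")
proof -
  have sub: "subalgebra M (F T)" using T by (intro subalgebra_F) simp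
  note sup = L2_rv_superalgebra[OF _ sub]
  \<comment> \<open>The Richardson iterates must stay in L2 of \<open>F T\<close>, hence a version
    that is jointly measurable over \<open>F T\<close>; the condition defining
    \<open>cond_exp_process\<close> does not ask for this.\<close>
  define Z where "Z z = (SOME Z. is_cond_exp_version z Z \<and> case_prod Z \<in> borel_measurable (NT \<Otimes>\<^sub>M F T))"
    for z :: "'a \<Rightarrow> real^'n"
  have Z: "is_cond_exp_version z (Z z)" "case_prod (Z z) \<in> borel_measurable (NT \<Otimes>\<^sub>M F T)"
    if "z \<in> L2_rv M (F T)" for z :: "'a \<Rightarrow> real^'n"
    using is_cond_exp_version_exists[OF T sup[OF that]]
    someI_ex[of "\<lambda>Z. is_cond_exp_version z Z \<and> case_prod Z \<in> borel_measurable (NT \<Otimes>\<^sub>M F T)"]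
    unfolding Z_def by metis+
  define D where "D z = dual_control K (Z z)" for z
  define W where "W z = control_map T K (D z)" for z
  have D: "D z \<in> L2_adapted M F T" if "z \<in> L2_rv M (F T)" for z
    unfolding D_def by (rule dual_control_L2(1)[OF K sup[OF that] Z(1)[OF that]])
  then have DL: "case_prod (D z) \<in> L2_rv PT PT" if "z \<in> L2_rv M (F T)" for z
    using that by (simp add: L2_adapted_iff)
  have adj: "(LINT \<omega>|M. control_map T K u \<omega> \<bullet> z \<omega>) = (LINT x|PT. case_prod u x \<bullet> case_prod (D z) x)"
    if "u \<in> L2_adapted M F T" "z \<in> L2_rv M (F T)" for u z
    unfolding D_def by (rule control_map_adjoint[OF K that(1) sup[OF that(2)] Z(1)[OF that(2)]])
  have energy: "(LINT \<omega>|M. W z \<omega> \<bullet> z \<omega>) = (l2norm PT (case_prod (D z)))\<^sup>2" if "z \<in> L2_rv M (F T)" for z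
    unfolding W_def D_def by (rule dual_control_energy[OF K sup[OF that] Z(1)[OF that]])
  \<comment> \<open>The quadratic form does not depend on the version: the adjoint identity is used
    twice, with the control built from one version and the dual control from the other. Both forms
    become the pairing of \<open>D x\<close> with \<open>?C\<close>.\<close>
  have gram: "(LINT \<omega>|M. control_map T K (dual_control K (cond_exp_process M F T x)) \<omega> \<bullet> x \<omega>)
      = (LINT \<omega>|M. W x \<omega> \<bullet> x \<omega>)" if x: "x \<in> L2_rv M (F T)" for x
  proof -
    note v = cond_exp_process_is_version[OF T sup[OF x]]
    let ?C = "dual_control K (cond_exp_process M F T x)"
    have C: "?C \<in> L2_adapted M F T" by (rule dual_control_L2(1)[OF K sup[OF x] v])
    have "(LINT \<omega>|M. control_map T K ?C \<omega> \<bullet> x \<omega>) = (LINT y|PT. case_prod (D x) y \<bullet> case_prod ?C y)"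
      unfolding adj[OF C x] by (intro Bochner_Integration.integral_cong refl inner_commute)
    also have "\<dots> = (LINT \<omega>|M. W x \<omega> \<bullet> x \<omega>)"
      unfolding W_def by (rule control_map_adjoint[OF K D[OF x] sup[OF x] v, symmetric])
    finally show ?thesis .
  qed
  have "?surj" if coer: "?coercive"
  proof
    fix y :: "'a \<Rightarrow> real^'n" assume y: "y \<in> L2_rv M (F T)"
    from coer obtain \<gamma> where \<gamma>: "0 < \<gamma>"
      "\<And>x. x \<in> L2_rv M (F T) \<Longrightarrow> \<gamma> * (l2norm M x)\<^sup>2 \<le> (LINT \<omega>|M. W x \<omega> \<bullet> x \<omega>)"
      using gram by metis
    obtain z where z: "z \<in> L2_rv M (F T)" "AE \<omega> in M. W z \<omega> = y \<omega>"
    proof (rule L2_coercive_solve[OF finite_measure_M sub, of W "(l2norm NT K)\<^sup>2" \<gamma> y])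
      fix x :: "'a \<Rightarrow> real^'n" assume x: "x \<in> L2_rv M (F T)"
      have "(\<lambda>p. transpose (K (fst p)) *v case_prod (Z x) p) \<in> borel_measurable (NT \<Otimes>\<^sub>M F T)"
        by (intro borel_measurable_matrix_vector_mult borel_measurable_transpose Z(2)[OF x]
          measurable_compose[OF measurable_fst L2_rv_measurable[OF K]])
      then have "case_prod (D x) \<in> borel_measurable (NT \<Otimes>\<^sub>M F T)"
        by (simp add: D_def dual_control_def split_beta')
      then have "W x \<in> borel_measurable (F T)"
        unfolding W_def by (rule control_map_measurable[OF L2_rv_measurable[OF K]])
      then show "W x \<in> L2_rv M (F T)"
        using control_map_L2(1)[OF K DL[OF x]] by (simp add: W_def L2_rv_def)
      have "l2norm M (W x) \<le> l2norm NT K * l2norm PT (case_prod (D x))"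
        unfolding W_def by (rule control_map_L2(2)[OF K DL[OF x]])
      also have "\<dots> \<le> l2norm NT K * (l2norm NT K * l2norm M x)"
        unfolding D_def by (intro mult_left_mono dual_control_L2(2)[OF K sup[OF x] Z(1)[OF x]]) simp
      finally show "l2norm M (W x) \<le> (l2norm NT K)\<^sup>2 * l2norm M x" by (simp add: power2_eq_square mult.assoc)
      show "\<gamma> * (l2norm M x)\<^sup>2 \<le> (LINT \<omega>|M. W x \<omega> \<bullet> x \<omega>)" by (rule \<gamma>(2)[OF x])
    next
      fix x y :: "'a \<Rightarrow> real^'n" assume x: "x \<in> L2_rv M (F T)" and y: "y \<in> L2_rv M (F T)"
      \<comment> \<open>Symmetry: both sides are the inner product of \<open>D x\<close> and
        \<open>D y\<close> over \<open>PT\<close>.\<close>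
      have "(LINT \<omega>|M. W x \<omega> \<bullet> y \<omega>) = (LINT \<omega>|M. W y \<omega> \<bullet> x \<omega>)"
        unfolding W_def adj[OF D[OF x] y] adj[OF D[OF y] x] by (intro Bochner_Integration.integral_cong refl inner_commute)
      then show "(LINT \<omega>|M. W x \<omega> \<bullet> y \<omega>) = (LINT \<omega>|M. x \<omega> \<bullet> W y \<omega>)" by (simp add: inner_commute)
    qed (use y \<gamma>(1) in auto)
    then show "\<exists>u\<in>L2_adapted M F T. AE \<omega> in M. control_map T K u \<omega> = y \<omega>"
      using D[OF z(1)] unfolding W_def by blast
  qed
  moreover have "?coercive" if surj: "?surj"
  proof -
    have "\<exists>c>0. \<forall>z\<in>L2_rv M (F T). l2norm M z \<le> c * l2norm PT (case_prod (D z))"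
    proof (rule L2_uniform_boundedness[OF finite_measure_M sub])
      fix y :: "'a \<Rightarrow> real^'n" assume y: "y \<in> L2_rv M (F T)"
      with surj obtain u where u: "u \<in> L2_adapted M F T" "AE \<omega> in M. control_map T K u \<omega> = y \<omega>" by blast
      have uL: "case_prod u \<in> L2_rv PT PT" using u(1) by (simp add: L2_adapted_iff)
      \<comment> \<open>The norm of a control steering to \<open>y\<close> is the constant in the
        pairing bound for \<open>y\<close>.\<close>
      have "\<bar>LINT \<omega>|M. y \<omega> \<bullet> z \<omega>\<bar> \<le> l2norm PT (case_prod u) * l2norm PT (case_prod (D z))"
        if z: "z \<in> L2_rv M (F T)" for z
      proof -
        have "(LINT \<omega>|M. y \<omega> \<bullet> z \<omega>) = (LINT \<omega>|M. control_map T K u \<omega> \<bullet> z \<omega>)"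
        proof (rule integral_cong_AE)
          show "(\<lambda>\<omega>. y \<omega> \<bullet> z \<omega>) \<in> borel_measurable M"
            "(\<lambda>\<omega>. control_map T K u \<omega> \<bullet> z \<omega>) \<in> borel_measurable M"
            using L2_rv_measurable[OF sup[OF y]] L2_rv_measurable[OF sup[OF z]]
              L2_rv_measurable[OF control_map_L2(1)[OF K uL]] by measurable
          show "AE \<omega> in M. y \<omega> \<bullet> z \<omega> = control_map T K u \<omega> \<bullet> z \<omega>"
            using u(2) by eventually_elim simp
        qed
        then show ?thesis
          using L2_rv_Cauchy_Schwarz[OF uL DL[OF z]] by (simp only: adj[OF u(1) z])
      qed
      then show "\<exists>c. \<forall>z\<in>L2_rv M (F T). \<bar>LINT \<omega>|M. y \<omega> \<bullet> z \<omega>\<bar> \<le> c * l2norm PT (case_prod (D z))" by blast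
    qed simp
    then obtain c where c: "0 < c" "\<And>z. z \<in> L2_rv M (F T) \<Longrightarrow> l2norm M z \<le> c * l2norm PT (case_prod (D z))"
      by blast
    have "1 / c\<^sup>2 * (l2norm M x)\<^sup>2 \<le> (LINT \<omega>|M. W x \<omega> \<bullet> x \<omega>)" if x: "x \<in> L2_rv M (F T)" for x
    proof -
      have "(l2norm M x)\<^sup>2 \<le> (c * l2norm PT (case_prod (D x)))\<^sup>2"
        by (intro power_mono c(2)[OF x]) simp
      then show ?thesis using c(1) by (simp add: energy[OF x] power_mult_distrib field_simps)
    qed
    then show ?thesis using c(1) gram by (intro exI[of _ "1 / c\<^sup>2"]) auto
  qed
  ultimately show ?thesis by blast
qed

end

section \<open>Mittag-Leffler functions\<close>

text \<open>Row i of the product is the transpose of \<open>B\<close> applied to row i of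
  \<open>A\<close>, so the bound for matrix-vector products applies row by row.\<close>

lemma norm_matrix_matrix_mult_le:
  fixes A :: "real^'k^'n" and B :: "real^'m^'k"
  shows "norm (A ** B) \<le> norm A * norm B"
proof -
  have row: "(A ** B) $ i = transpose B *v (A $ i)" for i
    by (simp add: vec_eq_iff matrix_matrix_mult_def matrix_vector_mult_def transpose_def mult.commute)
  have "(norm (A ** B))\<^sup>2 = (\<Sum>i\<in>UNIV. (norm (transpose B *v (A $ i)))\<^sup>2)"
    unfolding norm_vec_power2_norm[of "A ** B"] row ..
  also have "\<dots> \<le> (\<Sum>i\<in>UNIV. (norm B * norm (A $ i))\<^sup>2)"
    using norm_matrix_vector_mult_le[of "transpose B"] unfolding norm_transpose_matrix
    by (intro sum_mono power_mono) auto
  also have "\<dots> = (norm A * norm B)\<^sup>2"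
    by (simp add: norm_vec_power2_norm[of A] power_mult_distrib sum_distrib_left mult.commute)
  finally show ?thesis by (rule power2_le_imp_le) simp
qed

lemma bounded_bilinear_matrix_mult:
  "bounded_bilinear ((**) :: real^'k^'n \<Rightarrow> real^'m^'k \<Rightarrow> real^'m^'n)"
proof
  show "\<exists>K. \<forall>A B. norm ((A :: real^'k^'n) ** (B :: real^'m^'k)) \<le> norm A * norm B * K"
    by (intro exI[of _ 1] allI) (simp add: norm_matrix_matrix_mult_le)
qed (simp_all add: vec_eq_iff matrix_matrix_mult_def
      sum_distrib_left sum.distrib algebra_simps)

lemma bounded_linear_transpose: "bounded_linear (transpose :: real^'m^'n \<Rightarrow> real^'n^'m)"
proof (rule bounded_linear_intro[where K = 1])
  show "norm (transpose x) \<le> norm x * 1" for x :: "real^'m^'n" by (simp add: norm_transpose_matrix)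
qed (simp_all add: transpose_def vec_eq_iff)

lemmas continuous_on_matrix_mult [continuous_intros] =
  bounded_bilinear.continuous_on[OF bounded_bilinear_matrix_mult]

lemma borel_measurable_matrix_mult [measurable (raw)]:
  fixes f :: "'a \<Rightarrow> real^'k^'n" and g :: "'a \<Rightarrow> real^'m^'k"
  assumes "f \<in> borel_measurable M" "g \<in> borel_measurable M"
  shows "(\<lambda>x. f x ** g x) \<in> borel_measurable M"
  using assms by (rule borel_measurable_continuous_Pair) (intro continuous_intros)

lemma matpow_0 [simp]: "matpow A 0 = mat 1"
  and matpow_Suc: "matpow A (Suc k) = A ** matpow A k"
  by (simp_all add: matpow_def)

lemma matpow_commute:
  fixes A B :: "real^'n^'n"
  assumes "A ** B = B ** A"
  shows "matpow A k ** B = B ** matpow A k"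
proof (induction k)
  case (Suc k)
  then show ?case by (metis assms matpow_Suc matrix_mul_assoc)
qed simp

lemma transpose_matpow: "transpose (matpow A k) = matpow (transpose A) k"
proof (induction k)
  case (Suc k)
  then show ?case
    by (metis matpow_Suc matpow_commute matrix_transpose_mul)
qed simp

text \<open>The identity has Frobenius norm sqrt n and not 1, whence the extra factor.\<close>

lemma norm_matpow_le: "norm (matpow A k) \<le> norm (mat 1 :: real^'n^'n) * norm A ^ k"
  for A :: "real^'n^'n"
proof (induction k)
  case (Suc k)
  have "norm (matpow A (Suc k)) \<le> norm A * norm (matpow A k)"
    unfolding matpow_Suc by (rule norm_matrix_matrix_mult_le)
  also have "\<dots> \<le> norm A * (norm (mat 1 :: real^'n^'n) * norm A ^ k)"
    using Suc by (intro mult_left_mono) auto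
  finally show ?case by (simp add: mult_ac)
qed simp

lemma continuous_on_matpow [continuous_intros]:
  fixes f :: "'a::topological_space \<Rightarrow> real^'n^'n"
  assumes "continuous_on S f"
  shows "continuous_on S (\<lambda>x. matpow (f x) k)"
  by (induction k) (auto simp: matpow_Suc intro!: continuous_intros assms)

text \<open>The integrand \<open>t\<^bsup>x-1\<^esup> e\<^bsup>-t\<^esup>\<close> is estimated from below on \<open>[R, R + 1]\<close>.\<close>

lemma Gamma_exponential_lower_bound:
  assumes R: "1 \<le> R" and x: "1 \<le> (x::real)"
  shows "R powr (x - 1) * exp (- (R + 1)) \<le> Gamma x"
proof -
  have "ennreal (R powr (x - 1) * exp (- (R + 1)))
      = (\<integral>\<^sup>+t. ennreal (R powr (x - 1) * exp (- (R + 1))) * indicator {R..R + 1} t \<partial>lborel)"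
    by (simp add: nn_integral_cmult_indicator)
  also have "\<dots> \<le> (\<integral>\<^sup>+t. ennreal (indicator {0..} t * t powr (x - 1) / exp t) \<partial>lborel)"
  proof (rule nn_integral_mono)
    fix t :: real
    have "R powr (x - 1) * exp (- (R + 1)) \<le> t powr (x - 1) * exp (- t)" if "R \<le> t" "t \<le> R + 1"
      using that R x by (intro mult_mono powr_mono2) auto
    then show "ennreal (R powr (x - 1) * exp (- (R + 1))) * indicator {R..R + 1} t
        \<le> ennreal (indicator {0..} t * t powr (x - 1) / exp t)"
      using R by (auto simp: indicator_def exp_minus divide_inverse intro!: ennreal_leI)
  qed
  also have "\<dots> = ennreal (Gamma x)" using x by (subst Gamma_conv_nn_integral_real) auto
  finally show ?thesis using x by (simp add: Gamma_real_pos less_imp_le)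
qed

text \<open>\<open>R\<close> is chosen such that \<open>2 * b \<le> R powr \<alpha>\<close>. The
  lower bound for Gamma then grows at least like (2 b)^j up to a constant, which leaves a geometric
  majorant with ratio 1/2.\<close>

lemma summable_power_over_Gamma:
  assumes \<alpha>: "0 < \<alpha>" and \<beta>: "0 < \<beta>" and b: "0 \<le> (b::real)"
  shows "summable (\<lambda>j. b ^ j / Gamma (real j * \<alpha> + \<beta>))"
proof -
  define R where "R = max 1 ((2 * b) powr (1 / \<alpha>))"
  have R: "1 \<le> R" by (simp add: R_def)
  have Ra: "2 * b \<le> R powr \<alpha>"
  proof (cases "b = 0")
    case False
    have "2 * b = ((2 * b) powr (1 / \<alpha>)) powr \<alpha>" using b \<alpha> False by (simp add: powr_powr)
    also have "\<dots> \<le> R powr \<alpha>" using \<alpha> by (intro powr_mono2) (auto simp: R_def)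
    finally show ?thesis .
  qed simp
  define C where "C = exp (R + 1) * R powr (1 - \<beta>)"
  \<comment> \<open>From here on the argument of Gamma is at least 1, as its lower bound
    requires.\<close>
  have "eventually (\<lambda>j. 1 / \<alpha> \<le> real j) sequentially"
    using eventually_ge_at_top[of "nat \<lceil>1 / \<alpha>\<rceil>"] by eventually_elim linarith
  then have "eventually (\<lambda>j. norm (b ^ j / Gamma (real j * \<alpha> + \<beta>)) \<le> C * (1 / 2) ^ j) sequentially"
  proof eventually_elim
    case (elim j)
    have x: "1 \<le> real j * \<alpha> + \<beta>" using elim \<alpha> \<beta> by (simp add: field_simps)
    have Rj: "R powr (real j * \<alpha> + \<beta> - 1) = (R powr \<alpha>) ^ j / R powr (1 - \<beta>)"
      using R by (simp add: powr_add[symmetric] powr_diff[symmetric] powr_realpow[symmetric] powr_powr algebra_simps)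
    have Rp: "0 < (R powr \<alpha>) ^ j / R powr (1 - \<beta>) * exp (- (R + 1))" using R by simp
    have "b ^ j / Gamma (real j * \<alpha> + \<beta>) \<le> b ^ j / ((R powr \<alpha>) ^ j / R powr (1 - \<beta>) * exp (- (R + 1)))"
    proof (rule divide_left_mono)
      show "(R powr \<alpha>) ^ j / R powr (1 - \<beta>) * exp (- (R + 1)) \<le> Gamma (real j * \<alpha> + \<beta>)"
        using Gamma_exponential_lower_bound[OF R x] unfolding Rj .
      have "0 < Gamma (real j * \<alpha> + \<beta>)" using x by (intro Gamma_real_pos) linarith
      from mult_pos_pos[OF this Rp]
      show "0 < Gamma (real j * \<alpha> + \<beta>) * ((R powr \<alpha>) ^ j / R powr (1 - \<beta>) * exp (- (R + 1)))" .
    qed (use b in simp)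
    also have "\<dots> = C * (b / R powr \<alpha>) ^ j"
      unfolding exp_minus using R by (simp add: C_def power_divide field_simps)
    also have "\<dots> \<le> C * (1 / 2) ^ j"
      using Ra R b by (intro mult_left_mono power_mono) (auto simp: C_def field_simps)
    finally show ?case using b x by (simp add: Gamma_real_pos less_imp_le)
  qed
  then show ?thesis
    by (rule summable_comparison_test_ev) (intro summable_mult summable_geometric, simp)
qed

text \<open>Each step multiplies the quotient by (\<delta> + j) / (j + 1), which is at most \<delta>
  for \<delta> at least 1. The three-parameter series is thereby majorized by a two-parameter one
  with argument scaled by \<delta>.\<close>

lemma pochhammer_over_fact_le:
  assumes \<delta>: "1 \<le> (\<delta>::real)"
  shows "pochhammer \<delta> j / fact j \<le> \<delta> ^ j"
proof (induction j)
  case (Suc j)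
  have pos: "0 \<le> pochhammer \<delta> j / fact j" using \<delta> by (simp add: pochhammer_nonneg)
  have "pochhammer \<delta> (Suc j) / fact (Suc j) = pochhammer \<delta> j / fact j * ((\<delta> + real j) / (real j + 1))"
    by (simp add: pochhammer_Suc field_simps)
  also have "\<dots> \<le> pochhammer \<delta> j / fact j * \<delta>"
  proof (rule mult_left_mono[OF _ pos])
    have "real j \<le> \<delta> * real j" using mult_right_mono[OF \<delta>, of "real j"] by simp
    then show "(\<delta> + real j) / (real j + 1) \<le> \<delta>" by (simp add: field_simps)
  qed
  also have "\<dots> \<le> \<delta> ^ j * \<delta>" using Suc \<delta> by (intro mult_right_mono) auto
  finally show ?case by (simp add: mult.commute)
qed simp

context
  fixes \<delta> \<alpha> \<beta> :: real
  assumes \<delta>: "1 \<le> \<delta>" and \<alpha>: "0 < \<alpha>" and \<beta>: "0 < \<beta>"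
begin

text \<open>Uniform on the ball of radius \<open>r\<close>, so that one majorant serves summability
  as well as the Weierstrass test for continuity.\<close>

lemma mittag_leffler3_term_le:
  fixes X :: "real^'n^'n"
  assumes "norm X \<le> r"
  shows "norm ((pochhammer \<delta> k / Gamma (real k * \<alpha> + \<beta>) / fact k) *\<^sub>R matpow X k)
    \<le> norm (mat 1 :: real^'n^'n) * ((\<delta> * r) ^ k / Gamma (real k * \<alpha> + \<beta>))"
proof -
  have G: "0 < Gamma (real k * \<alpha> + \<beta>)"
    using \<alpha> \<beta> by (intro Gamma_real_pos add_nonneg_pos) auto
  have r: "0 \<le> r" using assms norm_ge_zero[of X] by linarith
  have p: "0 \<le> pochhammer \<delta> k / fact k" using \<delta> by (simp add: pochhammer_nonneg)
  have "norm ((pochhammer \<delta> k / Gamma (real k * \<alpha> + \<beta>) / fact k) *\<^sub>R matpow X k)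
      = pochhammer \<delta> k / fact k / Gamma (real k * \<alpha> + \<beta>) * norm (matpow X k)"
    using G p by (simp add: abs_mult field_simps)
  also have "\<dots> \<le> \<delta> ^ k / Gamma (real k * \<alpha> + \<beta>) * (norm (mat 1 :: real^'n^'n) * r ^ k)"
  proof (intro mult_mono divide_right_mono pochhammer_over_fact_le \<delta>)
    have "norm (mat 1 :: real^'n^'n) * norm X ^ k \<le> norm (mat 1 :: real^'n^'n) * r ^ k"
      using assms by (intro mult_left_mono power_mono) auto
    then show "norm (matpow X k) \<le> norm (mat 1 :: real^'n^'n) * r ^ k"
      using norm_matpow_le[of X k] by linarith
  qed (use G \<delta> in auto)
  finally show ?thesis by (simp add: power_mult_distrib mult_ac)
qed

lemma mittag_leffler3_majorant_summable:
  assumes "0 \<le> r"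
  shows "summable (\<lambda>k. norm (mat 1 :: real^'n^'n) * ((\<delta> * r) ^ k / Gamma (real k * \<alpha> + \<beta>)))"
  using assms \<delta> \<alpha> \<beta> by (intro summable_mult summable_power_over_Gamma) auto

lemma mittag_leffler3_summable:
  fixes X :: "real^'n^'n"
  shows "summable (\<lambda>k. (pochhammer \<delta> k / Gamma (real k * \<alpha> + \<beta>) / fact k) *\<^sub>R matpow X k)"
  by (rule summable_comparison_test'[OF mittag_leffler3_majorant_summable[of "norm X"]])
     (rule norm_ge_zero, rule mittag_leffler3_term_le, rule order_refl)

lemma continuous_on_mittag_leffler3:
  "continuous_on UNIV (mittag_leffler3 \<delta> \<alpha> \<beta> :: real^'n^'n \<Rightarrow> real^'n^'n)"
proof -
  let ?t = "\<lambda>k X. (pochhammer \<delta> k / Gamma (real k * \<alpha> + \<beta>) / fact k) *\<^sub>R matpow (X :: real^'n^'n) k"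
  have "continuous (at X) (mittag_leffler3 \<delta> \<alpha> \<beta>)" for X :: "real^'n^'n"
  proof -
    \<comment> \<open>One more than the norm, so that \<open>X\<close> is an interior point of the
      ball.\<close>
    define r where "r = norm X + 1"
    have "uniform_limit (cball 0 r) (\<lambda>n X. \<Sum>k<n. ?t k X) (\<lambda>X. \<Sum>k. ?t k X) sequentially"
    proof (rule Weierstrass_m_test)
      show "norm (?t k X) \<le> norm (mat 1 :: real^'n^'n) * ((\<delta> * r) ^ k / Gamma (real k * \<alpha> + \<beta>))"
        if "X \<in> cball 0 r" for k X
        using that by (intro mittag_leffler3_term_le) simp
    qed (rule mittag_leffler3_majorant_summable, simp add: r_def)
    then have "continuous_on (cball (0 :: real^'n^'n) r) (\<lambda>X. \<Sum>k. ?t k X)"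
      by (rule uniform_limit_theorem[rotated])
         (auto intro!: always_eventually continuous_intros)
    then have "continuous_on (cball 0 r) (mittag_leffler3 \<delta> \<alpha> \<beta> :: real^'n^'n \<Rightarrow> real^'n^'n)"
      by (simp add: mittag_leffler3_def[abs_def])
    then show ?thesis
      by (rule continuous_on_interior) (simp add: r_def)
  qed
  then show ?thesis by (intro continuous_at_imp_continuous_on) auto
qed

lemma transpose_mittag_leffler3:
  "transpose (mittag_leffler3 \<delta> \<alpha> \<beta> X) = mittag_leffler3 \<delta> \<alpha> \<beta> (transpose X)"
  for X :: "real^'n^'n"
  unfolding mittag_leffler3_def
  by (subst bounded_linear.suminf[OF bounded_linear_transpose mittag_leffler3_summable])
     (simp add: transpose_scalar transpose_matpow)

lemma mittag_leffler3_commute: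
  fixes X Y :: "real^'n^'n"
  assumes "X ** Y = Y ** X"
  shows "mittag_leffler3 \<delta> \<alpha> \<beta> X ** Y = Y ** mittag_leffler3 \<delta> \<alpha> \<beta> X"
  unfolding mittag_leffler3_def
    bounded_linear.suminf[OF bounded_bilinear.bounded_linear_left[OF bounded_bilinear_matrix_mult] mittag_leffler3_summable]
    bounded_linear.suminf[OF bounded_bilinear.bounded_linear_right[OF bounded_bilinear_matrix_mult] mittag_leffler3_summable]
  by (simp only: bounded_bilinear.scaleR_left[OF bounded_bilinear_matrix_mult]
      bounded_bilinear.scaleR_right[OF bounded_bilinear_matrix_mult] matpow_commute[OF assms])

end

section \<open>The delayed Mittag-Leffler kernel\<close>

lemma transpose_zero: "transpose (0 :: real^'m^'n) = 0"
  by (simp add: transpose_def vec_eq_iff)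

lemma transpose_sum: "transpose (\<Sum>k\<in>I. f k) = (\<Sum>k\<in>I. transpose (f k))" for f :: "'i \<Rightarrow> real^'m^'n"
  by (rule linear_sum[OF bounded_linear.linear[OF bounded_linear_transpose]])

text \<open>Transposition reverses each product of a power of \<open>B\<close> with a series in
  \<open>A\<close>, and commutativity of \<open>A\<close> and \<open>B\<close> restores the order.
  In this way the kernel with transposed matrices in the Grammian becomes the transpose of the
  control kernel.\<close>

lemma transpose_delayed_ML2:
  fixes A B :: "real^'n^'n"
  assumes \<alpha>: "0 < \<alpha>" and \<beta>: "0 < \<beta>" and comm: "A ** B = B ** A"
  shows "transpose (delayed_ML2 h \<alpha> \<beta> A B t) = delayed_ML2 h \<alpha> \<beta> (transpose A) (transpose B) t"
proof -
  have "transpose (matpow B k ** mittag_leffler3 (real k + 1) \<alpha> (real k * \<alpha> + \<beta>) (c *\<^sub>R A))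
      = matpow (transpose B) k ** mittag_leffler3 (real k + 1) \<alpha> (real k * \<alpha> + \<beta>) (c *\<^sub>R transpose A)" for k c
  proof -
    have b: "0 < real k * \<alpha> + \<beta>" using \<alpha> \<beta> by (intro add_nonneg_pos) auto
    have "(c *\<^sub>R A) ** matpow B k = matpow B k ** (c *\<^sub>R A)"
      using matpow_commute[OF comm[symmetric], of k]
      by (simp add: bounded_bilinear.scaleR_left[OF bounded_bilinear_matrix_mult]
        bounded_bilinear.scaleR_right[OF bounded_bilinear_matrix_mult])
    then show ?thesis
      unfolding mittag_leffler3_commute[OF _ \<alpha> b \<open>(c *\<^sub>R A) ** matpow B k = _\<close>, of "real k + 1", simplified, symmetric]
      by (simp add: matrix_transpose_mul transpose_matpow transpose_mittag_leffler3 \<alpha> b transpose_scalar)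
  qed
  then show ?thesis
    by (simp add: delayed_ML2_def transpose_sum transpose_scalar transpose_zero)
qed

text \<open>Writing the \<open>k\<close>-th summand in terms of the positive part of its argument makes it vanish
  outside its range of summation (recall \<open>0 powr x = 0\<close>), so that the number of summands no longer
  depends on \<open>t\<close>.\<close>

definition delayed_ML2_summand :: "nat \<Rightarrow> real \<Rightarrow> real \<Rightarrow> real^'n^'n \<Rightarrow> real^'n^'n \<Rightarrow> real \<Rightarrow> real^'n^'n" where
  "delayed_ML2_summand k \<alpha> \<beta> A B s = s powr (real k * \<alpha> + \<beta> - 1) *\<^sub>R
     (matpow B k ** mittag_leffler3 (real k + 1) \<alpha> (real k * \<alpha> + \<beta>) (s powr \<alpha> *\<^sub>R A))"

lemma delayed_ML2_eq_sum:
  assumes h: "0 < h" and t: "t \<le> real P * h"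
  shows "delayed_ML2 h \<alpha> \<beta> A B t = (\<Sum>k\<le>P. delayed_ML2_summand k \<alpha> \<beta> A B (max 0 (t - (real k - 1) * h)))"
proof (cases "t \<le> - h")
  case True
  have "t - (real k - 1) * h \<le> 0" for k
  proof -
    have "0 \<le> real k * h" using h by simp
    then show ?thesis using True by (simp add: algebra_simps)
  qed
  then have "max 0 (t - (real k - 1) * h) = 0" for k by (simp add: max_def antisym)
  then show ?thesis using True by (simp add: delayed_ML2_def delayed_ML2_summand_def)
next
  case False
  define p where "p = delay_index h t"
  have "- 1 < t / h" using False h by (simp add: field_simps)
  \<comment> \<open>Since \<open>t / h\<close> exceeds -1, its ceiling is nonnegative and
    \<open>nat\<close> in \<open>delay_index\<close> does not truncate.\<close>
  then have "real p = of_int \<lceil>t / h\<rceil>" by (simp add: p_def delay_index_def)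
  then have "real p - 1 < t / h" "t / h \<le> real p" by linarith+
  then have p: "(real p - 1) * h < t" "t \<le> real p * h" using h by (simp_all add: field_simps)
  have "(real p - 1) * h < real P * h" using p(1) t by linarith
  then have "real p - 1 < real P" using h by simp
  then have pP: "p \<le> P" by linarith
  have "delayed_ML2 h \<alpha> \<beta> A B t = (\<Sum>k\<in>{0..p}. delayed_ML2_summand k \<alpha> \<beta> A B (max 0 (t - (real k - 1) * h)))"
    unfolding delayed_ML2_def p_def[symmetric] if_not_P[OF False]
  proof (intro sum.cong refl)
    fix k assume "k \<in> {0..p}"
    then have "(real k - 1) * h \<le> (real p - 1) * h" using h by (intro mult_right_mono) auto
    then have "max 0 (t - (real k - 1) * h) = t - (real k - 1) * h" using p by simp
    then show "(t - (real k - 1) * h) powr (real k * \<alpha> + \<beta> - 1) *\<^sub>R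
        (matpow B k ** mittag_leffler3 (real k + 1) \<alpha> (real k * \<alpha> + \<beta>) ((t - (real k - 1) * h) powr \<alpha> *\<^sub>R A))
      = delayed_ML2_summand k \<alpha> \<beta> A B (max 0 (t - (real k - 1) * h))"
      by (simp only: delayed_ML2_summand_def)
  qed
  also have "\<dots> = (\<Sum>k\<le>P. delayed_ML2_summand k \<alpha> \<beta> A B (max 0 (t - (real k - 1) * h)))"
  proof (rule sum.mono_neutral_left)
    show "\<forall>k\<in>{..P} - {0..p}. delayed_ML2_summand k \<alpha> \<beta> A B (max 0 (t - (real k - 1) * h)) = 0"
    proof
      fix k assume "k \<in> {..P} - {0..p}"
      then have "real p * h \<le> (real k - 1) * h" using h by (intro mult_right_mono) auto
      then have "max 0 (t - (real k - 1) * h) = 0" using p by simp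
      then show "delayed_ML2_summand k \<alpha> \<beta> A B (max 0 (t - (real k - 1) * h)) = 0"
        by (simp add: delayed_ML2_summand_def)
    qed
  qed (use pP in auto)
  finally show ?thesis .
qed

context
  fixes \<alpha> h T :: real and A B :: "real^'n^'n"
  assumes \<alpha>: "1 / 2 < \<alpha>" "\<alpha> < 1" and h: "0 < h" and T: "0 < T"
begin

text \<open>At \<open>T - h - r\<close> the argument of summand \<open>k\<close> becomes
  \<open>T - r - k h\<close>. Only \<open>k = 0\<close>, with exponent \<alpha> - 1, is singular,
  and only at \<open>r = T\<close>.\<close>

lemma delayed_kernel_eq:
  assumes "0 \<le> r"
  shows "delayed_ML2 h \<alpha> \<alpha> A B (T - h - r)
    = (\<Sum>k\<le>nat \<lceil>T / h\<rceil>. delayed_ML2_summand k \<alpha> \<alpha> A B (max 0 (T - r - real k * h)))"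
proof -
  have "T / h \<le> real (nat \<lceil>T / h\<rceil>)" by linarith
  then have "T \<le> real (nat \<lceil>T / h\<rceil>) * h" using h by (simp add: field_simps)
  then have "T - h - r \<le> real (nat \<lceil>T / h\<rceil>) * h" using assms h by linarith
  then show ?thesis by (simp add: delayed_ML2_eq_sum[OF h] algebra_simps)
qed

lemma continuous_on_delayed_ML2_factor:
  "continuous_on {0..} (\<lambda>s. matpow B k ** mittag_leffler3 (real k + 1) \<alpha> (real k * \<alpha> + \<alpha>) (s powr \<alpha> *\<^sub>R A))"
proof -
  have b: "0 < real k * \<alpha> + \<alpha>" using \<alpha> by (intro add_nonneg_pos) auto
  have "continuous_on {0..} (\<lambda>s::real. s powr \<alpha> *\<^sub>R A)"
    using \<alpha> by (intro continuous_intros continuous_on_powr') auto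
  then have "continuous_on {0..} (\<lambda>s. mittag_leffler3 (real k + 1) \<alpha> (real k * \<alpha> + \<alpha>) (s powr \<alpha> *\<^sub>R A))"
    using \<alpha> b by (intro continuous_on_compose2[OF continuous_on_mittag_leffler3]) auto
  then show ?thesis by (intro continuous_intros)
qed

text \<open>For \<open>k \<ge> 1\<close> the exponent is at least 2 \<alpha> - 1 > 0, so these
  summands vanish continuously where the delay switches them off. For \<open>k = 0\<close> the base
  stays positive on \<open>{0..<T}\<close>.\<close>

lemma continuous_on_delayed_kernel:
  "continuous_on {0..<T} (\<lambda>r. delayed_ML2 h \<alpha> \<alpha> A B (T - h - r))"
proof -
  have *: "continuous_on {0..<T} (\<lambda>r. delayed_ML2_summand k \<alpha> \<alpha> A B (max 0 (T - r - real k * h)))" for k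
    unfolding delayed_ML2_summand_def
  proof (rule continuous_on_scaleR)
    show "continuous_on {0..<T} (\<lambda>r. matpow B k ** mittag_leffler3 (real k + 1) \<alpha> (real k * \<alpha> + \<alpha>)
        (max 0 (T - r - real k * h) powr \<alpha> *\<^sub>R A))"
      by (rule continuous_on_compose2[OF continuous_on_delayed_ML2_factor])
         (auto intro!: continuous_intros)
    show "continuous_on {0..<T} (\<lambda>r. max 0 (T - r - real k * h) powr (real k * \<alpha> + \<alpha> - 1))"
    proof (rule continuous_on_powr')
      show "\<forall>r\<in>{0..<T}. 0 \<le> max 0 (T - r - real k * h) \<and>
          (max 0 (T - r - real k * h) = 0 \<longrightarrow> 0 < real k * \<alpha> + \<alpha> - 1)"
      proof (cases "k = 0")
        case False
        then have "1 * \<alpha> \<le> real k * \<alpha>" using \<alpha> by (intro mult_right_mono) auto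
        then have "0 < real k * \<alpha> + \<alpha> - 1" using \<alpha> by linarith
        then show ?thesis by simp
      qed auto
    qed (intro continuous_intros)+
  qed
  have "continuous_on {0..<T} (\<lambda>r. \<Sum>k\<le>nat \<lceil>T / h\<rceil>. delayed_ML2_summand k \<alpha> \<alpha> A B (max 0 (T - r - real k * h)))"
    by (intro continuous_on_sum *)
  then show ?thesis
    by (rule continuous_on_eq) (simp add: delayed_kernel_eq)
qed

text \<open>The matrix factor of each summand is bounded by compactness. In the power,
  \<open>T - r - k h\<close> is replaced by the larger \<open>T - r\<close> (they agree for
  \<open>k = 0\<close>, the one negative exponent), and the surplus
  \<open>(T - r) powr (k \<alpha>)\<close> is bounded by its value at \<open>r = 0\<close>. At
  \<open>r = T\<close> both sides are 0, as \<open>0 powr x = 0\<close>.\<close>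

lemma delayed_kernel_bound:
  obtains c where "0 \<le> c" "\<And>r. r \<in> {0..T} \<Longrightarrow> norm (delayed_ML2 h \<alpha> \<alpha> A B (T - h - r)) \<le> c * (T - r) powr (\<alpha> - 1)"
proof -
  have "\<exists>c\<ge>0. \<forall>r\<in>{0..T}. norm (delayed_ML2_summand k \<alpha> \<alpha> A B (max 0 (T - r - real k * h))) \<le> c * (T - r) powr (\<alpha> - 1)" for k
  proof -
    let ?\<Phi> = "\<lambda>s. matpow B k ** mittag_leffler3 (real k + 1) \<alpha> (real k * \<alpha> + \<alpha>) (s powr \<alpha> *\<^sub>R A)"
    have "compact (?\<Phi> ` {0..T})"
      by (intro compact_continuous_image continuous_on_subset[OF continuous_on_delayed_ML2_factor]) auto
    from compact_imp_bounded[OF this]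
    obtain m where "\<forall>x\<in>?\<Phi> ` {0..T}. norm x \<le> m" unfolding bounded_iff by blast
    then have m: "\<And>s. s \<in> {0..T} \<Longrightarrow> norm (?\<Phi> s) \<le> m" by blast
    have m0: "0 \<le> m" using order_trans[OF norm_ge_zero m[of 0]] T by simp
    have pow: "max 0 (T - r - real k * h) powr (real k * \<alpha> + \<alpha> - 1) \<le> T powr (real k * \<alpha>) * (T - r) powr (\<alpha> - 1)"
      if r: "r \<in> {0..T}" for r
    proof (cases "T - r - real k * h \<le> 0")
      case False
      define s where "s = T - r - real k * h"
      have s: "0 < s" "s \<le> T - r" "T - r \<le> T" using False r h by (auto simp: s_def)
      have "s powr (real k * \<alpha> + \<alpha> - 1) \<le> (T - r) powr (real k * \<alpha> + \<alpha> - 1)"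
      proof (cases "k = 0")
        case False
        then have "1 * \<alpha> \<le> real k * \<alpha>" using \<alpha> by (intro mult_right_mono) auto
        then have "0 \<le> real k * \<alpha> + \<alpha> - 1" using \<alpha> by linarith
        then show ?thesis using s by (intro powr_mono2) auto
      qed (simp add: s_def)
      also have "\<dots> = (T - r) powr (real k * \<alpha>) * (T - r) powr (\<alpha> - 1)"
        by (simp add: powr_add[symmetric] algebra_simps)
      also have "\<dots> \<le> T powr (real k * \<alpha>) * (T - r) powr (\<alpha> - 1)"
        using s \<alpha> by (intro mult_right_mono powr_mono2) auto
      finally show ?thesis using s by (simp add: s_def[symmetric] max_def)
    qed simp
    have "norm (delayed_ML2_summand k \<alpha> \<alpha> A B (max 0 (T - r - real k * h))) \<le> T powr (real k * \<alpha>) * m * (T - r) powr (\<alpha> - 1)"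
      if r: "r \<in> {0..T}" for r
    proof -
      have "0 \<le> real k * h" using h by simp
      then have "max 0 (T - r - real k * h) \<in> {0..T}" using r T by auto
      from mult_mono[OF pow[OF r] m[OF this]] show ?thesis
        using m0 by (simp add: delayed_ML2_summand_def mult_ac)
    qed
    then show ?thesis using m0 by (intro exI[of _ "T powr (real k * \<alpha>) * m"]) auto
  qed
  then obtain c where c: "\<And>k. 0 \<le> c k" "\<And>k r. r \<in> {0..T} \<Longrightarrow>
      norm (delayed_ML2_summand k \<alpha> \<alpha> A B (max 0 (T - r - real k * h))) \<le> c k * (T - r) powr (\<alpha> - 1)"
    by metis
  show ?thesis
  proof (rule that[of "\<Sum>k\<le>nat \<lceil>T / h\<rceil>. c k"])
    fix r assume r: "r \<in> {0..T}"
    then have "norm (delayed_ML2 h \<alpha> \<alpha> A B (T - h - r))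
        \<le> (\<Sum>k\<le>nat \<lceil>T / h\<rceil>. norm (delayed_ML2_summand k \<alpha> \<alpha> A B (max 0 (T - r - real k * h))))"
      by (simp add: delayed_kernel_eq norm_sum)
    also have "\<dots> \<le> (\<Sum>k\<le>nat \<lceil>T / h\<rceil>. c k * (T - r) powr (\<alpha> - 1))" by (intro sum_mono c r)
    finally show "norm (delayed_ML2 h \<alpha> \<alpha> A B (T - h - r)) \<le> (\<Sum>k\<le>nat \<lceil>T / h\<rceil>. c k) * (T - r) powr (\<alpha> - 1)"
      by (simp add: sum_distrib_right)
  qed (simp add: sum_nonneg c)
qed

lemma L2_fractional_kernel:
  "(\<lambda>r. (T - r) powr (\<alpha> - 1)) \<in> L2_rv (interval_measure_upto T) (interval_measure_upto T)"
proof -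
  have "((\<lambda>x. x powr (2 * \<alpha> - 2)) has_integral (T powr (2 * \<alpha> - 2 + 1) / (2 * \<alpha> - 2 + 1))) {0..T}"
    using \<alpha> T by (intro has_integral_powr_from_0) auto
  from nn_integral_has_integral_lebesgue[OF _ this]
  have fin: "(\<integral>\<^sup>+x. ennreal (indicator {0..T} x * x powr (2 * \<alpha> - 2)) \<partial>lborel) < \<infinity>" by simp
  have "(\<integral>\<^sup>+r. ennreal ((norm ((T - r) powr (\<alpha> - 1)))\<^sup>2) \<partial>interval_measure_upto T)
      = (\<integral>\<^sup>+r. ennreal ((norm ((T - r) powr (\<alpha> - 1)))\<^sup>2) * indicator {0..T} r \<partial>lborel)"
    by (subst nn_integral_restrict_space) auto
  \<comment> \<open>The form \<open>T + - 1 * r\<close> matches the affine substitution that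
    follows. It moves the singularity to 0, where the exponent 2 \<alpha> - 2 > -1 is
    integrable.\<close>
  also have "\<dots> = (\<integral>\<^sup>+r. ennreal (indicator {0..T} (T + - 1 * r) * (T + - 1 * r) powr (2 * \<alpha> - 2)) \<partial>lborel)"
  proof (intro nn_integral_cong)
    fix r
    show "ennreal ((norm ((T - r) powr (\<alpha> - 1)))\<^sup>2) * indicator {0..T} r
        = ennreal (indicator {0..T} (T + - 1 * r) * (T + - 1 * r) powr (2 * \<alpha> - 2))"
      by (auto simp: indicator_def power2_eq_square powr_add[symmetric])
  qed
  also have "\<dots> = (\<integral>\<^sup>+x. ennreal (indicator {0..T} x * x powr (2 * \<alpha> - 2)) \<partial>lborel)"
    by (subst nn_integral_real_affine[where c = "- 1" and t = T]) auto
  finally have "(\<integral>\<^sup>+r. ennreal ((norm ((T - r) powr (\<alpha> - 1)))\<^sup>2) \<partial>interval_measure_upto T) < \<infinity>"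
    using fin by simp
  then show ?thesis
    unfolding L2_rv_def mem_Collect_eq
    by (intro conjI integrableI_bounded) (simp_all add: measurable_restrict_space1)
qed

end

text \<open>Extending by the constant \<open>f b\<close> makes the value at the end point, where the
  kernels are singular, irrelevant for measurability.\<close>

lemma borel_measurable_interval:
  fixes f :: "real \<Rightarrow> 'b::euclidean_space"
  assumes "continuous_on {0..<b} f"
  shows "f \<in> borel_measurable (interval_measure_upto b)"
proof -
  have "(\<lambda>r. if r \<in> {0..<b} then f r else f b) \<in> borel_measurable borel"
    by (rule borel_measurable_continuous_on_if) (use assms in auto)
  then have "(\<lambda>r. if r \<in> {0..<b} then f r else f b) \<in> borel_measurable (interval_measure_upto b)"
    by (intro measurable_restrict_space1) simp
  also have "?this \<longleftrightarrow> f \<in> borel_measurable (interval_measure_upto b)"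
    by (rule measurable_cong) (auto simp: space_restrict_space not_less)
  finally show ?thesis .
qed

section \<open>Brownian increments and Ito integrals\<close>

text \<open>\<open>lborel\<close> on \<open>real^'n\<close> is the image of a product measure
  indexed by \<open>Basis\<close>, and \<open>axis i 1\<close> matches coordinates with basis
  vectors. After this reindexing the claims are those for finite product measures.\<close>

lemma
  fixes g :: "'n::finite \<Rightarrow> real \<Rightarrow> real"
  assumes g: "\<And>i. integrable lborel (g i)"
  shows integrable_prod_components: "integrable lborel (\<lambda>x :: real^'n. \<Prod>i\<in>UNIV. g i (x $ i))"
    and integral_prod_components:
      "(LINT x|lborel. (\<Prod>i\<in>UNIV. g i ((x :: real^'n) $ i))) = (\<Prod>i\<in>UNIV. LINT x|lborel. g i x)"
proof -
  interpret product_sigma_finite "\<lambda>_ :: real^'n. lborel :: real measure" ..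
  have Basis: "(Basis :: (real^'n) set) = (\<lambda>i. axis i 1) ` UNIV" by (auto simp: Basis_vec_def)
  have inj: "inj (\<lambda>i::'n. axis i (1::real))" by (auto simp: inj_def axis_eq_axis)
  define g' where "g' b = g (inv (\<lambda>i. axis i 1) b)" for b :: "real^'n"
  have g': "g' (axis i 1) = g i" for i by (simp add: g'_def inv_f_f[OF inj])
  have comp: "(\<Sum>b\<in>Basis. f b *\<^sub>R b) $ i = f (axis i 1)" for f and i :: 'n
    by (simp add: cart_eq_inner_axis inner_sum_left_Basis axis_in_Basis_iff)
  have eq: "(\<Prod>i\<in>UNIV. g i ((\<Sum>b\<in>Basis. f b *\<^sub>R b :: real^'n) $ i)) = (\<Prod>b\<in>Basis. g' b (f b))" for f
    unfolding comp unfolding Basis by (simp add: prod.reindex[OF inj] g')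
  have gm [measurable]: "g i \<in> borel_measurable borel" for i
    using borel_measurable_integrable[OF g] by simp
  have g'm [measurable]: "g' b \<in> borel_measurable borel" for b unfolding g'_def by measurable
  have m: "(\<lambda>f. \<Sum>b\<in>Basis. f b *\<^sub>R b :: real^'n) \<in> measurable (\<Pi>\<^sub>M b\<in>Basis. lborel) borel"
    by measurable
  have int: "integrable lborel (g' b)" for b unfolding g'_def by (rule g)
  have intP: "integrable (\<Pi>\<^sub>M b\<in>Basis. lborel) (\<lambda>f. \<Prod>b\<in>Basis. g' b (f b) :: real)"
    by (rule product_integrable_prod) (auto intro: int)
  have pm: "(\<lambda>x :: real^'n. \<Prod>i\<in>UNIV. g i (x $ i)) \<in> borel_measurable borel" by measurable
  show "integrable lborel (\<lambda>x :: real^'n. \<Prod>i\<in>UNIV. g i (x $ i))"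
    unfolding lborel_eq[where 'a = "real^'n"]
    unfolding integrable_distr_eq[OF m pm] eq by (rule intP)
  have "(LINT x|lborel. (\<Prod>i\<in>UNIV. g i ((x :: real^'n) $ i)))
      = (LINT f|(\<Pi>\<^sub>M b\<in>Basis. lborel). (\<Prod>b\<in>Basis. g' b (f b)))"
    unfolding lborel_eq[where 'a = "real^'n"] integral_distr[OF m pm] eq ..
  also have "\<dots> = (\<Prod>b\<in>Basis. LINT x|lborel. g' b x)"
    by (rule product_integral_prod) (auto intro: int)
  also have "\<dots> = (\<Prod>i\<in>UNIV. LINT x|lborel. g i x)"
    unfolding Basis by (simp add: prod.reindex[OF inj] g')
  finally show "(LINT x|lborel. (\<Prod>i\<in>UNIV. g i ((x :: real^'n) $ i))) = (\<Prod>i\<in>UNIV. LINT x|lborel. g i x)" .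
qed

text \<open>The density times a power of one coordinate is again a product: factor \<open>a\<close>
  carries the power and the other factors integrate to 1. This reduces moments of a component to
  one-dimensional Gaussian moments.\<close>

lemma
  fixes X :: "'a \<Rightarrow> real^'n"
  assumes X: "distributed M lborel X (\<lambda>x. ennreal (\<Prod>i\<in>UNIV. normal_density 0 \<sigma> (x $ i)))" and \<sigma>: "0 < \<sigma>"
  shows gaussian_component_moment_integrable: "integrable M (\<lambda>\<omega>. (X \<omega> $ a) ^ k)"
    and gaussian_component_moment:
      "(LINT \<omega>|M. (X \<omega> $ a) ^ k) = (LINT x|lborel. normal_density 0 \<sigma> x * x ^ k)"
proof -
  define g where "g i x = (if i = a then normal_density 0 \<sigma> x * x ^ k else normal_density 0 \<sigma> x)" for i :: 'n and x
  have g: "integrable lborel (g i)" for i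
    using integrable_normal_moment[OF \<sigma>, of 0 k] integrable_normal_density[OF \<sigma>, of 0]
    by (cases "i = a") (simp_all add: g_def[abs_def])
  have split: "(\<Prod>i\<in>UNIV. normal_density 0 \<sigma> (x $ i)) * (x $ a) ^ k = (\<Prod>i\<in>UNIV. g i (x $ i))" for x :: "real^'n"
  proof -
    have "(\<Prod>i\<in>UNIV. g i (x $ i)) = g a (x $ a) * (\<Prod>i\<in>UNIV - {a}. normal_density 0 \<sigma> (x $ i))"
      by (subst prod.remove[of UNIV a]) (auto simp: g_def intro!: prod.cong)
    also have "\<dots> = (x $ a) ^ k * (\<Prod>i\<in>UNIV. normal_density 0 \<sigma> (x $ i))"
      by (subst prod.remove[of UNIV a "\<lambda>i. normal_density 0 \<sigma> (x $ i)"]) (auto simp: g_def)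
    finally show ?thesis by simp
  qed
  have pos: "0 \<le> (\<Prod>i\<in>UNIV. normal_density 0 \<sigma> (x $ i))" for x :: "real^'n"
    by (simp add: prod_nonneg)
  have m: "(\<lambda>x::real^'n. (x $ a) ^ k) \<in> borel_measurable lborel" by measurable
  show "integrable M (\<lambda>\<omega>. (X \<omega> $ a) ^ k)"
    using distributed_integrable[OF X m pos] integrable_prod_components[of g, OF g] by (simp add: split)
  have "(LINT \<omega>|M. (X \<omega> $ a) ^ k) = (\<Prod>i\<in>UNIV. LINT x|lborel. g i x)"
    using distributed_integral[OF X m pos] integral_prod_components[of g, OF g] by (simp add: split)
  also have "\<dots> = (LINT x|lborel. g a x) * (\<Prod>i\<in>UNIV - {a}. LINT x|lborel. g i x)"
    by (rule prod.remove) auto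
  also have "(\<Prod>i\<in>UNIV - {a}. LINT x|lborel. g i x) = 1"
    using integral_normal_density[OF \<sigma>, of 0] by (intro prod.neutral) (simp add: g_def[abs_def])
  finally show "(LINT \<omega>|M. (X \<omega> $ a) ^ k) = (LINT x|lborel. normal_density 0 \<sigma> x * x ^ k)"
    by (simp add: g_def)
qed

section \<open>Moments and independence of increments, and simple Ito sums\<close>

context standard_brownian_motion
begin

lemma increment_L2:
  assumes "0 \<le> s" "s \<le> t" "t \<le> T"
  shows "(\<lambda>\<omega>. W t \<omega> - W s \<omega>) \<in> L2_rv M (F t)"
    and "(l2norm M (\<lambda>\<omega>. W t \<omega> - W s \<omega>))\<^sup>2 = real CARD('n) * (t - s)"
    and "(LINT \<omega>|M. (W t \<omega> - W s \<omega>) $ a) = 0"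
proof -
  have sub: "subalgebra (F t) (F s)"
    using subalgebra_F[of s] subalgebra_F[of t] F_mono[OF assms] assms by (auto simp: subalgebra_def)
  have [measurable]: "W t \<in> borel_measurable (F t)" "W s \<in> borel_measurable (F t)"
    using measurable_from_subalg[OF sub W_adapted[of s]] W_adapted[of t] assms by auto
  have m: "(\<lambda>\<omega>. W t \<omega> - W s \<omega>) \<in> borel_measurable (F t)" by measurable
  have "(\<lambda>\<omega>. W t \<omega> - W s \<omega>) \<in> L2_rv M (F t) \<and>
    (l2norm M (\<lambda>\<omega>. W t \<omega> - W s \<omega>))\<^sup>2 = real CARD('n) * (t - s) \<and> (LINT \<omega>|M. (W t \<omega> - W s \<omega>) $ a) = 0"
  \<comment> \<open>\<open>W_gaussian\<close> speaks of \<open>s < t\<close> only; for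
    \<open>s = t\<close> the increment is 0.\<close>
  proof (cases "s = t")
    case True
    then show ?thesis by (simp add: L2_rv_zero l2norm_def)
  next
    case False
    then have \<sigma>: "0 < sqrt (t - s)" and st: "s < t" using assms by auto
    note X = W_gaussian[OF assms(1) st assms(3)]
    note int = gaussian_component_moment_integrable[OF X \<sigma>] and mom = gaussian_component_moment[OF X \<sigma>]
    have "(LINT \<omega>|M. (norm (W t \<omega> - W s \<omega>))\<^sup>2) = (\<Sum>i\<in>UNIV. LINT \<omega>|M. ((W t \<omega> - W s \<omega>) $ i)\<^sup>2)"
      unfolding norm_vec_power2 using int[of _ 2] by (intro Bochner_Integration.integral_sum) auto
    also have "\<dots> = (\<Sum>i\<in>(UNIV::'n set). t - s)"
      using integral_normal_moment_even[OF \<sigma>, of 0 1] assms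
      by (intro sum.cong refl) (simp only: mom, simp)
    finally have "(l2norm M (\<lambda>\<omega>. W t \<omega> - W s \<omega>))\<^sup>2 = real CARD('n) * (t - s)"
      by (simp add: l2norm_power2)
    moreover have "(\<lambda>\<omega>. W t \<omega> - W s \<omega>) \<in> L2_rv M (F t)"
      unfolding L2_rv_def norm_vec_power2 using m int[of _ 2] by auto
    moreover have "(LINT \<omega>|M. (W t \<omega> - W s \<omega>) $ a) = 0"
      using mom[of a 1] integral_normal_moment_odd[OF \<sigma>, of 0 0] by simp
    ultimately show ?thesis by blast
  qed
  then show "(\<lambda>\<omega>. W t \<omega> - W s \<omega>) \<in> L2_rv M (F t)"
    and "(l2norm M (\<lambda>\<omega>. W t \<omega> - W s \<omega>))\<^sup>2 = real CARD('n) * (t - s)"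
    and "(LINT \<omega>|M. (W t \<omega> - W s \<omega>) $ a) = 0" by auto
qed

text \<open>\<open>W_indep\<close> concerns families of sets, and the sigma-algebras generated by
  \<open>f\<close> and by a coordinate of the increment lie inside these families.\<close>

lemma increment_indep_var:
  assumes st: "0 \<le> s" "s < t" "t \<le> T" and f: "(f :: 'a \<Rightarrow> real) \<in> borel_measurable (F s)"
  shows "indep_var borel f borel (\<lambda>\<omega>. (W t \<omega> - W s \<omega>) $ a)"
proof -
  let ?X = "\<lambda>\<omega>. W t \<omega> - W s \<omega>"
  have sub: "subalgebra M (F s)" using st by (intro subalgebra_F) auto
  have fM: "f \<in> borel_measurable M" by (rule measurable_from_subalg[OF sub f])
  have sub_t: "subalgebra M (F t)" using st by (intro subalgebra_F) auto
  have XM [measurable]: "?X \<in> borel_measurable M"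
    using measurable_from_subalg[OF sub_t L2_rv_measurable[OF increment_L2(1)]] st by auto
  \<comment> \<open>The preimages under the increment already form a sigma-algebra, so
    \<open>sigma_sets\<close> of the coordinate preimages does not leave this family.\<close>
  have gen: "{?X -` S \<inter> space M | S. S \<in> sets borel} = sets (vimage_algebra (space M) ?X borel)"
    by (subst sets_vimage_algebra2) auto
  have "indep_set (sigma_sets (space M) {f -` A \<inter> space M | A. A \<in> sets borel})
     (sigma_sets (space M) {(\<lambda>\<omega>. ?X \<omega> $ a) -` A \<inter> space M | A. A \<in> sets borel})"
    unfolding indep_set_def
  proof (rule indep_sets_mono_sets[OF W_indep[OF st, unfolded indep_set_def]])
    fix i :: bool
    have "sigma_sets (space M) {f -` A \<inter> space M | A. A \<in> sets borel} \<subseteq> sets (F s)"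
    proof -
      have sp: "space (F s) = space M" using sub by (simp add: subalgebra_def)
      have "{f -` A \<inter> space M | A. A \<in> sets borel} \<subseteq> sets (F s)"
        using measurable_sets[OF f] unfolding sp by blast
      from sets.sigma_sets_subset[OF this] show ?thesis unfolding sp .
    qed
    moreover have "sigma_sets (space M) {(\<lambda>\<omega>. ?X \<omega> $ a) -` A \<inter> space M | A. A \<in> sets borel}
        \<subseteq> {?X -` S \<inter> space M | S. S \<in> sets borel}"
    proof -
      have "{(\<lambda>\<omega>. ?X \<omega> $ a) -` A \<inter> space M | A. A \<in> sets borel} \<subseteq> {?X -` S \<inter> space M | S. S \<in> sets borel}"
      proof clarify
        fix A :: "real set" assume A: "A \<in> sets borel"
        have "(\<lambda>x::real^'n. x $ a) -` A \<inter> space borel \<in> sets borel"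
          by (rule measurable_sets[OF _ A]) measurable
        then show "\<exists>S. (\<lambda>\<omega>. ?X \<omega> $ a) -` A \<inter> space M = ?X -` S \<inter> space M \<and> S \<in> sets borel"
          by (intro exI[of _ "(\<lambda>x::real^'n. x $ a) -` A"]) auto
      qed
      then show ?thesis
        unfolding gen using sets.sigma_sets_subset[of _ "vimage_algebra (space M) ?X borel"] by simp
    qed
    ultimately show "case_bool (sigma_sets (space M) {f -` A \<inter> space M | A. A \<in> sets borel})
       (sigma_sets (space M) {(\<lambda>\<omega>. ?X \<omega> $ a) -` A \<inter> space M | A. A \<in> sets borel}) i
      \<subseteq> case_bool (sets (F s)) {?X -` S \<inter> space M | S. S \<in> sets borel} i"
      by (cases i) auto
  qed
  moreover have "(\<lambda>\<omega>. ?X \<omega> $ a) \<in> borel_measurable M" by measurable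
  ultimately show ?thesis unfolding indep_var_eq using fM by blast
qed

text \<open>By independence the expectation of each product of components factors, and the increment
  has mean 0. This removes the cross terms in the estimate of simple Ito sums.\<close>

lemma increment_orthogonal:
  assumes st: "0 \<le> s" "s \<le> t" "t \<le> T" and f: "f \<in> L2_rv M (F s)"
  shows "(LINT \<omega>|M. f \<omega> \<bullet> (W t \<omega> - W s \<omega>)) = 0"
proof (cases "s = t")
  case False
  then have "s < t" using st by simp
  let ?X = "\<lambda>\<omega>. W t \<omega> - W s \<omega>"
  have sub: "subalgebra M (F s)" "subalgebra M (F t)" using st by (auto intro!: subalgebra_F)
  have fL: "(\<lambda>\<omega>. f \<omega> $ i) \<in> L2_rv M M" for i by (rule L2_rv_vec_nth[OF L2_rv_superalgebra[OF f sub(1)]])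
  have XL: "(\<lambda>\<omega>. ?X \<omega> $ i) \<in> L2_rv M M" for i
    by (rule L2_rv_vec_nth[OF L2_rv_superalgebra[OF increment_L2(1)[OF st] sub(2)]])
  have "(LINT \<omega>|M. f \<omega> $ i * ?X \<omega> $ i) = 0" for i
  proof -
    have m: "(\<lambda>\<omega>. f \<omega> $ i) \<in> borel_measurable (F s)"
      using L2_rv_measurable[OF f] by measurable
    have "(LINT \<omega>|M. f \<omega> $ i * ?X \<omega> $ i) = (LINT \<omega>|M. f \<omega> $ i) * (LINT \<omega>|M. ?X \<omega> $ i)"
      by (rule indep_var_lebesgue_integral[OF increment_indep_var[OF st(1) \<open>s < t\<close> st(3) m]
            L2_rv_imp_integrable[OF fL] L2_rv_imp_integrable[OF XL]])
    then show ?thesis using increment_L2(3)[OF st] by simp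
  qed
  moreover have "integrable M (\<lambda>\<omega>. f \<omega> $ i * ?X \<omega> $ i)" for i
    using L2_rv_integrable_inner[OF fL XL] by simp
  ultimately show ?thesis unfolding inner_vec_def by simp
qed simp

lemma simple_ito_L2:
  fixes \<xi> :: "nat \<Rightarrow> 'a \<Rightarrow> real^'n^'k"
  assumes "simple_integrand F b N s \<xi>" "b \<le> T"
  shows "simple_ito W N s \<xi> \<in> L2_rv M (F b)"
proof -
  have s: "0 \<le> s 0" "s N \<le> b" "\<And>i. i < N \<Longrightarrow> s i \<le> s (Suc i)"
    and \<xi>: "\<And>i. i < N \<Longrightarrow> \<xi> i \<in> borel_measurable (F (s i))"
    and bd: "\<And>i. i < N \<Longrightarrow> bounded (\<xi> i ` space (F (s i)))"
    using assms(1) by (auto simp: simple_integrand_def)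
  have mono: "s i \<le> s j" if "i \<le> j" "j \<le> N" for i j
    using that
  proof (induction j rule: dec_induct)
    case (step j)
    then have "s i \<le> s j" "s j \<le> s (Suc j)" using s(3)[of j] by auto
    then show ?case by (rule order_trans)
  qed simp
  have "(\<lambda>\<omega>. \<xi> i \<omega> *v (W (s (Suc i)) \<omega> - W (s i) \<omega>)) \<in> L2_rv M (F b)" if i: "i < N" for i
  proof -
    have si: "0 \<le> s i" "s i \<le> s (Suc i)" "s (Suc i) \<le> b"
      using mono[of 0 i] mono[of "Suc i" N] s i by auto
    have sub: "subalgebra (F b) (F (s i))" "subalgebra (F b) (F (s (Suc i)))" "subalgebra M (F b)"
      "subalgebra M (F (s i))" "subalgebra M (F (s (Suc i)))"
      using subalgebra_F[of b] subalgebra_F[of "s i"] subalgebra_F[of "s (Suc i)"] si assms(2)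
        F_mono[of "s i" b] F_mono[of "s (Suc i)" b] by (auto simp: subalgebra_def)
    have X: "(\<lambda>\<omega>. W (s (Suc i)) \<omega> - W (s i) \<omega>) \<in> L2_rv M (F (s (Suc i)))"
      using si assms(2) by (intro increment_L2(1)) auto
    obtain c where c: "\<And>\<omega>. \<omega> \<in> space (F (s i)) \<Longrightarrow> norm (\<xi> i \<omega>) \<le> c"
      using bd[OF i] unfolding bounded_iff by blast
    show ?thesis
    proof (rule L2_rv_dominated[OF _ sub(3)])
      have [measurable]: "\<xi> i \<in> borel_measurable (F b)" by (rule measurable_from_subalg[OF sub(1) \<xi>[OF i]])
      have [measurable]: "(\<lambda>\<omega>. W (s (Suc i)) \<omega> - W (s i) \<omega>) \<in> borel_measurable (F b)"
        by (rule measurable_from_subalg[OF sub(2) L2_rv_measurable[OF X]])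
      show "(\<lambda>\<omega>. \<xi> i \<omega> *v (W (s (Suc i)) \<omega> - W (s i) \<omega>)) \<in> borel_measurable (F b)" by measurable
      show "integrable M (\<lambda>\<omega>. c\<^sup>2 * (norm (W (s (Suc i)) \<omega> - W (s i) \<omega>))\<^sup>2)"
        using L2_rv_integrable[OF X] by simp
      show "AE \<omega> in M. (norm (\<xi> i \<omega> *v (W (s (Suc i)) \<omega> - W (s i) \<omega>)))\<^sup>2
          \<le> c\<^sup>2 * (norm (W (s (Suc i)) \<omega> - W (s i) \<omega>))\<^sup>2"
      proof (rule AE_I2)
        fix \<omega> assume "\<omega> \<in> space M"
        then have "norm (\<xi> i \<omega>) \<le> c" using sub(4) by (intro c) (simp add: subalgebra_def)
        then have "norm (\<xi> i \<omega> *v (W (s (Suc i)) \<omega> - W (s i) \<omega>)) \<le> c * norm (W (s (Suc i)) \<omega> - W (s i) \<omega>)"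
          using norm_matrix_vector_mult_le[of "\<xi> i \<omega>" "W (s (Suc i)) \<omega> - W (s i) \<omega>"]
            mult_right_mono[of "norm (\<xi> i \<omega>)" c "norm (W (s (Suc i)) \<omega> - W (s i) \<omega>)"] by simp
        from power_mono[OF this, of 2]
        show "(norm (\<xi> i \<omega> *v (W (s (Suc i)) \<omega> - W (s i) \<omega>)))\<^sup>2 \<le> c\<^sup>2 * (norm (W (s (Suc i)) \<omega> - W (s i) \<omega>))\<^sup>2"
          by (simp add: power_mult_distrib)
      qed
    qed
  qed
  moreover have "subalgebra M (F b)"
    using mono[of 0 N] s assms(2) by (intro subalgebra_F) auto
  ultimately have "(\<lambda>\<omega>. \<Sum>i<N. \<xi> i \<omega> *v (W (s (Suc i)) \<omega> - W (s i) \<omega>)) \<in> L2_rv M (F b)"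
    by (intro L2_rv_sum) auto
  then show ?thesis by (simp add: simple_ito_def[abs_def])
qed

text \<open>\<open>has_ito_integral\<close> asks only for \<open>M\<close>-measurability of
  \<open>J\<close>. Approximating sums with error at most 2^-n have a limit in L2 of
  \<open>F b\<close>, and this limit agrees with \<open>J\<close> almost everywhere.\<close>

lemma has_ito_integral_L2:
  fixes H :: "real \<Rightarrow> 'a \<Rightarrow> real^'n^'k"
  assumes J: "has_ito_integral M F W b H J" and b: "0 \<le> b" "b \<le> T"
  obtains J' where "J' \<in> L2_rv M (F b)" "AE \<omega> in M. J \<omega> = J' \<omega>"
proof -
  obtain N s \<xi> where simple: "\<And>k. simple_integrand F b (N k) (s k) (\<xi> k)"
    and lim: "(\<lambda>k. \<integral>\<^sup>+\<omega>. ennreal ((norm (J \<omega> - simple_ito W (N k) (s k) (\<xi> k) \<omega>))\<^sup>2) \<partial>M) \<longlonglongrightarrow> 0"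
    and Jm [measurable]: "J \<in> borel_measurable M"
    using J unfolding has_ito_integral_def by blast
  have sub: "subalgebra M (F b)" using b by (intro subalgebra_F) auto
  define S where "S k = simple_ito W (N k) (s k) (\<xi> k)" for k
  have S: "S k \<in> L2_rv M (F b)" for k unfolding S_def by (rule simple_ito_L2[OF simple b(2)])
  have SM: "S k \<in> L2_rv M M" for k by (rule L2_rv_superalgebra[OF S sub])
  have [measurable]: "S k \<in> borel_measurable M" for k by (rule L2_rv_measurable[OF SM])
  have "\<exists>k. (\<integral>\<^sup>+\<omega>. ennreal ((norm (J \<omega> - S k \<omega>))\<^sup>2) \<partial>M) \<le> ennreal (((1 / 2) ^ n)\<^sup>2)" for n :: nat
  proof -
    have "eventually (\<lambda>k. (\<integral>\<^sup>+\<omega>. ennreal ((norm (J \<omega> - S k \<omega>))\<^sup>2) \<partial>M) < ennreal (((1 / 2) ^ n)\<^sup>2)) sequentially"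
      using order_tendstoD(2)[OF lim, of "ennreal (((1 / 2) ^ n)\<^sup>2)"] by (simp add: S_def)
    from eventually_happens[OF this] show ?thesis using less_imp_le by (auto simp del: power_one_over)
  qed
  then obtain \<kappa> where \<kappa>: "\<And>n. (\<integral>\<^sup>+\<omega>. ennreal ((norm (J \<omega> - S (\<kappa> n) \<omega>))\<^sup>2) \<partial>M) \<le> ennreal (((1 / 2) ^ n)\<^sup>2)"
    by metis
  have D: "(\<lambda>\<omega>. J \<omega> - S (\<kappa> n) \<omega>) \<in> L2_rv M M" "l2norm M (\<lambda>\<omega>. J \<omega> - S (\<kappa> n) \<omega>) \<le> (1 / 2) ^ n" for n
    using L2_rv_nn_integralD[OF _ \<kappa>[of n]] by auto
  have JM: "J \<in> L2_rv M M" using L2_rv_add[OF D(1) SM subalgebra_refl, of 0 "\<kappa> 0"] by simp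
  have "l2norm M (\<lambda>\<omega>. S (\<kappa> (Suc n)) \<omega> - S (\<kappa> n) \<omega>) \<le> 2 * (1 / 2) ^ n" for n
    using L2_rv_triangle_diff[OF SM[of "\<kappa> (Suc n)"] JM SM[of "\<kappa> n"]] D(2)[of n] D(2)[of "Suc n"]
      l2norm_minus_commute[of M J "S (\<kappa> (Suc n))"] zero_le_power[of "1 / 2 :: real" n]
    unfolding power_Suc by linarith
  from L2_rv_complete_geometric[OF finite_measure_M sub S this]
  obtain J' where J': "J' \<in> L2_rv M (F b)"
    "\<And>n. l2norm M (\<lambda>\<omega>. J' \<omega> - S (\<kappa> n) \<omega>) \<le> 2 * (1 / 2) ^ n / (1 - 1 / 2)" by auto
  have J'M: "J' \<in> L2_rv M M" by (rule L2_rv_superalgebra[OF J'(1) sub])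
  \<comment> \<open>5 = 1 + 4: the distance of \<open>S (\<kappa> n)\<close> to \<open>J\<close>,
    plus the geometric tail 2 / (1 - 1/2) to \<open>J'\<close>.\<close>
  have "l2norm M (\<lambda>\<omega>. J \<omega> - J' \<omega>) \<le> 5 * (1 / 2) ^ n" for n
    using L2_rv_triangle_diff[OF JM SM[of "\<kappa> n"] J'M] D(2)[of n] J'(2)[of n]
      l2norm_minus_commute[of M J' "S (\<kappa> n)"] by simp
  moreover have "(\<lambda>n. 5 * (1 / 2 :: real) ^ n) \<longlonglongrightarrow> 0"
    by (intro tendsto_mult_right_zero LIMSEQ_power_zero) simp
  ultimately have "l2norm M (\<lambda>\<omega>. J \<omega> - J' \<omega>) \<le> 0"
    by (intro LIMSEQ_le_const[where X = "\<lambda>n. 5 * (1 / 2) ^ n"]) auto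
  then have "AE \<omega> in M. J \<omega> - J' \<omega> = 0"
    by (intro l2norm_eq_0_imp_AE L2_rv_diff JM J'M subalgebra_refl) (simp add: antisym)
  then show ?thesis using J'(1) by (intro that[of J']) auto
qed

end

text \<open>Applied both to the stochastic sums and to the step functions themselves, since
  \<open>indicator {a<..b} r = of_bool (r \<le> b) - of_bool (r \<le> a)\<close>.\<close>

lemma (in bounded_bilinear) sum_refine:
  fixes w :: "nat \<Rightarrow> 'b"
  shows "(\<Sum>i<N * m. prod (a (i div m)) (w (Suc i) - w i)) = (\<Sum>j<N. prod (a j) (w (Suc j * m) - w (j * m)))"
proof -
  have "(\<Sum>i\<in>{j * m..<j * m + m}. prod (a (i div m)) (w (Suc i) - w i)) = prod (a j) (w (Suc j * m) - w (j * m))" for j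
  proof -
    have "(\<Sum>i\<in>{j * m..<j * m + m}. prod (a (i div m)) (w (Suc i) - w i))
        = (\<Sum>i\<in>{j * m..<j * m + m}. prod (a j) (w (Suc i) - w i))"
    proof (intro sum.cong refl)
      fix i assume "i \<in> {j * m..<j * m + m}"
      then have "i div m = j" by (intro div_nat_eqI) (auto simp: algebra_simps)
      then show "prod (a (i div m)) (w (Suc i) - w i) = prod (a j) (w (Suc i) - w i)" by simp
    qed
    also have "\<dots> = prod (a j) (\<Sum>i\<in>{j * m..<j * m + m}. w (Suc i) - w i)" by (simp add: sum_right)
    also have "(\<Sum>i\<in>{j * m..<j * m + m}. w (Suc i) - w i) = w (j * m + m) - w (j * m)"
      by (rule sum_Suc_diff') simp
    finally show ?thesis by (simp add: add.commute)
  qed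
  then show ?thesis by (simp add: sum.nat_group[symmetric])
qed

section \<open>Refinement of partitions and approximation by step functions\<close>

lemma bounded_bilinear_matrix_vector_mult:
  "bounded_bilinear ((*v) :: real^'m^'n \<Rightarrow> real^'m \<Rightarrow> real^'n)"
proof
  show "\<exists>K. \<forall>A x. norm ((A :: real^'m^'n) *v x) \<le> norm A * norm x * K"
    by (intro exI[of _ 1] allI) (simp add: norm_matrix_vector_mult_le)
qed (simp_all add: vec_eq_iff matrix_vector_mult_def sum_distrib_left sum.distrib algebra_simps)

text \<open>\<open>i div m\<close> is the coarse cell that contains the fine cell \<open>i\<close>.
  Sums over two nested partitions can thus be subtracted over the finer one.\<close>

lemma simple_ito_refine:
  fixes a :: "nat \<Rightarrow> real^'k^'n"
  shows "simple_ito W (N * m) s (\<lambda>i _. a (i div m)) = simple_ito W N (\<lambda>j. s (j * m)) (\<lambda>j _. a j)"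
  using bounded_bilinear.sum_refine[OF bounded_bilinear_matrix_vector_mult, of a m "\<lambda>i. W (s i) _" N]
  by (simp add: simple_ito_def fun_eq_iff)

lemma indicator_Ioc_diff:
  "a \<le> b \<Longrightarrow> indicator {a<..b} r = (of_bool (r \<le> b) - of_bool (r \<le> a) :: real)" for a b r :: real
  by (auto simp: indicator_def)

lemma simple_process_refine:
  fixes a :: "nat \<Rightarrow> real^'k^'n"
  assumes "mono s"
  shows "simple_process (N * m) s (\<lambda>i _. a (i div m)) = simple_process N (\<lambda>j. s (j * m)) (\<lambda>j _. a j)"
proof (intro ext)
  fix r \<omega>
  have *: "s i \<le> s (Suc i)" "s (j * m) \<le> s (Suc j * m)" for i j
    using monoD[OF assms] by (auto simp del: mult_Suc intro: mult_right_mono)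
  have "bounded_bilinear (\<lambda>(x :: real^'k^'n) (c :: real). c *\<^sub>R x)"
    by (rule bounded_bilinear.flip[OF bounded_bilinear_scaleR])
  note refine = bounded_bilinear.sum_refine[OF this, where a = a and m = m and N = N and w = "\<lambda>i. of_bool (r \<le> s i)"]
  show "simple_process (N * m) s (\<lambda>i _. a (i div m)) r \<omega> = simple_process N (\<lambda>j. s (j * m)) (\<lambda>j _. a j) r \<omega>"
    using refine
    by (simp add: simple_process_def indicator_Ioc_diff[OF *(1)] indicator_Ioc_diff[OF *(2)] del: mult_Suc)
qed

text \<open>The cells are disjoint, so at most one term is nonzero at \<open>r\<close> and squaring
  acts termwise.\<close>

lemma norm_simple_process:
  fixes \<xi> :: "nat \<Rightarrow> 'a \<Rightarrow> real^'k^'n"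
  assumes "mono s"
  shows "(norm (simple_process N s \<xi> r \<omega>))\<^sup>2 = (\<Sum>i<N. indicator {s i<..s (Suc i)} r * (norm (\<xi> i \<omega>))\<^sup>2)"
proof (cases "\<exists>j<N. r \<in> {s j<..s (Suc j)}")
  case True
  then obtain j where j: "j < N" "r \<in> {s j<..s (Suc j)}" by blast
  have ind: "indicator {s i<..s (Suc i)} r = (if i = j then 1 else 0 :: real)" for i
  proof (cases i j rule: linorder_cases)
    case less
    then have "s (Suc i) \<le> s j" by (intro monoD[OF assms]) simp
    with j less show ?thesis by (simp add: indicator_def)
  next
    case greater
    then have "s (Suc j) \<le> s i" by (intro monoD[OF assms]) simp
    with j greater show ?thesis by (simp add: indicator_def)
  qed (use j in simp)
  have "simple_process N s \<xi> r \<omega> = (\<Sum>i<N. if i = j then \<xi> i \<omega> else 0)"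
    unfolding simple_process_def ind by (intro sum.cong) auto
  moreover have "(\<Sum>i<N. indicator {s i<..s (Suc i)} r * (norm (\<xi> i \<omega>))\<^sup>2) = (\<Sum>i<N. if i = j then (norm (\<xi> i \<omega>))\<^sup>2 else 0)"
    unfolding ind by (intro sum.cong) auto
  ultimately show ?thesis using j(1) by simp
next
  case False
  then have "indicator {s i<..s (Suc i)} r = (0::real)" if "i < N" for i
    using that by (auto simp: indicator_def)
  then show ?thesis by (simp add: simple_process_def)
qed

lemma simple_process_diff:
  "simple_process N s (\<lambda>i \<omega>. f i \<omega> - g i \<omega>) r \<omega> = simple_process N s f r \<omega> - simple_process N s g r \<omega>"
  by (simp add: simple_process_def scaleR_diff_right sum_subtractf)

lemma simple_ito_diff:
  "simple_ito W N s (\<lambda>i \<omega>. f i \<omega> - g i \<omega>) \<omega> = simple_ito W N s f \<omega> - simple_ito W N s g \<omega>"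
  by (simp add: simple_ito_def matrix_vector_mult_diff_rdistrib sum_subtractf)

lemma simple_process_const_L2:
  fixes D :: "nat \<Rightarrow> real^'k^'n" and \<omega> :: 'a
  assumes s: "mono s" "0 \<le> s 0" "s N \<le> b"
  shows "(\<lambda>r. simple_process N s (\<lambda>i _. D i) r \<omega>) \<in> L2_rv (interval_measure_upto b) (interval_measure_upto b)"
    and "(l2norm (interval_measure_upto b) (\<lambda>r. simple_process N s (\<lambda>i _. D i) r \<omega>))\<^sup>2
      = (\<Sum>i<N. (s (Suc i) - s i) * (norm (D i))\<^sup>2)"
proof -
  have [measurable]: "(\<lambda>r. indicator {s i<..s (Suc i)} r :: real) \<in> borel_measurable (interval_measure_upto b)" for i
    by (intro measurable_restrict_space1) auto
  have fin: "integrable (interval_measure_upto b) (\<lambda>r. indicator {s i<..s (Suc i)} r * (norm (D i))\<^sup>2)" for i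
  proof -
    have "integrable (interval_measure_upto b) (\<lambda>r. indicator {s i<..s (Suc i)} r :: real)"
    proof (rule finite_measure.integrable_const_bound[OF finite_measure_interval, where B = 1])
      show "AE r in interval_measure_upto b. norm (indicator {s i<..s (Suc i)} r :: real) \<le> 1"
        by (simp add: indicator_def)
    qed measurable
    then show ?thesis by (intro integrable_mult_left)
  qed
  have m: "(\<lambda>r. simple_process N s (\<lambda>i _. D i) r \<omega>) \<in> borel_measurable (interval_measure_upto b)"
    unfolding simple_process_def by measurable
  have "integrable (interval_measure_upto b) (\<lambda>r. (norm (simple_process N s (\<lambda>i _. D i) r \<omega>))\<^sup>2)"
    unfolding norm_simple_process[OF s(1)] by (intro Bochner_Integration.integrable_sum fin)
  then show "(\<lambda>r. simple_process N s (\<lambda>i _. D i) r \<omega>) \<in> L2_rv (interval_measure_upto b) (interval_measure_upto b)"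
    using m by (simp add: L2_rv_def)
  have len: "(LINT r|interval_measure_upto b. indicator {s i<..s (Suc i)} r) = s (Suc i) - s i" if "i < N" for i
  proof -
    have le: "0 \<le> s i" "s i \<le> s (Suc i)" "s (Suc i) \<le> b"
      using monoD[OF s(1), of 0 i] monoD[OF s(1), of i "Suc i"] monoD[OF s(1), of "Suc i" N] s that by auto
    have "(LINT r|interval_measure_upto b. indicator {s i<..s (Suc i)} r)
        = (LINT r|lborel. indicator {0..b} r *\<^sub>R (indicator {s i<..s (Suc i)} r :: real))"
      by (rule integral_restrict_space) simp
    also have "\<dots> = (LINT r|lborel. (indicator {s i<..s (Suc i)} r :: real))"
      using le by (intro Bochner_Integration.integral_cong) (auto simp: indicator_def)
    also have "\<dots> = s (Suc i) - s i" using le by simp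
    finally show ?thesis .
  qed
  have "(LINT r|interval_measure_upto b. (\<Sum>i<N. indicator {s i<..s (Suc i)} r * (norm (D i))\<^sup>2))
      = (\<Sum>i<N. LINT r|interval_measure_upto b. indicator {s i<..s (Suc i)} r * (norm (D i))\<^sup>2)"
    by (rule Bochner_Integration.integral_sum) (rule fin)
  also have "\<dots> = (\<Sum>i<N. (s (Suc i) - s i) * (norm (D i))\<^sup>2)"
    by (intro sum.cong refl) (simp only: integral_mult_left_zero len lessThan_iff)
  finally show "(l2norm (interval_measure_upto b) (\<lambda>r. simple_process N s (\<lambda>i _. D i) r \<omega>))\<^sup>2
      = (\<Sum>i<N. (s (Suc i) - s i) * (norm (D i))\<^sup>2)"
    unfolding l2norm_power2 norm_simple_process[OF s(1)] .
qed

text \<open>Left end points of the intervals \<open>(i d, (i + 1) d]\<close> approach \<open>r\<close> strictly from below, so that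
  an integrand which is singular only at the right end point is dominated by its values at \<open>r\<close>.\<close>

lemma simple_process_grid_value:
  fixes H :: "real \<Rightarrow> real^'k^'n"
  assumes d: "0 < d" and r: "0 < r" "r \<le> real N * d"
  obtains x where "0 \<le> x" "x < r" "r \<le> x + d"
    "simple_process N (\<lambda>i. real i * d) (\<lambda>i _. H (real i * d)) r \<omega> = H x"
proof -
  define j where "j = nat (\<lceil>r / d\<rceil> - 1)"
  have c: "0 < \<lceil>r / d\<rceil>" using d r by simp
  then have "real j = of_int \<lceil>r / d\<rceil> - 1" by (simp add: j_def)
  then have "real j < r / d" "r / d \<le> real j + 1" by linarith+
  then have j: "real j * d < r" "r \<le> real (Suc j) * d" using d by (simp_all add: field_simps)
  have "real j * d < real N * d" using j(1) r by linarith
  then have jN: "j < N" using d by simp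
  have ind: "indicator {real i * d<..real (Suc i) * d} r = (if i = j then 1 else 0 :: real)" for i
  proof (cases i j rule: linorder_cases)
    case less
    then have "real (Suc i) * d \<le> real j * d" using d by (intro mult_right_mono) auto
    with j less show ?thesis by (simp add: indicator_def)
  next
    case greater
    then have "real (Suc j) * d \<le> real i * d" using d by (intro mult_right_mono) auto
    with j greater show ?thesis by (simp add: indicator_def)
  qed (use j in simp)
  have "simple_process N (\<lambda>i. real i * d) (\<lambda>i _. H (real i * d)) r \<omega> = (\<Sum>i<N. if i = j then H (real i * d) else 0)"
    unfolding simple_process_def ind by (intro sum.cong) auto
  also have "\<dots> = H (real j * d)" using jN by simp
  finally show ?thesis using j d by (intro that[of "real j * d"]) (simp_all add: algebra_simps)
qed

text \<open>\<open>H\<close> may blow up at \<open>b\<close>, which rules out uniform approximation.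
  Instead, dominated convergence applies: at \<open>r\<close> the step function takes the value of
  \<open>H\<close> at some \<open>x < r\<close>, bounded by \<open>g x\<close> and hence by
  \<open>g r\<close>, so the squared error is at most four times the square of \<open>g r\<close>.
  Pointwise convergence is continuity of \<open>H\<close>.\<close>

lemma dyadic_approximation:
  fixes H :: "real \<Rightarrow> real^'k^'n" and \<omega> :: 'a
  assumes b: "0 < b" and cont: "continuous_on {0..<b} H"
    and g: "g \<in> L2_rv (interval_measure_upto b) (interval_measure_upto b)"
    and mono: "\<And>x y. 0 \<le> x \<Longrightarrow> x \<le> y \<Longrightarrow> y < b \<Longrightarrow> g x \<le> (g y :: real)"
    and le: "\<And>r. 0 \<le> r \<Longrightarrow> r < b \<Longrightarrow> norm (H r) \<le> g r"
  shows "(\<lambda>k. l2norm (interval_measure_upto b)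
    (\<lambda>r. simple_process (2 ^ k) (\<lambda>i. real i * (b / 2 ^ k)) (\<lambda>i _. H (real i * (b / 2 ^ k))) r \<omega> - H r)) \<longlonglongrightarrow> 0"
proof -
  let ?N = "interval_measure_upto b"
  define S where "S k r = simple_process (2 ^ k) (\<lambda>i. real i * (b / 2 ^ k)) (\<lambda>i _. H (real i * (b / 2 ^ k))) r \<omega>" for k r
  have Hm [measurable]: "H \<in> borel_measurable ?N" by (rule borel_measurable_interval[OF cont])
  have Sm [measurable]: "S k \<in> borel_measurable ?N" for k
  proof -
    have "mono (\<lambda>i. real i * (b / 2 ^ k))" using b by (intro monoI mult_right_mono) auto
    from simple_process_const_L2(1)[OF this, of "2 ^ k" b] show ?thesis
      using b unfolding S_def[abs_def] by (intro L2_rv_measurable) simp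
  qed
  have AE: "AE r in ?N. 0 < r \<and> r < b"
  proof -
    have "AE r in lborel. r \<noteq> 0 \<and> r \<noteq> b"
      using AE_lborel_singleton[of 0] AE_lborel_singleton[of b] by eventually_elim simp
    then show ?thesis by (subst AE_restrict_space_iff) auto
  qed
  have val: "\<exists>x. 0 \<le> x \<and> x < r \<and> r \<le> x + b / 2 ^ k \<and> S k r = H x" if "0 < r" "r < b" for k r
    using simple_process_grid_value[of "b / 2 ^ k" r "2 ^ k" H \<omega>] that b unfolding S_def by auto
  have "(\<lambda>k. LINT r|?N. (norm (S k r - H r))\<^sup>2) \<longlonglongrightarrow> (LINT r|?N. (0::real))"
  proof (rule integral_dominated_convergence[where w = "\<lambda>r. 4 * (norm (g r))\<^sup>2"])
    show "integrable ?N (\<lambda>r. 4 * (norm (g r))\<^sup>2)" using L2_rv_integrable[OF g] by simp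
    show "AE r in ?N. norm ((norm (S k r - H r))\<^sup>2) \<le> 4 * (norm (g r))\<^sup>2" for k
      using AE
    proof eventually_elim
      case (elim r)
      then obtain x where x: "0 \<le> x" "x < r" "S k r = H x" using val by blast
      have "norm (S k r - H r) \<le> norm (H x) + norm (H r)" unfolding x(3) by (rule norm_triangle_ineq4)
      also have "\<dots> \<le> 2 * g r" using le[of x] le[of r] mono[of x r] x elim by auto
      finally have "(norm (S k r - H r))\<^sup>2 \<le> (2 * g r)\<^sup>2" by (intro power_mono) auto
      then show ?case by (simp add: power_mult_distrib)
    qed
    show "AE r in ?N. (\<lambda>k. (norm (S k r - H r))\<^sup>2) \<longlonglongrightarrow> 0"
      using AE
    proof eventually_elim
      case (elim r)
      then have "\<forall>k. \<exists>x. 0 \<le> x \<and> x < r \<and> r \<le> x + b / 2 ^ k \<and> S k r = H x" using val by blast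
      then obtain x where x: "\<And>k. 0 \<le> x k" "\<And>k. x k < r" "\<And>k. r \<le> x k + b / 2 ^ k" "\<And>k. S k r = H (x k)"
        by metis
      have "x \<longlonglongrightarrow> r"
      proof -
        have "(\<lambda>k. b * (1 / 2) ^ k) \<longlonglongrightarrow> 0" by (intro tendsto_mult_right_zero LIMSEQ_power_zero) simp
        then have "(\<lambda>k. b / 2 ^ k) \<longlonglongrightarrow> 0" by (simp add: power_one_over field_simps)
        from tendsto_diff[OF tendsto_const this] have low: "(\<lambda>k. r - b / 2 ^ k) \<longlonglongrightarrow> r" by simp
        have "r - b / 2 ^ k \<le> x k" "x k \<le> r" for k using x(2,3)[of k] by linarith+
        then show ?thesis
          by (intro tendsto_sandwich[OF _ _ low tendsto_const] always_eventually allI)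
      qed
      then have "(\<lambda>k. H (x k)) \<longlonglongrightarrow> H r"
      proof (rule continuous_on_tendsto_compose[OF cont])
        show "eventually (\<lambda>k. x k \<in> {0..<b}) sequentially"
        proof (intro always_eventually allI)
          fix k show "x k \<in> {0..<b}" using x(1,2)[of k] elim by simp
        qed
      qed (use elim in simp)
      then have "(\<lambda>k. norm (S k r - H r)) \<longlonglongrightarrow> 0"
        unfolding x(4) by (intro tendsto_norm_zero) (simp add: LIM_zero)
      from tendsto_power[OF this, of 2] show ?case by simp
    qed
  qed simp_all
  from tendsto_real_sqrt[OF this] show ?thesis by (simp add: l2norm_def S_def)
qed

section \<open>Existence of the Ito integral of a deterministic integrand\<close>

context standard_brownian_motion
begin

lemma simple_integrand_const:
  assumes "mono s" "0 \<le> s 0" "s N \<le> b"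
  shows "simple_integrand F b N s (\<lambda>i _. D i)"
  using assms monoD[OF assms(1)] by (auto simp: simple_integrand_def image_constant_conv)

text \<open>Only the upper bound in the Ito isometry is needed, so the covariances between the components of
  an increment do not enter.\<close>

lemma simple_ito_const_norm_le:
  fixes D :: "nat \<Rightarrow> real^'n^'k"
  assumes s: "mono s" "0 \<le> s 0" "s N \<le> T"
  shows "(l2norm M (simple_ito W N s (\<lambda>i _. D i)))\<^sup>2
    \<le> real CARD('n) * (\<Sum>i<N. (s (Suc i) - s i) * (norm (D i))\<^sup>2)"
  using s(3)
proof (induction N)
  case 0
  then show ?case by (simp add: simple_ito_def l2norm_def)
next
  case (Suc N)
  have sN: "0 \<le> s N" "s N \<le> s (Suc N)" using monoD[OF s(1), of 0 N] monoD[OF s(1), of N "Suc N"] s(2) by auto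
  then have NT: "s N \<le> T" using Suc.prems by simp
  let ?S = "simple_ito W N s (\<lambda>i _. D i)" and ?X = "\<lambda>\<omega>. W (s (Suc N)) \<omega> - W (s N) \<omega>"
  have S: "?S \<in> L2_rv M (F (s N))"
    by (rule simple_ito_L2[OF simple_integrand_const[OF s(1,2) order_refl] NT])
  have sub: "subalgebra M (F (s N))" "subalgebra M (F (s (Suc N)))"
    using sN Suc.prems by (auto intro!: subalgebra_F)
  note X = increment_L2[OF sN Suc.prems]
  have XM: "?X \<in> L2_rv M M" by (rule L2_rv_superalgebra[OF X(1) sub(2)])
  note [measurable] = L2_rv_measurable[OF S] L2_rv_measurable[OF XM]
  have DX_le: "(norm (D N *v ?X \<omega>))\<^sup>2 \<le> (norm (D N))\<^sup>2 * (norm (?X \<omega>))\<^sup>2" for \<omega>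
    unfolding power_mult_distrib[symmetric] by (intro power_mono norm_matrix_vector_mult_le) simp
  have int: "integrable M (\<lambda>\<omega>. (norm (D N))\<^sup>2 * (norm (?X \<omega>))\<^sup>2)" using L2_rv_integrable[OF XM] by simp
  have DX: "(\<lambda>\<omega>. D N *v ?X \<omega>) \<in> L2_rv M M"
    by (rule L2_rv_dominated[OF _ subalgebra_refl int]) (measurable, simp add: DX_le)
  have "(l2norm M (\<lambda>\<omega>. D N *v ?X \<omega>))\<^sup>2 \<le> (LINT \<omega>|M. (norm (D N))\<^sup>2 * (norm (?X \<omega>))\<^sup>2)"
    unfolding l2norm_power2 by (rule integral_mono[OF L2_rv_integrable[OF DX] int DX_le])
  also have "\<dots> = (norm (D N))\<^sup>2 * (real CARD('n) * (s (Suc N) - s N))"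
    using X(2) by (simp add: l2norm_power2)
  finally have last: "(l2norm M (\<lambda>\<omega>. D N *v ?X \<omega>))\<^sup>2 \<le> (norm (D N))\<^sup>2 * (real CARD('n) * (s (Suc N) - s N))" .
  have "(LINT \<omega>|M. ?S \<omega> \<bullet> (D N *v ?X \<omega>)) = (LINT \<omega>|M. (transpose (D N) *v ?S \<omega>) \<bullet> ?X \<omega>)"
    by (simp only: inner_transpose_matrix_vector[of "transpose (D N)"] transpose_transpose)
  also have "\<dots> = 0"
  proof (rule increment_orthogonal[OF sN Suc.prems])
    show "(\<lambda>\<omega>. transpose (D N) *v ?S \<omega>) \<in> L2_rv M (F (s N))"
    proof (rule L2_rv_dominated[OF _ sub(1)])
      show "integrable M (\<lambda>\<omega>. (norm (D N))\<^sup>2 * (norm (?S \<omega>))\<^sup>2)" using L2_rv_integrable[OF S] by simp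
      show "AE \<omega> in M. (norm (transpose (D N) *v ?S \<omega>))\<^sup>2 \<le> (norm (D N))\<^sup>2 * (norm (?S \<omega>))\<^sup>2"
        unfolding power_mult_distrib[symmetric] norm_transpose_matrix[of "D N", symmetric]
        by (intro AE_I2 power_mono norm_matrix_vector_mult_le) simp
    qed measurable
  qed
  finally have cross: "(LINT \<omega>|M. ?S \<omega> \<bullet> (D N *v ?X \<omega>)) = 0" .
  have "simple_ito W (Suc N) s (\<lambda>i _. D i) = (\<lambda>\<omega>. ?S \<omega> + 1 *\<^sub>R (D N *v ?X \<omega>))"
    by (simp add: simple_ito_def fun_eq_iff)
  then have "(l2norm M (simple_ito W (Suc N) s (\<lambda>i _. D i)))\<^sup>2
      = (l2norm M ?S)\<^sup>2 + (l2norm M (\<lambda>\<omega>. D N *v ?X \<omega>))\<^sup>2"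
    using L2_rv_norm_add[OF L2_rv_superalgebra[OF S sub(1)] DX, of 1] cross by simp
  then show ?case using Suc.IH[OF NT] last by (simp add: algebra_simps)
qed

lemma ito_integral_exists:
  fixes H :: "real \<Rightarrow> real^'n^'k"
  assumes T: "0 < T" and cont: "continuous_on {0..<T} H"
    and g: "g \<in> L2_rv NT NT"
    and mono: "\<And>x y. 0 \<le> x \<Longrightarrow> x \<le> y \<Longrightarrow> y < T \<Longrightarrow> g x \<le> (g y :: real)"
    and le: "\<And>r. 0 \<le> r \<Longrightarrow> r < T \<Longrightarrow> norm (H r) \<le> g r"
  obtains J where "has_ito_integral M F W T (\<lambda>r _. H r) J"
proof -
  define s where "s k i = real i * (T / 2 ^ k)" for k i :: nat
  define S where "S k = simple_ito W (2 ^ k) (s k) (\<lambda>i _. H (s k i))" for k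
  \<comment> \<open>The coefficients are deterministic, so the sample point is immaterial and
    \<open>undefined\<close> fills its place.\<close>
  define P where "P k r = simple_process (2 ^ k) (s k) (\<lambda>i (_::'a). H (s k i)) r undefined" for k r
  have P: "simple_process (2 ^ k) (s k) (\<lambda>i (_::'a). H (s k i)) r \<omega> = P k r" for k r \<omega>
    by (simp add: P_def simple_process_def)
  have s_mono: "mono (s k)" for k unfolding s_def using T by (intro monoI mult_right_mono) auto
  have s0: "0 \<le> s k 0" and sT: "s k (2 ^ k) \<le> T" for k by (simp_all add: s_def)
  have simple: "simple_integrand F T (2 ^ k) (s k) (\<lambda>i _. H (s k i))" for k
    by (rule simple_integrand_const[OF s_mono s0 sT])
  have sub: "subalgebra M (F T)" using T by (intro subalgebra_F) simp
  have SG: "S k \<in> L2_rv M (F T)" for k unfolding S_def by (rule simple_ito_L2[OF simple order_refl])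
  have SM: "S k \<in> L2_rv M M" for k by (rule L2_rv_superalgebra[OF SG sub])
  have PL: "P k \<in> L2_rv NT NT" for k
    unfolding P_def[abs_def] by (rule simple_process_const_L2(1)[OF s_mono s0 sT])
  have Hm: "H \<in> borel_measurable NT" by (rule borel_measurable_interval[OF cont])
  have AE_T: "AE r in NT. r < T"
  proof -
    have "AE r in lborel. r \<noteq> T" by (rule AE_lborel_singleton)
    then show ?thesis by (simp add: AE_NT_iff) (auto elim: eventually_mono)
  qed
  have HL: "H \<in> L2_rv NT NT"
  proof (rule L2_rv_dominated[OF Hm subalgebra_refl L2_rv_integrable[OF g]])
    show "AE r in NT. (norm (H r))\<^sup>2 \<le> (norm (g r))\<^sup>2"
      using AE_T AE_space
    proof eventually_elim
      case (elim r)
      then have "norm (H r) \<le> norm (g r)" using le[of r] by (simp add: space_NT)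
      then show ?case by (rule power_mono) simp
    qed
  qed
  have PH: "(\<lambda>k. l2norm NT (\<lambda>r. P k r - H r)) \<longlonglongrightarrow> 0"
    using dyadic_approximation[OF T cont g mono le, of undefined] unfolding P_def s_def by simp
  \<comment> \<open>The coarser sum is rewritten over the finer grid, where the difference is again
    a simple sum with constant coefficients.\<close>
  have isometry: "l2norm M (\<lambda>\<omega>. S l \<omega> - S k \<omega>) \<le> sqrt (real CARD('n)) * l2norm NT (\<lambda>r. P l r - P k r)"
    if kl: "k \<le> l" for k l
  proof -
    define m where "m = (2::nat) ^ (l - k)"
    have N: "(2::nat) ^ l = 2 ^ k * m" using kl by (simp add: m_def power_add[symmetric])
    have "real m = 2 ^ (l - k)" by (simp add: m_def)
    then have sk: "s k j = s l (j * m)" for j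
      using kl by (simp add: s_def power_diff field_simps)
    define D where "D i = H (s l i) - H (s k (i div m))" for i
    have "S k = simple_ito W (2 ^ l) (s l) (\<lambda>i _. H (s k (i div m)))"
      unfolding N simple_ito_refine[of W "2 ^ k" m "s l" "\<lambda>j. H (s k j)"] by (simp add: S_def sk[symmetric])
    then have 1: "(\<lambda>\<omega>. S l \<omega> - S k \<omega>) = simple_ito W (2 ^ l) (s l) (\<lambda>i _. D i)"
      by (simp add: S_def D_def simple_ito_diff fun_eq_iff)
    have "simple_process (2 ^ k) (s k) (\<lambda>i (_::'a). H (s k i))
        = simple_process (2 ^ l) (s l) (\<lambda>i (_::'a). H (s k (i div m)))"
      unfolding N simple_process_refine[OF s_mono, of "2 ^ k" m l "\<lambda>j. H (s k j)"] by (simp add: sk[symmetric])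
    then have 2: "(\<lambda>r. P l r - P k r) = (\<lambda>r. simple_process (2 ^ l) (s l) (\<lambda>i (_::'a). D i) r undefined)"
      by (simp add: P_def D_def simple_process_diff fun_eq_iff)
    have "(l2norm M (\<lambda>\<omega>. S l \<omega> - S k \<omega>))\<^sup>2 \<le> real CARD('n) * (l2norm NT (\<lambda>r. P l r - P k r))\<^sup>2"
      unfolding 1 2 simple_process_const_L2(2)[OF s_mono s0 sT]
      by (rule simple_ito_const_norm_le[OF s_mono s0 sT])
    also have "\<dots> = (sqrt (real CARD('n)) * l2norm NT (\<lambda>r. P l r - P k r))\<^sup>2"
      by (simp add: power_mult_distrib)
    finally show ?thesis by (rule power2_le_imp_le) simp
  qed
  \<comment> \<open>Strictly increasing levels, because \<open>isometry\<close> compares a level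
    only with a finer one.\<close>
  have "\<exists>\<kappa>. \<forall>n. l2norm NT (\<lambda>r. P (\<kappa> n) r - H r) \<le> (1 / 2) ^ n \<and> \<kappa> n < \<kappa> (Suc n)"
  proof (rule dependent_nat_choice)
    have ev: "eventually (\<lambda>k. l2norm NT (\<lambda>r. P k r - H r) \<le> (1 / 2) ^ n) sequentially" for n :: nat
      using order_tendstoD(2)[OF PH, of "(1 / 2) ^ n"] by (auto elim: eventually_mono)
    show "\<exists>k. l2norm NT (\<lambda>r. P k r - H r) \<le> (1 / 2) ^ 0"
      using eventually_happens[OF ev[of 0]] by auto
    show "\<exists>l. l2norm NT (\<lambda>r. P l r - H r) \<le> (1 / 2) ^ Suc n \<and> k < l" for k n
      using eventually_happens[OF eventually_conj[OF ev[of "Suc n"] eventually_gt_at_top[of k]]] by auto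
  qed
  then obtain \<kappa> where \<kappa>: "\<And>n. l2norm NT (\<lambda>r. P (\<kappa> n) r - H r) \<le> (1 / 2) ^ n" "\<And>n. \<kappa> n < \<kappa> (Suc n)" by blast
  have "l2norm M (\<lambda>\<omega>. S (\<kappa> (Suc n)) \<omega> - S (\<kappa> n) \<omega>) \<le> 2 * sqrt (real CARD('n)) * (1 / 2) ^ n" for n
  proof -
    have "l2norm NT (\<lambda>r. P (\<kappa> (Suc n)) r - P (\<kappa> n) r) \<le> 2 * (1 / 2) ^ n"
      using L2_rv_triangle_diff[OF PL HL PL, of "\<kappa> (Suc n)" "\<kappa> n"] \<kappa>(1)[of n] \<kappa>(1)[of "Suc n"]
        l2norm_minus_commute[of NT H "P (\<kappa> n)"] zero_le_power[of "1 / 2 :: real" n]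
      unfolding power_Suc by linarith
    from mult_left_mono[OF this, of "sqrt (real CARD('n))"]
    have "sqrt (real CARD('n)) * l2norm NT (\<lambda>r. P (\<kappa> (Suc n)) r - P (\<kappa> n) r) \<le> 2 * sqrt (real CARD('n)) * (1 / 2) ^ n"
      by (simp add: mult_ac)
    with isometry[OF less_imp_le[OF \<kappa>(2)[of n]]] show ?thesis by linarith
  qed
  from L2_rv_complete_geometric[OF finite_measure_M sub SG this]
  obtain J where J: "J \<in> L2_rv M (F T)"
    "\<And>n. l2norm M (\<lambda>\<omega>. J \<omega> - S (\<kappa> n) \<omega>) \<le> 2 * sqrt (real CARD('n)) * (1 / 2) ^ n / (1 - 1 / 2)"
    by auto
  have J2: "l2norm M (\<lambda>\<omega>. J \<omega> - S (\<kappa> n) \<omega>) \<le> 4 * sqrt (real CARD('n)) * (1 / 2) ^ n" for n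
    using J(2)[of n] by simp
  have JM: "J \<in> L2_rv M M" by (rule L2_rv_superalgebra[OF J(1) sub])
  have zero: "(\<lambda>n. c * (1 / 2 :: real) ^ n) \<longlonglongrightarrow> 0" for c
    by (intro tendsto_mult_right_zero LIMSEQ_power_zero) simp
  interpret P: pair_sigma_finite NT M by (rule pair_sigma_finite_NT)
  have PTint: "(\<integral>\<^sup>+x. ennreal ((norm (f (fst x)))\<^sup>2) \<partial>PT) = ennreal ((l2norm NT f)\<^sup>2)"
    if f: "f \<in> L2_rv NT NT" for f :: "real \<Rightarrow> real^'n^'k"
  proof -
    note [measurable] = L2_rv_measurable[OF f]
    have "(\<lambda>x. ennreal ((norm (f (fst x)))\<^sup>2)) \<in> borel_measurable PT" by measurable
    from nn_integral_fst[OF this] show ?thesis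
      by (simp add: L2_rv_nn_integral[OF f] emeasure_space_1)
  qed
  have "(\<lambda>x. H (fst x)) \<in> L2_rv PT PT"
  proof (rule L2_rv_nn_integralD(1))
    show "(\<lambda>x. H (fst x)) \<in> borel_measurable PT" using Hm by measurable
  qed (use PTint[OF HL] in auto)
  then have "case_prod (\<lambda>r (_::'a). H r) \<in> L2_rv PT PT" by (simp add: split_beta')
  then have HA: "(\<lambda>r _. H r) \<in> L2_adapted M F T" by (simp add: L2_adapted_iff)
  have lim1: "(\<lambda>n. \<integral>\<^sup>+ (r, \<omega>). ennreal ((norm (H r - simple_process (2 ^ \<kappa> n) (s (\<kappa> n)) (\<lambda>i _. H (s (\<kappa> n) i)) r \<omega>))\<^sup>2) \<partial>PT)
      \<longlonglongrightarrow> 0"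
  proof -
    have "(\<integral>\<^sup>+ (r, \<omega>). ennreal ((norm (H r - simple_process (2 ^ \<kappa> n) (s (\<kappa> n)) (\<lambda>i _. H (s (\<kappa> n) i)) r \<omega>))\<^sup>2) \<partial>PT)
        = ennreal ((l2norm NT (\<lambda>r. P (\<kappa> n) r - H r))\<^sup>2)" for n
      using PTint[OF L2_rv_diff[OF PL HL subalgebra_refl], of "\<kappa> n"]
      unfolding P by (simp add: split_beta' norm_minus_commute)
    moreover have "(\<lambda>n. ennreal ((l2norm NT (\<lambda>r. P (\<kappa> n) r - H r))\<^sup>2)) \<longlonglongrightarrow> ennreal (0\<^sup>2)"
    proof (intro tendsto_ennrealI tendsto_power)
      show "(\<lambda>n. l2norm NT (\<lambda>r. P (\<kappa> n) r - H r)) \<longlonglongrightarrow> 0"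
        by (rule tendsto_sandwich[OF _ _ tendsto_const zero[of 1]])
           (use \<kappa>(1) in \<open>auto intro!: always_eventually\<close>)
    qed
    ultimately show ?thesis by simp
  qed
  have lim2: "(\<lambda>n. \<integral>\<^sup>+\<omega>. ennreal ((norm (J \<omega> - simple_ito W (2 ^ \<kappa> n) (s (\<kappa> n)) (\<lambda>i _. H (s (\<kappa> n) i)) \<omega>))\<^sup>2) \<partial>M)
      \<longlonglongrightarrow> 0"
  proof -
    have "(\<integral>\<^sup>+\<omega>. ennreal ((norm (J \<omega> - simple_ito W (2 ^ \<kappa> n) (s (\<kappa> n)) (\<lambda>i _. H (s (\<kappa> n) i)) \<omega>))\<^sup>2) \<partial>M)
        = ennreal ((l2norm M (\<lambda>\<omega>. J \<omega> - S (\<kappa> n) \<omega>))\<^sup>2)" for n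
      using L2_rv_nn_integral[OF L2_rv_diff[OF JM SM subalgebra_refl], of "\<kappa> n"] by (simp add: S_def)
    moreover have "(\<lambda>n. ennreal ((l2norm M (\<lambda>\<omega>. J \<omega> - S (\<kappa> n) \<omega>))\<^sup>2)) \<longlonglongrightarrow> ennreal (0\<^sup>2)"
    proof (intro tendsto_ennrealI tendsto_power)
      show "(\<lambda>n. l2norm M (\<lambda>\<omega>. J \<omega> - S (\<kappa> n) \<omega>)) \<longlonglongrightarrow> 0"
        by (rule tendsto_sandwich[OF _ _ tendsto_const zero[of "4 * sqrt (real CARD('n))"]])
           (use J2 in \<open>auto intro!: always_eventually simp del: power_one_over\<close>)
    qed
    ultimately show ?thesis by simp
  qed
  have "has_ito_integral M F W T (\<lambda>r _. H r) J"
    unfolding has_ito_integral_def using HA L2_rv_measurable[OF JM]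
  proof (intro conjI exI)
    show "\<forall>n. simple_integrand F T (2 ^ \<kappa> n) (s (\<kappa> n)) (\<lambda>i _. H (s (\<kappa> n) i))" using simple by blast
  qed (use lim1 lim2 in auto)
  then show ?thesis by (rule that)
qed

end

section \<open>Complete controllability\<close>

text \<open>Complete controllability quantifies over initial functions, so at least one is needed to
  extract surjectivity from it. The derivative within the interval is determined because the
  interval is nondegenerate.\<close>

lemma zero_C1_initial:
  assumes "0 < h"
  shows "(\<lambda>_. 0) \<in> C1_initial h"
proof -
  have "vector_derivative (\<lambda>_. 0 :: real^'n) (at s within {-h..0}) = 0" if "s \<in> {-h..0}" for s
    using vector_derivative_within_cbox[of "-h" 0 s "\<lambda>_. 0 :: real^'n" 0] that assms by simp
  then have "continuous_on {-h..0} (\<lambda>s. vector_derivative (\<lambda>_. 0 :: real^'n) (at s within {-h..0}))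
      \<longleftrightarrow> continuous_on {-h..0} (\<lambda>_. 0 :: real^'n)"
    by (intro continuous_on_cong) auto
  then show ?thesis by (simp add: C1_initial_def)
qed

theorem theorem5p4:
  fixes M :: "'a measure" and F :: "real \<Rightarrow> 'a measure" and W :: "real \<Rightarrow> 'a \<Rightarrow> real^'n"
    and T h \<alpha> :: real and A B :: "real^'n^'n" and C :: "real^'m^'n"
    and \<Delta> :: "real \<Rightarrow> real^'n^'n"
  assumes "standard_brownian_motion M F T W"
    and "1 / 2 < \<alpha>" "\<alpha> < 1" and "0 < h" and "0 < T"
    and "A ** B = B ** A"
    and "CARD('m) < CARD('n)"
    and "continuous_on {0..T} \<Delta>"
  shows "completely_controllable M F W T h \<alpha> A B C \<Delta> \<longleftrightarrow>
    (\<exists>\<gamma>>0. \<forall>x\<in>L2_rv M (F T).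
      (LINT \<omega>|M. grammian M F T h \<alpha> A B C x \<omega> \<bullet> x \<omega>) \<ge> \<gamma> * (LINT \<omega>|M. (norm (x \<omega>))\<^sup>2))"
proof -
  interpret standard_brownian_motion M F T W by fact
  note T = \<open>0 < T\<close> and \<alpha> = \<open>1 / 2 < \<alpha>\<close> \<open>\<alpha> < 1\<close>
  have sub: "subalgebra M (F T)" using T by (intro subalgebra_F) simp
  define E where "E r = delayed_ML2 h \<alpha> \<alpha> A B (T - h - r)" for r
  define K where "K r = E r ** C" for r
  define H where "H r = E r ** \<Delta> r" for r
  have E_cont: "continuous_on {0..<T} E"
    unfolding E_def[abs_def] by (rule continuous_on_delayed_kernel) fact+
  obtain c where c: "0 \<le> c" "\<And>r. r \<in> {0..T} \<Longrightarrow> norm (E r) \<le> c * (T - r) powr (\<alpha> - 1)"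
    unfolding E_def using delayed_kernel_bound[OF \<alpha> \<open>0 < h\<close> T, of A B] by blast
  note frac = L2_fractional_kernel[OF \<alpha> \<open>0 < h\<close> T]
  have "compact (\<Delta> ` {0..T})" by (intro compact_continuous_image) (fact, simp)
  from compact_imp_bounded[OF this] obtain D where "\<forall>x\<in>\<Delta> ` {0..T}. norm x \<le> D"
    unfolding bounded_iff by blast
  then have D: "norm (\<Delta> r) \<le> D" if "r \<in> {0..T}" for r using that by blast
  have D0: "0 \<le> D" using order_trans[OF norm_ge_zero D[of 0]] T by simp
  have K: "K \<in> L2_rv NT NT"
  proof (rule L2_rv_dominated[OF _ subalgebra_refl])
    show "K \<in> borel_measurable NT"
      unfolding K_def[abs_def] by (intro borel_measurable_interval continuous_intros E_cont)
    show "integrable NT (\<lambda>r. (c * norm C)\<^sup>2 * (norm ((T - r) powr (\<alpha> - 1)))\<^sup>2)"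
      using L2_rv_integrable[OF frac] by simp
    show "AE r in NT. (norm (K r))\<^sup>2 \<le> (c * norm C)\<^sup>2 * (norm ((T - r) powr (\<alpha> - 1)))\<^sup>2"
    proof (rule AE_I2)
      fix r assume "r \<in> space NT"
      then have "norm (E r) * norm C \<le> c * (T - r) powr (\<alpha> - 1) * norm C"
        by (intro mult_right_mono c) (simp_all add: space_NT)
      then have "norm (K r) \<le> c * norm C * norm ((T - r) powr (\<alpha> - 1))"
        using norm_matrix_matrix_mult_le[of "E r" C] by (simp add: K_def mult_ac)
      from power_mono[OF this, of 2]
      show "(norm (K r))\<^sup>2 \<le> (c * norm C)\<^sup>2 * (norm ((T - r) powr (\<alpha> - 1)))\<^sup>2"
        by (simp add: power_mult_distrib)
    qed
  qed
  obtain J where "has_ito_integral M F W T (\<lambda>r _. H r) J"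
  \<comment> \<open>This majorant increases with \<open>r\<close> because \<alpha> - 1 < 0, as the
    approximation from the left requires.\<close>
  proof (rule ito_integral_exists[OF T, of H "\<lambda>r. c * D * (T - r) powr (\<alpha> - 1)"])
    show "continuous_on {0..<T} H"
      unfolding H_def[abs_def]
      by (intro continuous_intros E_cont continuous_on_subset[OF \<open>continuous_on {0..T} \<Delta>\<close>]) auto
    show "(\<lambda>r. c * D * (T - r) powr (\<alpha> - 1)) \<in> L2_rv NT NT"
      using L2_rv_scaleR[OF frac, of "c * D"] by simp
    show "c * D * (T - x) powr (\<alpha> - 1) \<le> c * D * (T - y) powr (\<alpha> - 1)" if "0 \<le> x" "x \<le> y" "y < T" for x y
      using that c(1) D0 \<alpha> by (intro mult_left_mono powr_mono2') auto
    show "norm (H r) \<le> c * D * (T - r) powr (\<alpha> - 1)" if "0 \<le> r" "r < T" for r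
    proof -
      have "norm (H r) \<le> norm (E r) * norm (\<Delta> r)" unfolding H_def by (rule norm_matrix_matrix_mult_le)
      also have "\<dots> \<le> c * (T - r) powr (\<alpha> - 1) * D"
        using that c(1) by (intro mult_mono c D) auto
      finally show ?thesis by (simp add: mult_ac)
    qed
  qed blast
  \<comment> \<open>Existence of some integral makes the \<open>SOME\<close> in
    \<open>ito_integral\<close> return one.\<close>
  then have ito: "has_ito_integral M F W T (\<lambda>r _. H r) (ito_integral M F W T (\<lambda>r _. H r))"
    unfolding ito_integral_def by (rule someI[where P = "has_ito_integral M F W T (\<lambda>r _. H r)"])
  obtain J' where J': "J' \<in> L2_rv M (F T)" "AE \<omega> in M. ito_integral M F W T (\<lambda>r _. H r) \<omega> = J' \<omega>"
    using has_ito_integral_L2[OF ito] T by auto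
  \<comment> \<open>The deterministic part of the terminal state, governed by the initial
    function.\<close>
  define v where "v \<phi> = delayed_ML1 h \<alpha> A B T *v \<phi> (- h)
    + (LINT r:{-h..0}|lborel. delayed_ML1 h \<alpha> A B (T - h - r) *v vector_derivative \<phi> (at r within {-h..0}))" for \<phi>
  have solution: "delay_solution M F W h \<alpha> A B C \<Delta> \<phi> u T \<omega>
      = v \<phi> + control_map T K u \<omega> + ito_integral M F W T (\<lambda>r _. H r) \<omega>" for \<phi> u \<omega>
    using T unfolding delay_solution_def v_def control_map_def K_def H_def E_def
    by (simp add: matrix_vector_mul_assoc)
  have affine_L2: "(\<lambda>\<omega>. v \<phi> + J' \<omega>) \<in> L2_rv M (F T)" for \<phi>
    by (intro L2_rv_add L2_rv_const finite_measure_M J' sub)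
  have "completely_controllable M F W T h \<alpha> A B C \<Delta> \<longleftrightarrow>
      (\<forall>y\<in>L2_rv M (F T). \<exists>u\<in>L2_adapted M F T. AE \<omega> in M. control_map T K u \<omega> = y \<omega>)"
  proof
    assume cc: "completely_controllable M F W T h \<alpha> A B C \<Delta>"
    show "\<forall>y\<in>L2_rv M (F T). \<exists>u\<in>L2_adapted M F T. AE \<omega> in M. control_map T K u \<omega> = y \<omega>"
    proof
      fix y :: "'a \<Rightarrow> real^'n" assume y: "y \<in> L2_rv M (F T)"
      \<comment> \<open>The target is \<open>y\<close> shifted by the part of the state that no
        control affects, so a control reaching it is mapped to \<open>y\<close>. \<open>J'\<close>
        stands in for the Ito integral, as it is \<open>F T\<close>-measurable.\<close>
      have "(\<lambda>\<omega>. y \<omega> + (v (\<lambda>_. 0) + J' \<omega>)) \<in> L2_rv M (F T)" by (intro L2_rv_add y affine_L2 sub)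
      from bspec[OF bspec[OF cc[unfolded completely_controllable_def] zero_C1_initial[OF \<open>0 < h\<close>]] this]
      obtain u where u: "u \<in> L2_adapted M F T"
        "AE \<omega> in M. delay_solution M F W h \<alpha> A B C \<Delta> (\<lambda>_. 0) u T \<omega> = y \<omega> + (v (\<lambda>_. 0) + J' \<omega>)"
        by blast
      have "AE \<omega> in M. control_map T K u \<omega> = y \<omega>"
        using u(2) J'(2) unfolding solution by eventually_elim (simp add: algebra_simps)
      with u(1) show "\<exists>u\<in>L2_adapted M F T. AE \<omega> in M. control_map T K u \<omega> = y \<omega>" by blast
    qed
  next
    assume surj: "\<forall>y\<in>L2_rv M (F T). \<exists>u\<in>L2_adapted M F T. AE \<omega> in M. control_map T K u \<omega> = y \<omega>"
    show "completely_controllable M F W T h \<alpha> A B C \<Delta>"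
      unfolding completely_controllable_def
    proof (intro ballI)
      fix \<phi> and x1 :: "'a \<Rightarrow> real^'n"
      assume "x1 \<in> L2_rv M (F T)"
      then have "(\<lambda>\<omega>. x1 \<omega> - (v \<phi> + J' \<omega>)) \<in> L2_rv M (F T)" by (intro L2_rv_diff affine_L2 sub)
      from bspec[OF surj this] obtain u where u: "u \<in> L2_adapted M F T"
        "AE \<omega> in M. control_map T K u \<omega> = x1 \<omega> - (v \<phi> + J' \<omega>)" by blast
      have "AE \<omega> in M. delay_solution M F W h \<alpha> A B C \<Delta> \<phi> u T \<omega> = x1 \<omega>"
        using u(2) J'(2) unfolding solution by eventually_elim (simp add: algebra_simps)
      with u(1) show "\<exists>u\<in>L2_adapted M F T. AE \<omega> in M. delay_solution M F W h \<alpha> A B C \<Delta> \<phi> u T \<omega> = x1 \<omega>"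
        by blast
    qed
  qed
  also have "\<dots> \<longleftrightarrow> (\<exists>\<gamma>>0. \<forall>x\<in>L2_rv M (F T). \<gamma> * (l2norm M x)\<^sup>2 \<le>
      (LINT \<omega>|M. control_map T K (dual_control K (cond_exp_process M F T x)) \<omega> \<bullet> x \<omega>))"
    by (rule control_map_surjective_iff[OF T K])
  also have "\<dots> \<longleftrightarrow> (\<exists>\<gamma>>0. \<forall>x\<in>L2_rv M (F T).
      (LINT \<omega>|M. grammian M F T h \<alpha> A B C x \<omega> \<bullet> x \<omega>) \<ge> \<gamma> * (LINT \<omega>|M. (norm (x \<omega>))\<^sup>2))"
  proof -
    \<comment> \<open>Hence the Grammian kernel is \<open>K r\<close> times its transpose, and the
      Grammian is the control map applied to the dual control for the version chosen by
      \<open>cond_exp_process\<close>.\<close>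
    have "transpose (E r) = delayed_ML2 h \<alpha> \<alpha> (transpose A) (transpose B) (T - h - r)" for r
      unfolding E_def using \<alpha> \<open>A ** B = B ** A\<close> by (intro transpose_delayed_ML2) auto
    then have "grammian M F T h \<alpha> A B C x = control_map T K (dual_control K (cond_exp_process M F T x))" for x
      by (simp add: fun_eq_iff grammian_def control_map_def dual_control_def K_def E_def[symmetric]
        matrix_transpose_mul matrix_vector_mul_assoc matrix_mul_assoc del: transpose_matrix_vector)
    then show ?thesis by (simp only: l2norm_power2)
  qed
  finally show ?thesis .
qed

end
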